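(* Let $d\ge1$, let $H$ be a connected graph on $k\ge2$ vertices, let $\theta\ge1$ and let $S\subseteq\mathbb R^d$ be a Borel set with $S=-S$ and $B(0,1)\subseteq S\subseteq B(0,\theta)$. Let $\mu$ be a non-zero locally finite measure on $\mathbb R^d$ with a Lebesgue density $m$, let $(\rho_t)_{t\in\mathbb N}$ be a sequence of positive reals with $\rho_t\to0$, and let $(\eta_t)_{t\in\mathbb N}$ be Poisson point processes in $\mathbb R^d$, defined on a common probability space, where $\eta_t$ has intensity measure $t\mu$. Let $N_t$ be the number of (not necessarily induced) subgraphs isomorphic to $H$ in $\mathfrak G_{\rho_tS}(\eta_t)$, and assume $N_t<\infty$ almost surely for every $t$. Assume that: (i) there exists a constant $a>0$ such that $\mathbb E N_t\sim a\,t^k\rho_t^{d(k-1)}$ as $t\to\infty$; (ii) there exist constants $A^{(n)}>0$, $1\le n\le k$, such that $$\mathbb V N_t\sim t^k\rho_t^{d(k-1)}\sum_{n=1}^k(t\rho_t^d)^{k-n}A^{(n)}\quad\text{as }t\to\infty;$$ (iii) for some $\gamma>0$, $\displaystyle\liminf_{t\to\infty}t^{k-\gamma}\rho_t^{d(k-1)}>0$. Then, with $a=\lim_{t\to\infty}\mathbb E N_t/(t^k\rho_t^{d(k-1)})$, $$\frac{N_t}{t^k\rho_t^{d(k-1)}}\longrightarrow a\quad\text{almost surely as }t\to\infty .$$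
   Context: $B(x,r)$ is the closed Euclidean ball with center $x$ and radius $r$. For a set $T\subseteq\mathbb R^d$ with $T=-T$ and a countable set $\xi\subset\mathbb R^d$, $\mathfrak G_T(\xi)$ is the graph with vertex set $\xi$ and an edge between distinct $x,y\in\xi$ whenever $x-y\in T$. Formally, $$N_t=\frac1{k!}\sum_{\mathbf x\in(\eta_t)^k_{\neq}}\left|\{\text{subgraphs }H'\text{ of }\mathfrak G_{\rho_tS}(\{x_1,\dots,x_k\}):H'\cong H\}\right|,$$ where $(\eta_t)^k_{\neq}$ is the set of $k$-tuples of pairwise distinct points of $\eta_t$ and subgraphs need not be induced. $a_t\sim b_t$ means $\lim_{t\to\infty}a_t/b_t=1$. $\mathbb N=\{1,2,\dots\}$. *)

theory Defs
  imports "HOL-Probability.Probability" "HOL-Library.Landau_Symbols"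
begin

datatype 'v ugraph = UGraph (verts: "'v set") (edges: "'v set set")

definition simple_graph :: "'v ugraph \<Rightarrow> bool" where
  "simple_graph G \<longleftrightarrow> (\<forall>e\<in>edges G. e \<subseteq> verts G \<and> card e = 2)"

definition connected_graph :: "'v ugraph \<Rightarrow> bool" where
  "connected_graph G \<longleftrightarrow>
     verts G \<noteq> {} \<and> (\<forall>u\<in>verts G. \<forall>v\<in>verts G. (u, v) \<in> {(x, y). {x, y} \<in> edges G}\<^sup>*)"

definition subgraph_of :: "'v ugraph \<Rightarrow> 'v ugraph \<Rightarrow> bool" where
  "subgraph_of G' G \<longleftrightarrow> simple_graph G' \<and> verts G' \<subseteq> verts G \<and> edges G' \<subseteq> edges G"

definition graph_iso :: "'v ugraph \<Rightarrow> 'w ugraph \<Rightarrow> bool" where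
  "graph_iso G G' \<longleftrightarrow>
     (\<exists>f. bij_betw f (verts G) (verts G') \<and>
        (\<forall>u\<in>verts G. \<forall>v\<in>verts G. {u, v} \<in> edges G \<longleftrightarrow> {f u, f v} \<in> edges G'))"

definition geometric_graph :: "'a::euclidean_space set \<Rightarrow> 'a set \<Rightarrow> 'a ugraph" where
  "geometric_graph T \<xi> = UGraph \<xi> {{x, y} | x y. x \<in> \<xi> \<and> y \<in> \<xi> \<and> x \<noteq> y \<and> x - y \<in> T}"

(* The integral with respect to the counting measure is the sum over all tuples of
   pairwise distinct points of \<xi>, with value \<infinity> if the sum diverges. *)
definition subgraph_count :: "'v ugraph \<Rightarrow> 'a::euclidean_space set \<Rightarrow> 'a set \<Rightarrow> ennreal" where
  "subgraph_count H T \<xi> =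
     (\<integral>\<^sup>+ xs. of_nat (card {H'. subgraph_of H' (geometric_graph T (set xs)) \<and> graph_iso H' H})
        \<partial>count_space {xs. length xs = card (verts H) \<and> distinct xs \<and> set xs \<subseteq> \<xi>})
     / of_nat (fact (card (verts H)))"

definition point_count :: "'a set \<Rightarrow> 'a set \<Rightarrow> ennreal" where
  "point_count \<xi> B = emeasure (count_space UNIV) (\<xi> \<inter> B)"

(* A Poisson process is modelled as a random locally finite point set. This loses nothing
   for diffuse intensity measures \<Lambda>, whose Poisson processes are almost surely simple;
   it is not adequate for \<Lambda> with atoms. *)
definition poisson_process ::
    "'w measure \<Rightarrow> 'a::euclidean_space measure \<Rightarrow> ('w \<Rightarrow> 'a set) \<Rightarrow> bool" where
  "poisson_process M \<Lambda> \<eta> \<longleftrightarrow>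
     prob_space M \<and>
     (\<forall>\<omega>\<in>space M. \<forall>B. bounded B \<longrightarrow> finite (\<eta> \<omega> \<inter> B)) \<and>
     (\<forall>B\<in>sets borel. (\<lambda>\<omega>. point_count (\<eta> \<omega>) B) \<in> borel_measurable M) \<and>
     (\<forall>B\<in>sets borel. emeasure \<Lambda> B < \<infinity> \<longrightarrow>
        (\<forall>n. measure M {\<omega> \<in> space M. point_count (\<eta> \<omega>) B = of_nat n}
             = measure \<Lambda> B ^ n / fact n * exp (- measure \<Lambda> B))) \<and>
     (\<forall>B\<in>sets borel. emeasure \<Lambda> B = \<infinity> \<longrightarrow> (AE \<omega> in M. point_count (\<eta> \<omega>) B = \<infinity>)) \<and>
     (\<forall>(n::nat) B. (\<forall>i<n. B i \<in> sets borel) \<longrightarrow> disjoint_family_on B {..<n} \<longrightarrow>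
        prob_space.indep_vars M (\<lambda>_. borel) (\<lambda>i \<omega>. point_count (\<eta> \<omega>) (B i)) {..<n})"

end

(* For each t we bound the probability that N_t deviates from its mean by a summable sequence, so that
   Borel-Cantelli applies.  Chebyshev's inequality does not give summability, so we use central moments
   of high order 2h.
   N_t is approximated in L^1 by a multilinear polynomial F in the independent Poisson counts of the
   cells of a fine grid.  In the expansion of E (F - E F)^(2h) over 2h-tuples of k-sets of cells, every
   tuple containing a k-set disjoint from all the others contributes 0, so the remaining tuples involve
   at most h(2k - 1) distinct cells.  As only local k-sets occur, each new cell costs a factor at most B,
   a bound for the intensity of a ball of radius comparable to rho_t, whence
   E (F - E F)^(2h) = O(B^(h(2k - 1))).  Finally k! E N_t >= (t mu(Q))^k for every Q of diameter at most
   rho_t, since all points in Q are adjacent; hence B may be taken proportional to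
   V^(1/k), where V = t^k rho_t^(d(k-1)), and the deviation probability is O(V^(-h/k)).  Assumption
   (iii) makes V grow at least like t^gamma. *)
theory Submission
  imports Defs
begin

section \<open>Central moments of multilinear polynomials in independent variables\<close>

text \<open>The main obstacle is that \<open>S\<close> is merely Borel: the adjacency pattern of a
  tuple need not be constant on the boxes of any grid, however fine. A grid polynomial can therefore
  approximate only in mean, by way of the sigma-algebra generated by unions of boxes. This is enough
  because the polynomial may depend on the accuracy while its moment bound does not: Markov's
  inequality absorbs an arbitrarily small L^1 error, and high moments are estimated only for
  polynomials, never for \<open>N_t\<close> itself. Multilinearity comes from keeping only tuples
  whose points lie in distinct cells; the others vanish in mean as the grid is refined. Cells are
  taken so fine that each has intensity at most 1. All moments of a cell count are then linear in
  its intensity, so a tuple of \<open>k\<close>-sets is charged for the cells that occur and not for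
  their multiplicities. Locality of the \<open>k\<close>-sets comes from connectedness of
  \<open>H\<close>. With \<open>h = k q\<close> and \<open>q\<close> at least
  \<open>2 / \<gamma>\<close> the final bound is of order \<open>t^(-2)\<close>.\<close>

lemma sum_prod_Pow_le_exp:
  fixes w :: "'i \<Rightarrow> real"
  assumes "finite X" "\<And>i. i \<in> X \<Longrightarrow> 0 \<le> w i"
  shows "(\<Sum>A\<in>Pow X. \<Prod>i\<in>A. w i) \<le> exp (\<Sum>i\<in>X. w i)"
proof -
  \<comment> \<open>Expanding the product of the factors \<open>w i + 1\<close> yields one summand
    per subset. Subsets of every size are counted, so the bound depends on the total weight of
    \<open>X\<close> and not on its cardinality.\<close>
  have "(\<Sum>A\<in>Pow X. \<Prod>i\<in>A. w i) = (\<Prod>i\<in>X. w i + 1)"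
    using prod_add[OF assms(1), of w "\<lambda>_. 1"] by simp
  also have "\<dots> \<le> (\<Prod>i\<in>X. exp (w i))"
    by (intro prod_mono) (use assms exp_ge_add_one_self in \<open>auto simp: add.commute\<close>)
  finally show ?thesis by (simp add: exp_sum assms(1))
qed

lemma sum_funcset_Suc:
  fixes f :: "(nat \<Rightarrow> 'b) \<Rightarrow> 'c :: comm_monoid_add"
  shows "(\<Sum>g\<in>{..<Suc q} \<rightarrow>\<^sub>E S. f g) = (\<Sum>g\<in>{..<q} \<rightarrow>\<^sub>E S. \<Sum>y\<in>S. f (g(q := y)))"
proof -
  have "(\<Sum>g\<in>{..<Suc q} \<rightarrow>\<^sub>E S. f g) = sum f ((\<lambda>(y, g). g(q := y)) ` (S \<times> ({..<q} \<rightarrow>\<^sub>E S)))"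
    by (simp add: lessThan_Suc PiE_insert_eq)
  also have "\<dots> = (\<Sum>(y, g)\<in>S \<times> ({..<q} \<rightarrow>\<^sub>E S). f (g(q := y)))"
    using inj_combinator[of q "{..<q}" "\<lambda>_. S"]
    by (subst sum.reindex) (auto simp: case_prod_unfold o_def)
  also have "\<dots> = (\<Sum>y\<in>S. \<Sum>g\<in>{..<q} \<rightarrow>\<^sub>E S. f (g(q := y)))"
    by (simp add: sum.cartesian_product)
  also have "\<dots> = (\<Sum>g\<in>{..<q} \<rightarrow>\<^sub>E S. \<Sum>y\<in>S. f (g(q := y)))"
    by (rule sum.swap)
  finally show ?thesis .
qed

text \<open>With \<open>w\<close> the cell intensities divided by \<open>B\<close>, this bounds the cost of adding one more local
  set \<open>J\<close> to a tuple whose members already cover \<open>U\<close>: either \<open>J\<close> misses \<open>U\<close>, or all of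
  \<open>J - U\<close> is near one of the few points of \<open>U\<close>.\<close>

lemma sum_prod_Diff_le:
  fixes w :: "'i \<Rightarrow> real" and c :: "'i set \<Rightarrow> real"
  assumes "finite I" "\<And>i. i \<in> I \<Longrightarrow> 0 \<le> w i"
    and JJ: "\<J> \<subseteq> Pow I"
    and c: "\<And>J. J \<in> \<J> \<Longrightarrow> 0 \<le> c J \<and> c J \<le> D"
    and near: "\<And>J i j. J \<in> \<J> \<Longrightarrow> c J \<noteq> 0 \<Longrightarrow> i \<in> J \<Longrightarrow> j \<in> J \<Longrightarrow> near i j"
    and w1: "\<And>i. i \<in> I \<Longrightarrow> (\<Sum>j\<in>{j \<in> I. near i j}. w j) \<le> 1"
    and cw: "(\<Sum>J\<in>\<J>. c J * (\<Prod>i\<in>J. w i)) \<le> D"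
    and U: "U \<subseteq> I"
  shows "(\<Sum>J\<in>\<J>. c J * (\<Prod>i\<in>J - U. w i)) \<le> D * (1 + 3 * 2 ^ card U)"
proof -
  have fJ: "finite \<J>" using JJ assms(1) by (meson finite_Pow_iff finite_subset)
  have fU: "finite U" using U assms(1) finite_subset by auto
  have pos: "0 \<le> (\<Prod>i\<in>A. w i)" if "A \<subseteq> I" for A using that assms(2) by (auto intro!: prod_nonneg)
  have D0: "0 \<le> D"
    by (rule order_trans[OF sum_nonneg cw]) (use c pos JJ in auto)
  define J1 where "J1 = {J \<in> \<J>. J \<inter> U = {}}"
  \<comment> \<open>Among the sets meeting \<open>U\<close> only those with nonzero coefficient
    matter; their members are pairwise \<open>near\<close>.\<close>
  define J2 where "J2 = {J \<in> \<J>. J \<inter> U \<noteq> {} \<and> c J \<noteq> 0}"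
  have "(\<Sum>J\<in>\<J>. c J * (\<Prod>i\<in>J - U. w i)) = (\<Sum>J\<in>J1 \<union> J2. c J * (\<Prod>i\<in>J - U. w i))"
    by (rule sum.mono_neutral_right) (auto simp: J1_def J2_def fJ)
  also have "\<dots> = (\<Sum>J\<in>J1. c J * (\<Prod>i\<in>J - U. w i)) + (\<Sum>J\<in>J2. c J * (\<Prod>i\<in>J - U. w i))"
    by (rule sum.union_disjoint) (auto simp: J1_def J2_def fJ)
  also have "(\<Sum>J\<in>J1. c J * (\<Prod>i\<in>J - U. w i)) = (\<Sum>J\<in>J1. c J * (\<Prod>i\<in>J. w i))"
    by (intro sum.cong) (auto simp: J1_def Diff_triv)
  also have "\<dots> \<le> (\<Sum>J\<in>\<J>. c J * (\<Prod>i\<in>J. w i))"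
    using c pos JJ by (intro sum_mono2) (auto simp: J1_def fJ)
  also have "\<dots> \<le> D" by (rule cw)
  also have "(\<Sum>J\<in>J2. c J * (\<Prod>i\<in>J - U. w i)) \<le> (\<Sum>J\<in>J2. D * (\<Prod>i\<in>J - U. w i))"
  proof (intro sum_mono mult_right_mono pos)
    show "c J \<le> D" "J - U \<subseteq> I" if "J \<in> J2" for J using that c JJ by (auto simp: J2_def)
  qed
  also have "\<dots> = D * (\<Sum>J\<in>J2. \<Prod>i\<in>J - U. w i)" by (simp add: sum_distrib_left)
  also have "\<dots> \<le> D * (3 * 2 ^ card U)"
  proof (rule mult_left_mono[OF _ D0])
    \<comment> \<open>A set \<open>J\<close> in \<open>J2\<close> is encoded by the pair
      \<open>(J \<inter> U, J - U)\<close>. The first entry has at most \<open>2 ^ card U\<close>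
      values; the second is a subset of the cells near one chosen point of the first, and summing
      over all such subsets costs at most \<open>exp 1 \<le> 3\<close>.\<close>
    define N where "N T = {j \<in> I. near (SOME u. u \<in> T) j}" for T
    define h where "h J = (J \<inter> U, J - U)" for J :: "'i set"
    have inj: "inj_on h J2" by (auto simp: inj_on_def h_def)
    have sub: "h ` J2 \<subseteq> Sigma (Pow U - {{}}) (\<lambda>T. Pow (N T))"
    proof
      fix y assume "y \<in> h ` J2"
      then obtain J where J: "J \<in> J2" "y = h J" by auto
      hence "\<exists>u. u \<in> J \<inter> U" unfolding J2_def by blast
      hence s: "(SOME u. u \<in> J \<inter> U) \<in> J \<inter> U" by (rule someI_ex)
      have "J \<in> \<J>" "c J \<noteq> 0" using J by (auto simp: J2_def)
      hence JN: "J - U \<subseteq> N (J \<inter> U)" using s near[of J "SOME u. u \<in> J \<inter> U"] JJ by (auto simp: N_def)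
      show "y \<in> Sigma (Pow U - {{}}) (\<lambda>T. Pow (N T))"
        using J JN by (auto simp: h_def J2_def)
    qed
    have fN: "finite (N T)" for T using assms(1) by (auto simp: N_def)
    have "(\<Sum>J\<in>J2. \<Prod>i\<in>J - U. w i) = (\<Sum>y\<in>h ` J2. \<Prod>i\<in>snd y. w i)"
      by (subst sum.reindex[OF inj]) (simp add: h_def)
    also have "\<dots> \<le> (\<Sum>y\<in>Sigma (Pow U - {{}}) (\<lambda>T. Pow (N T)). \<Prod>i\<in>snd y. w i)"
      by (intro sum_mono2 sub) (auto intro!: pos simp: fU fN N_def assms(1))
    also have "\<dots> = (\<Sum>T\<in>Pow U - {{}}. \<Sum>A\<in>Pow (N T). \<Prod>i\<in>A. w i)"
      by (subst sum.Sigma) (auto simp: fU fN case_prod_unfold)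
    also have "\<dots> \<le> (\<Sum>T\<in>Pow U - {{}}. 3)"
    proof (rule sum_mono)
      fix T assume T: "T \<in> Pow U - {{}}"
      hence "\<exists>u. u \<in> T" by auto
      hence "(SOME u. u \<in> T) \<in> T" by (rule someI_ex)
      hence sI: "(SOME u. u \<in> T) \<in> I" using T U by auto
      have "(\<Sum>A\<in>Pow (N T). \<Prod>i\<in>A. w i) \<le> exp (\<Sum>i\<in>N T. w i)"
        by (rule sum_prod_Pow_le_exp[OF fN]) (auto simp: N_def assms(2))
      also have "\<dots> \<le> exp 1" using w1[OF sI] by (simp add: N_def)
      also have "\<dots> \<le> 3" by (rule exp_le)
      finally show "(\<Sum>A\<in>Pow (N T). \<Prod>i\<in>A. w i) \<le> 3" .
    qed
    also have "\<dots> = 3 * real (card (Pow U - {{}}))" by simp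
    also have "real (card (Pow U - {{}})) \<le> real (card (Pow U))"
      using fU by (intro of_nat_mono card_mono) auto
    also have "\<dots> = 2 ^ card U" using fU by (simp add: card_Pow)
    finally show "(\<Sum>J\<in>J2. \<Prod>i\<in>J - U. w i) \<le> 3 * 2 ^ card U" by simp
  qed
  finally show ?thesis by (simp add: algebra_simps)
qed

text \<open>Induction on the length \<open>q\<close>: the last set is split off, the product over
  the union factors into the old union and the new cells, and \<open>sum_prod_Diff_le\<close> bounds
  the inner sum. The old union never has more than \<open>p * k\<close> elements, so with
  \<open>p\<close> fixed beforehand every step costs the same factor.\<close>

lemma sum_tuples_prod_UN_le:
  fixes w :: "'i \<Rightarrow> real" and c :: "'i set \<Rightarrow> real"
  assumes "finite I" "\<And>i. i \<in> I \<Longrightarrow> 0 \<le> w i"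
    and JJ: "\<J> \<subseteq> Pow I" "\<And>J. J \<in> \<J> \<Longrightarrow> card J = k"
    and c: "\<And>J. J \<in> \<J> \<Longrightarrow> 0 \<le> c J \<and> c J \<le> D"
    and near: "\<And>J i j. J \<in> \<J> \<Longrightarrow> c J \<noteq> 0 \<Longrightarrow> i \<in> J \<Longrightarrow> j \<in> J \<Longrightarrow> near i j"
    and w1: "\<And>i. i \<in> I \<Longrightarrow> (\<Sum>j\<in>{j \<in> I. near i j}. w j) \<le> 1"
    and cw: "(\<Sum>J\<in>\<J>. c J * (\<Prod>i\<in>J. w i)) \<le> D"
    and "q \<le> p"
  shows "(\<Sum>g\<in>{..<q} \<rightarrow>\<^sub>E \<J>. (\<Prod>l<q. c (g l)) * (\<Prod>i\<in>(\<Union>l<q. g l). w i))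
           \<le> (D * (1 + 3 * 2 ^ (p * k))) ^ q"
  using \<open>q \<le> p\<close>
proof (induction q)
  case 0
  show ?case by simp
next
  case (Suc q)
  have pos: "0 \<le> (\<Prod>i\<in>A. w i)" if "A \<subseteq> I" for A using that assms(2) by (auto intro!: prod_nonneg)
  have fin: "finite A" if "A \<subseteq> I" for A using that assms(1) finite_subset by auto
  have D0: "0 \<le> D"
    by (rule order_trans[OF sum_nonneg cw]) (use c pos JJ in auto)
  have "(\<Sum>g\<in>{..<Suc q} \<rightarrow>\<^sub>E \<J>. (\<Prod>l<Suc q. c (g l)) * (\<Prod>i\<in>(\<Union>l<Suc q. g l). w i))
     = (\<Sum>g\<in>{..<q} \<rightarrow>\<^sub>E \<J>. \<Sum>J\<in>\<J>. (\<Prod>l<q. c (g l)) * c J * (\<Prod>i\<in>(\<Union>l<q. g l) \<union> J. w i))"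
  proof -
    have [simp]: "{..<q} \<inter> {x. x \<noteq> q} = {..<q}" by auto
    show ?thesis unfolding sum_funcset_Suc
      by (intro sum.cong refl) (simp add: lessThan_Suc Un_commute mult.commute)
  qed
  also have "\<dots> = (\<Sum>g\<in>{..<q} \<rightarrow>\<^sub>E \<J>. (\<Prod>l<q. c (g l)) * (\<Prod>i\<in>(\<Union>l<q. g l). w i) *
      (\<Sum>J\<in>\<J>. c J * (\<Prod>i\<in>J - (\<Union>l<q. g l). w i)))"
  proof (intro sum.cong refl, unfold sum_distrib_left, intro sum.cong refl)
    fix g J assume g: "g \<in> {..<q} \<rightarrow>\<^sub>E \<J>" and J: "J \<in> \<J>"
    have gI: "(\<Union>l<q. g l) \<subseteq> I" using g JJ by (fastforce simp: PiE_iff)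
    have "(\<Prod>i\<in>(\<Union>l<q. g l) \<union> J. w i) = (\<Prod>i\<in>(\<Union>l<q. g l) \<union> (J - (\<Union>l<q. g l)). w i)"
      by (intro prod.cong) auto
    also have "\<dots> = (\<Prod>i\<in>(\<Union>l<q. g l). w i) * (\<Prod>i\<in>J - (\<Union>l<q. g l). w i)"
      using J JJ by (intro prod.union_disjoint fin gI) auto
    finally show "(\<Prod>l<q. c (g l)) * c J * (\<Prod>i\<in>(\<Union>l<q. g l) \<union> J. w i)
      = (\<Prod>l<q. c (g l)) * (\<Prod>i\<in>(\<Union>l<q. g l). w i) * (c J * (\<Prod>i\<in>J - (\<Union>l<q. g l). w i))"
      by simp
  qed
  also have "\<dots> \<le> (\<Sum>g\<in>{..<q} \<rightarrow>\<^sub>E \<J>. (\<Prod>l<q. c (g l)) * (\<Prod>i\<in>(\<Union>l<q. g l). w i) *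
      (D * (1 + 3 * 2 ^ (p * k))))"
  proof (intro sum_mono mult_left_mono)
    fix g assume g: "g \<in> {..<q} \<rightarrow>\<^sub>E \<J>"
    have gI: "(\<Union>l<q. g l) \<subseteq> I" using g JJ by (fastforce simp: PiE_iff)
    have "card (\<Union>l<q. g l) \<le> (\<Sum>l<q. card (g l))" by (rule card_UN_le) simp
    also have "\<dots> = q * k" using g JJ by (simp add: PiE_iff)
    also have "\<dots> \<le> p * k" using Suc.prems by simp
    finally have cU: "card (\<Union>l<q. g l) \<le> p * k" .
    have "(\<Sum>J\<in>\<J>. c J * (\<Prod>i\<in>J - (\<Union>l<q. g l). w i)) \<le> D * (1 + 3 * 2 ^ card (\<Union>l<q. g l))"
      by (rule sum_prod_Diff_le[OF assms(1,2) JJ(1) c near w1 cw gI])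
    also have "\<dots> \<le> D * (1 + 3 * 2 ^ (p * k))"
      using D0 cU by (intro mult_left_mono add_left_mono power_increasing) auto
    finally show "(\<Sum>J\<in>\<J>. c J * (\<Prod>i\<in>J - (\<Union>l<q. g l). w i)) \<le> D * (1 + 3 * 2 ^ (p * k))" .
    show "0 \<le> (\<Prod>l<q. c (g l)) * (\<Prod>i\<in>(\<Union>l<q. g l). w i)"
      using g c by (intro mult_nonneg_nonneg pos gI prod_nonneg) (auto simp: PiE_iff)
  qed
  also have "\<dots> = (\<Sum>g\<in>{..<q} \<rightarrow>\<^sub>E \<J>. (\<Prod>l<q. c (g l)) * (\<Prod>i\<in>(\<Union>l<q. g l). w i)) *
      (D * (1 + 3 * 2 ^ (p * k)))" by (simp add: sum_distrib_right)
  also have "\<dots> \<le> (D * (1 + 3 * 2 ^ (p * k))) ^ q * (D * (1 + 3 * 2 ^ (p * k)))"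
    using Suc D0 by (intro mult_right_mono) auto
  finally show ?case by (simp add: mult.commute)
qed

text \<open>Double counting with the multiplicity \<open>s i\<close>, the number of sets containing
  \<open>i\<close>. The multiplicities add up to \<open>p * k\<close>, and each set contains an
  element of multiplicity at least 2, so such elements carry at least \<open>p\<close> of the
  incidences. An element of multiplicity 1 satisfies \<open>2 \<le> 2 * s i\<close>, one of higher
  multiplicity even \<open>2 + s i \<le> 2 * s i\<close>; summation gives the claim. For
  \<open>p = 2 * h\<close> it says that the union has at most \<open>h * (2 * k - 1)\<close>
  elements.\<close>

lemma card_UN_no_isolated:
  fixes g :: "nat \<Rightarrow> 'i set"
  assumes fin: "\<And>l. l < p \<Longrightarrow> finite (g l)" and card: "\<And>l. l < p \<Longrightarrow> card (g l) = k"
    and meet: "\<And>l. l < p \<Longrightarrow> \<exists>l'<p. l' \<noteq> l \<and> g l \<inter> g l' \<noteq> {}"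
  shows "2 * card (\<Union>l<p. g l) + p \<le> 2 * (p * k)"
proof -
  let ?U = "\<Union>l<p. g l"
  define s where "s i = card {l \<in> {..<p}. i \<in> g l}" for i
  have fU: "finite ?U" using fin by auto
  have cnt: "(\<Sum>i\<in>?U. if P i then s i else 0) = (\<Sum>l<p. card {i \<in> g l. P i})" for P
  proof -
    have "(\<Sum>i\<in>?U. if P i then s i else 0) = (\<Sum>i\<in>?U. \<Sum>l<p. if i \<in> g l \<and> P i then 1 else 0)"
      by (intro sum.cong refl) (simp add: s_def sum.If_cases Int_def conj_commute)
    also have "\<dots> = (\<Sum>l<p. \<Sum>i\<in>?U. if i \<in> g l \<and> P i then 1 else 0)" by (rule sum.swap)
    also have "\<dots> = (\<Sum>l<p. card {i \<in> g l. P i})"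
    proof (intro sum.cong refl)
      fix l assume l: "l \<in> {..<p}"
      have "{i. i \<in> g l \<and> P i} \<inter> ?U = {i \<in> g l. P i}" using l by auto
      thus "(\<Sum>i\<in>?U. if i \<in> g l \<and> P i then 1 else 0) = card {i \<in> g l. P i}"
        using fU by (simp add: sum.If_cases Int_commute)
    qed
    finally show ?thesis .
  qed
  have "(\<Sum>l<p. 1) \<le> (\<Sum>l<p. card {i \<in> g l. 2 \<le> s i})"
  proof (rule sum_mono)
    fix l assume "l \<in> {..<p}"
    then obtain l' i where l': "l < p" "l' < p" "l' \<noteq> l" "i \<in> g l" "i \<in> g l'" using meet[of l] by auto
    have "card {l, l'} \<le> s i" unfolding s_def using l' by (intro card_mono) auto
    hence "i \<in> {i \<in> g l. 2 \<le> s i}" using l' by auto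
    moreover have "finite {i \<in> g l. 2 \<le> s i}" using fin[OF l'(1)] by simp
    ultimately have "card {i} \<le> card {i \<in> g l. 2 \<le> s i}" by (intro card_mono) auto
    thus "1 \<le> card {i \<in> g l. 2 \<le> s i}" by simp
  qed
  hence 1: "p \<le> (\<Sum>i\<in>?U. if 2 \<le> s i then s i else 0)" unfolding cnt by simp
  have 2: "(\<Sum>i\<in>?U. s i) = p * k" using cnt[of "\<lambda>_. True"] card by simp
  have "(\<Sum>i\<in>?U. 2 + (if 2 \<le> s i then s i else 0)) \<le> (\<Sum>i\<in>?U. 2 * s i)"
  proof (rule sum_mono)
    fix i assume "i \<in> ?U"
    hence "{l \<in> {..<p}. i \<in> g l} \<noteq> {}" by auto
    hence "0 < s i" unfolding s_def by (simp add: card_gt_0_iff)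
    thus "2 + (if 2 \<le> s i then s i else 0) \<le> 2 * s i" by auto
  qed
  hence "2 * card ?U + (\<Sum>i\<in>?U. if 2 \<le> s i then s i else 0) \<le> 2 * (p * k)"
    unfolding sum.distrib sum_distrib_left[symmetric] 2 by simp
  thus ?thesis using 1 by linarith
qed

text \<open>The crucial gain over the trivial exponent \<open>2hk\<close> of \<open>B\<close> comes from \<open>card_UN_no_isolated\<close>.\<close>

lemma (in prob_space) centered_moment_bound:
  fixes n :: "'i \<Rightarrow> 'a \<Rightarrow> real" and c :: "'i set \<Rightarrow> real"
  assumes I: "finite I" and ind: "indep_vars (\<lambda>_. borel) n I"
    and n0: "\<And>i \<omega>. i \<in> I \<Longrightarrow> 0 \<le> n i \<omega>"
    and mean: "\<And>i. i \<in> I \<Longrightarrow> integrable M (n i)" "\<And>i. i \<in> I \<Longrightarrow> expectation (n i) = l i"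
    and mom: "\<And>i s. i \<in> I \<Longrightarrow> 1 \<le> s \<Longrightarrow> s \<le> 2 * h \<Longrightarrow> integrable M (\<lambda>\<omega>. (n i \<omega> + l i) ^ s)"
      "\<And>i s. i \<in> I \<Longrightarrow> 1 \<le> s \<Longrightarrow> s \<le> 2 * h \<Longrightarrow> expectation (\<lambda>\<omega>. (n i \<omega> + l i) ^ s) \<le> K * l i"
    and K: "1 \<le> K" and B: "1 \<le> B" and k: "1 \<le> k"
    and JJ: "\<J> \<subseteq> Pow I" "\<And>J. J \<in> \<J> \<Longrightarrow> card J = k"
    and c: "\<And>J. J \<in> \<J> \<Longrightarrow> 0 \<le> c J \<and> c J \<le> D"
    and near: "\<And>J i j. J \<in> \<J> \<Longrightarrow> c J \<noteq> 0 \<Longrightarrow> i \<in> J \<Longrightarrow> j \<in> J \<Longrightarrow> near i j"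
    and l1: "\<And>i. i \<in> I \<Longrightarrow> (\<Sum>j\<in>{j \<in> I. near i j}. l j) \<le> B"
    and cl: "(\<Sum>J\<in>\<J>. c J * (\<Prod>i\<in>J. l i)) \<le> D * B ^ k"
  shows "integrable M (\<lambda>\<omega>. ((\<Sum>J\<in>\<J>. c J * (\<Prod>i\<in>J. n i \<omega>)) - (\<Sum>J\<in>\<J>. c J * (\<Prod>i\<in>J. l i))) ^ (2 * h))" (is ?int)
    and "expectation (\<lambda>\<omega>. ((\<Sum>J\<in>\<J>. c J * (\<Prod>i\<in>J. n i \<omega>)) - (\<Sum>J\<in>\<J>. c J * (\<Prod>i\<in>J. l i))) ^ (2 * h))
      \<le> K ^ (2 * h * k) * (D * (1 + 3 * 2 ^ (2 * h * k))) ^ (2 * h) * B ^ (h * (2 * k - 1))" (is ?bd)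
proof -
  let ?p = "2 * h"
  let ?PJ = "{..<?p} \<rightarrow>\<^sub>E \<J>"
  have fJJ: "finite \<J>" using JJ I by (meson finite_Pow_iff finite_subset)
  have finJ: "finite J" "J \<subseteq> I" if "J \<in> \<J>" for J using that JJ I by (auto intro: finite_subset)
  have l0: "0 \<le> l i" if "i \<in> I" for i
    using mean(2)[OF that] n0[OF that] by (metis Bochner_Integration.integral_nonneg)
  have meas[measurable]: "n i \<in> borel_measurable M" if "i \<in> I" for i
    using mean(1)[OF that] by auto
  define y where "y J \<omega> = (\<Prod>i\<in>J. n i \<omega>) - (\<Prod>i\<in>J. l i)" for J \<omega>
  \<comment> \<open>\<open>Z J\<close> dominates the centred monomial \<open>y J\<close>: both
    products in \<open>y J\<close> are nonnegative and at most the product of the sums. Being a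
    monomial again, it can be regrouped by cells when several are multiplied.\<close>
  define Z where "Z J \<omega> = (\<Prod>i\<in>J. n i \<omega> + l i)" for J \<omega>
  have yint: "integrable M (y J)" and y0: "expectation (y J) = 0" if J: "J \<in> \<J>" for J
  proof -
    have iJ: "indep_vars (\<lambda>_. borel) n J" by (rule indep_vars_subset[OF ind finJ(2)[OF J]])
    have "integrable M (\<lambda>\<omega>. \<Prod>i\<in>J. n i \<omega>)"
      by (rule indep_vars_integrable[OF finJ(1)[OF J] iJ]) (use mean finJ(2)[OF J] in auto)
    moreover have "expectation (\<lambda>\<omega>. \<Prod>i\<in>J. n i \<omega>) = (\<Prod>i\<in>J. l i)"
      by (subst indep_vars_lebesgue_integral[OF finJ(1)[OF J] iJ])
         (use mean finJ(2)[OF J] in \<open>auto intro!: prod.cong\<close>)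
    ultimately show "integrable M (y J)" "expectation (y J) = 0"
      by (simp_all add: y_def[abs_def] prob_space)
  qed
  have yZ: "\<bar>y J \<omega>\<bar> \<le> Z J \<omega>" if J: "J \<in> \<J>" for J \<omega>
  proof -
    have "0 \<le> (\<Prod>i\<in>J. n i \<omega>)" "0 \<le> (\<Prod>i\<in>J. l i)" using finJ(2)[OF J] n0 l0 by (auto intro!: prod_nonneg)
    moreover have "(\<Prod>i\<in>J. n i \<omega>) \<le> Z J \<omega>" "(\<Prod>i\<in>J. l i) \<le> Z J \<omega>"
      unfolding Z_def using finJ(2)[OF J] n0 l0 by (auto intro!: prod_mono)
    ultimately show ?thesis by (auto simp: y_def)
  qed
  have ymeas[measurable]: "y J \<in> borel_measurable M" if "J \<in> \<J>" for J using yint[OF that] by auto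
  define Y where "Y g \<omega> = (\<Prod>l<?p. y (g l) \<omega>)" for g :: "nat \<Rightarrow> 'i set" and \<omega>
  define iso where "iso g \<longleftrightarrow> (\<exists>a<?p. \<forall>b<?p. b \<noteq> a \<longrightarrow> g a \<inter> g b = {})" for g :: "nat \<Rightarrow> 'i set"
  have gJ: "g a \<in> \<J>" if "g \<in> ?PJ" "a < ?p" for g a using that by (auto simp: PiE_iff)
  \<comment> \<open>Stated for any set \<open>A\<close> of positions: all positions give the moment
    bound, and all but one give the integrability needed to split off an isolated factor.\<close>
  have gen: "integrable M (\<lambda>\<omega>. \<Prod>a\<in>A. y (g a) \<omega>)"
    "expectation (\<lambda>\<omega>. \<Prod>a\<in>A. y (g a) \<omega>) \<le> K ^ card (\<Union>a\<in>A. g a) * (\<Prod>i\<in>(\<Union>a\<in>A. g a). l i)"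
    if g: "g \<in> ?PJ" and A: "A \<subseteq> {..<?p}" for g A
  proof -
    have fA: "finite A" using A finite_subset by auto
    have gJ: "g a \<in> \<J>" if "a \<in> A" for a using gJ[OF g] that A by auto
    let ?U = "\<Union>a\<in>A. g a"
    have UI: "?U \<subseteq> I" using gJ finJ by blast
    have fU: "finite ?U" using UI I finite_subset by auto
    \<comment> \<open>Multiplicity of the cell \<open>i\<close> among the chosen sets. The moment
      hypothesis bounds every power from 1 to \<open>2 * h\<close> by \<open>K * l i\<close>, so a
      repeated cell is charged its intensity only once.\<close>
    define s where "s i = card {a \<in> A. i \<in> g a}" for i
    have s: "1 \<le> s i \<and> s i \<le> ?p" if "i \<in> ?U" for i
    proof -
      have "{a \<in> A. i \<in> g a} \<noteq> {}" using that by auto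
      hence "0 < s i" unfolding s_def using fA by (simp add: card_gt_0_iff)
      moreover have "s i \<le> card {..<?p}" unfolding s_def using A by (intro card_mono) auto
      ultimately show ?thesis by simp
    qed
    have ZZ: "(\<Prod>a\<in>A. Z (g a) \<omega>) = (\<Prod>i\<in>?U. (n i \<omega> + l i) ^ s i)" for \<omega>
    proof -
      have "(\<Prod>a\<in>A. Z (g a) \<omega>) = (\<Prod>a\<in>A. \<Prod>i\<in>?U. if i \<in> g a then n i \<omega> + l i else 1)"
      proof (intro prod.cong refl)
        fix a assume a: "a \<in> A"
        have "?U \<inter> {i. i \<in> g a} = g a" using a by auto
        thus "Z (g a) \<omega> = (\<Prod>i\<in>?U. if i \<in> g a then n i \<omega> + l i else 1)"
          using fU by (simp add: Z_def prod.If_cases)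
      qed
      also have "\<dots> = (\<Prod>i\<in>?U. \<Prod>a\<in>A. if i \<in> g a then n i \<omega> + l i else 1)" by (rule prod.swap)
      also have "\<dots> = (\<Prod>i\<in>?U. (n i \<omega> + l i) ^ s i)"
        using fA by (intro prod.cong refl) (simp add: s_def prod.If_cases Int_def)
      finally show ?thesis .
    qed
    have iU: "indep_vars (\<lambda>_. borel) (\<lambda>i \<omega>. (n i \<omega> + l i) ^ s i) ?U"
      by (rule indep_vars_compose2[OF indep_vars_subset[OF ind UI]]) auto
    have mU: "integrable M (\<lambda>\<omega>. (n i \<omega> + l i) ^ s i)" "expectation (\<lambda>\<omega>. (n i \<omega> + l i) ^ s i) \<le> K * l i"
      if "i \<in> ?U" for i using mom[of i "s i"] s[OF that] that UI by auto
    have Zint: "integrable M (\<lambda>\<omega>. \<Prod>a\<in>A. Z (g a) \<omega>)"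
      unfolding ZZ by (rule indep_vars_integrable[OF fU iU mU(1)])
    have Yle: "\<bar>\<Prod>a\<in>A. y (g a) \<omega>\<bar> \<le> (\<Prod>a\<in>A. Z (g a) \<omega>)" for \<omega>
      unfolding abs_prod using yZ gJ by (intro prod_mono) auto
    show YI: "integrable M (\<lambda>\<omega>. \<Prod>a\<in>A. y (g a) \<omega>)"
    proof (rule Bochner_Integration.integrable_bound[OF Zint])
      show "(\<lambda>\<omega>. \<Prod>a\<in>A. y (g a) \<omega>) \<in> borel_measurable M" using gJ by (intro borel_measurable_prod) auto
      show "AE \<omega> in M. norm (\<Prod>a\<in>A. y (g a) \<omega>) \<le> norm (\<Prod>a\<in>A. Z (g a) \<omega>)"
        by (intro AE_I2) (simp only: real_norm_def order_trans[OF Yle abs_ge_self])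
    qed
    have "expectation (\<lambda>\<omega>. \<Prod>a\<in>A. y (g a) \<omega>) \<le> expectation (\<lambda>\<omega>. \<Prod>a\<in>A. Z (g a) \<omega>)"
      by (intro integral_mono YI Zint) (use Yle in \<open>auto intro: order_trans[OF abs_ge_self]\<close>)
    also have "\<dots> = (\<Prod>i\<in>?U. expectation (\<lambda>\<omega>. (n i \<omega> + l i) ^ s i))"
      unfolding ZZ by (rule indep_vars_lebesgue_integral[OF fU iU mU(1)])
    also have "\<dots> \<le> (\<Prod>i\<in>?U. K * l i)"
    proof (intro prod_mono conjI)
      fix i assume i: "i \<in> ?U"
      hence "i \<in> I" using UI by auto
      thus "0 \<le> expectation (\<lambda>\<omega>. (n i \<omega> + l i) ^ s i)"
        using l0 n0 by (intro Bochner_Integration.integral_nonneg) auto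
      show "expectation (\<lambda>\<omega>. (n i \<omega> + l i) ^ s i) \<le> K * l i" by (rule mU(2)[OF i])
    qed
    also have "\<dots> = K ^ card ?U * (\<Prod>i\<in>?U. l i)" by (simp add: prod.distrib)
    finally show "expectation (\<lambda>\<omega>. \<Prod>a\<in>A. y (g a) \<omega>) \<le> K ^ card ?U * (\<Prod>i\<in>?U. l i)" .
  qed
  have YI: "integrable M (Y g)" if g: "g \<in> ?PJ" for g
    unfolding Y_def[abs_def] by (rule gen(1)[OF g]) simp
  have YE: "expectation (Y g) \<le> K ^ (?p * k) * (\<Prod>i\<in>(\<Union>a<?p. g a). l i)" if g: "g \<in> ?PJ" for g
  proof -
    let ?U = "\<Union>a<?p. g a"
    have UI: "?U \<subseteq> I" using gJ[OF g] finJ by blast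
    have "expectation (Y g) \<le> K ^ card ?U * (\<Prod>i\<in>?U. l i)"
      unfolding Y_def[abs_def] by (rule gen(2)[OF g]) simp
    also have "\<dots> \<le> K ^ (?p * k) * (\<Prod>i\<in>?U. l i)"
    proof (intro mult_right_mono power_increasing K)
      have "card ?U \<le> (\<Sum>a<?p. card (g a))" by (rule card_UN_le) simp
      also have "\<dots> = ?p * k" using gJ[OF g] JJ(2) by simp
      finally show "card ?U \<le> ?p * k" .
      show "0 \<le> (\<Prod>i\<in>?U. l i)" using UI l0 by (intro prod_nonneg) auto
    qed
    finally show ?thesis .
  qed
  have Y0: "expectation (Y g) = 0" if g: "g \<in> ?PJ" and "iso g" for g
  proof -
    obtain a where a: "a < ?p" "\<And>b. b < ?p \<Longrightarrow> b \<noteq> a \<Longrightarrow> g a \<inter> g b = {}"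
      using \<open>iso g\<close> by (auto simp: iso_def)
    define A where "A = {..<?p} - {a}"
    define V where "V = (\<Union>b\<in>A. g b)"
    have VI: "V \<subseteq> I" "g a \<subseteq> I" using gJ[OF g] finJ(2) a(1) by (auto simp: V_def A_def)
    have disj: "g a \<inter> V = {}" using a(2) by (auto simp: V_def A_def)
    have mA: "(\<lambda>x. (\<Prod>i\<in>g a. x i) - (\<Prod>i\<in>g a. l i)) \<in> borel_measurable (PiM (g a) (\<lambda>_. borel))"
      by measurable
    have gV: "g b \<subseteq> V" if "b \<in> A" for b using that by (auto simp: V_def)
    have mV: "(\<lambda>x. \<Prod>b\<in>A. ((\<Prod>i\<in>g b. x i) - (\<Prod>i\<in>g b. l i))) \<in> borel_measurable (PiM V (\<lambda>_. borel))"
      by (intro borel_measurable_prod borel_measurable_diff borel_measurable_const measurable_component_singleton)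
         (use gV in auto)
    \<comment> \<open>The vectors of counts indexed by the disjoint sets \<open>g a\<close> and
      \<open>V\<close> are independent, and each factor is a measurable function of one of them. The
      factor \<open>y (g a)\<close> has mean 0 and makes the whole expectation vanish.\<close>
    have iv: "indep_var borel ((\<lambda>x. (\<Prod>i\<in>g a. x i) - (\<Prod>i\<in>g a. l i)) \<circ> (\<lambda>\<omega>. restrict (\<lambda>i. n i \<omega>) (g a)))
       borel ((\<lambda>x. \<Prod>b\<in>A. ((\<Prod>i\<in>g b. x i) - (\<Prod>i\<in>g b. l i))) \<circ> (\<lambda>\<omega>. restrict (\<lambda>i. n i \<omega>) V))"
      by (rule indep_var_compose[OF indep_var_restrict[OF ind disj VI(2,1)] mA mV])
    have e1: "((\<lambda>x. (\<Prod>i\<in>g a. x i) - (\<Prod>i\<in>g a. l i)) \<circ> (\<lambda>\<omega>. restrict (\<lambda>i. n i \<omega>) (g a))) = y (g a)"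
      by (auto simp: y_def fun_eq_iff)
    have e2: "((\<lambda>x. \<Prod>b\<in>A. ((\<Prod>i\<in>g b. x i) - (\<Prod>i\<in>g b. l i))) \<circ> (\<lambda>\<omega>. restrict (\<lambda>i. n i \<omega>) V))
       = (\<lambda>\<omega>. \<Prod>b\<in>A. y (g b) \<omega>)"
    proof
      fix \<omega>
      have "(\<Prod>i\<in>g b. restrict (\<lambda>i. n i \<omega>) V i) = (\<Prod>i\<in>g b. n i \<omega>)" if "b \<in> A" for b
        using gV[OF that] by (intro prod.cong) auto
      thus "((\<lambda>x. \<Prod>b\<in>A. ((\<Prod>i\<in>g b. x i) - (\<Prod>i\<in>g b. l i))) \<circ> (\<lambda>\<omega>. restrict (\<lambda>i. n i \<omega>) V)) \<omega>
        = (\<Prod>b\<in>A. y (g b) \<omega>)" by (simp add: y_def)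
    qed
    have Yeq: "Y g = (\<lambda>\<omega>. y (g a) \<omega> * (\<Prod>b\<in>A. y (g b) \<omega>))"
      using a(1) by (auto simp: Y_def A_def fun_eq_iff prod.remove)
    have True: "integrable M (\<lambda>\<omega>. \<Prod>b\<in>A. y (g b) \<omega>)" by (rule gen(1)[OF g]) (auto simp: A_def)
    show ?thesis unfolding Yeq
      using indep_var_lebesgue_integral[OF iv[unfolded e1 e2] yint[OF gJ[OF g a(1)]] True]
        y0[OF gJ[OF g a(1)]] by simp
  qed
  have expand: "((\<Sum>J\<in>\<J>. c J * (\<Prod>i\<in>J. n i \<omega>)) - (\<Sum>J\<in>\<J>. c J * (\<Prod>i\<in>J. l i))) ^ ?p
     = (\<Sum>g\<in>?PJ. (\<Prod>a<?p. c (g a)) * Y g \<omega>)" for \<omega>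
  proof -
    have "(\<Sum>J\<in>\<J>. c J * (\<Prod>i\<in>J. n i \<omega>)) - (\<Sum>J\<in>\<J>. c J * (\<Prod>i\<in>J. l i)) = (\<Sum>J\<in>\<J>. c J * y J \<omega>)"
      by (simp add: y_def sum_subtractf[symmetric] right_diff_distrib)
    hence "((\<Sum>J\<in>\<J>. c J * (\<Prod>i\<in>J. n i \<omega>)) - (\<Sum>J\<in>\<J>. c J * (\<Prod>i\<in>J. l i))) ^ ?p
       = (\<Prod>a<?p. \<Sum>J\<in>\<J>. c J * y J \<omega>)" by simp
    also have "\<dots> = (\<Sum>g\<in>?PJ. \<Prod>a<?p. c (g a) * y (g a) \<omega>)"
      by (rule prod_sum_PiE) (auto simp: fJJ)
    finally show ?thesis by (simp add: prod.distrib Y_def)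
  qed
  show ?int unfolding expand using YI by (intro Bochner_Integration.integrable_sum integrable_mult_right)
  \<comment> \<open>Normalised so that the cells near a given one have total weight at most 1.
    Passing from \<open>l\<close> to \<open>w\<close> takes out one factor \<open>B\<close> per
    distinct cell, and here the bound on the size of the union enters.\<close>
  define w where "w i = l i / B" for i
  have c0: "0 \<le> (\<Prod>a<?p. c (g a))" if "g \<in> ?PJ" for g using gJ[OF that] c by (auto intro!: prod_nonneg)
  have w0: "0 \<le> w i" if "i \<in> I" for i using l0[OF that] B by (auto simp: w_def)
  have "expectation (\<lambda>\<omega>. ((\<Sum>J\<in>\<J>. c J * (\<Prod>i\<in>J. n i \<omega>)) - (\<Sum>J\<in>\<J>. c J * (\<Prod>i\<in>J. l i))) ^ ?p)
    = (\<Sum>g\<in>?PJ. (\<Prod>a<?p. c (g a)) * expectation (Y g))"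
    unfolding expand using YI by (subst Bochner_Integration.integral_sum) auto
  also have "\<dots> \<le> (\<Sum>g\<in>?PJ. (\<Prod>a<?p. c (g a)) *
      (K ^ (?p * k) * B ^ (h * (2 * k - 1)) * (\<Prod>i\<in>(\<Union>a<?p. g a). w i)))"
  proof (intro sum_mono mult_left_mono c0)
    fix g assume g: "g \<in> ?PJ"
    let ?U = "\<Union>a<?p. g a"
    have UI: "?U \<subseteq> I" using gJ[OF g] finJ by blast
    have W0: "0 \<le> (\<Prod>i\<in>?U. w i)" using w0 UI by (intro prod_nonneg) auto
    show "expectation (Y g) \<le> K ^ (?p * k) * B ^ (h * (2 * k - 1)) * (\<Prod>i\<in>?U. w i)"
    proof (cases "iso g")
      case True
      show ?thesis using Y0[OF g True] W0 K B by simp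
    next
      case False
      have "2 * card ?U + ?p \<le> 2 * (?p * k)"
      proof (rule card_UN_no_isolated)
        fix a assume a: "a < ?p"
        show "finite (g a)" "card (g a) = k" using gJ[OF g a] finJ JJ by auto
        show "\<exists>b<?p. b \<noteq> a \<and> g a \<inter> g b \<noteq> {}" using False a by (auto simp: iso_def)
      qed
      moreover have "h * (2 * k - 1) + h = 2 * h * k"
        using k by (cases k) (auto simp: algebra_simps)
      ultimately have cU: "card ?U \<le> h * (2 * k - 1)" by linarith
      have "(\<Prod>i\<in>?U. l i) = (\<Prod>i\<in>?U. B * w i)" using B by (simp add: w_def)
      also have "\<dots> = B ^ card ?U * (\<Prod>i\<in>?U. w i)" by (simp add: prod.distrib)
      also have "\<dots> \<le> B ^ (h * (2 * k - 1)) * (\<Prod>i\<in>?U. w i)"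
        by (intro mult_right_mono power_increasing cU B W0)
      finally have "K ^ (?p * k) * (\<Prod>i\<in>?U. l i) \<le> K ^ (?p * k) * (B ^ (h * (2 * k - 1)) * (\<Prod>i\<in>?U. w i))"
        using K by (intro mult_left_mono) auto
      thus ?thesis using YE[OF g] by (simp add: mult.assoc)
    qed
  qed
  also have "\<dots> = K ^ (?p * k) * B ^ (h * (2 * k - 1)) *
      (\<Sum>g\<in>?PJ. (\<Prod>a<?p. c (g a)) * (\<Prod>i\<in>(\<Union>a<?p. g a). w i))"
    by (simp add: sum_distrib_left mult_ac)
  also have "\<dots> \<le> K ^ (?p * k) * B ^ (h * (2 * k - 1)) * (D * (1 + 3 * 2 ^ (?p * k))) ^ ?p"
  proof (intro mult_left_mono sum_tuples_prod_UN_le[OF I w0 JJ c near])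
    show "(\<Sum>j\<in>{j \<in> I. near i j}. w j) \<le> 1" if "i \<in> I" for i
      using l1[OF that] B by (simp add: w_def sum_divide_distrib[symmetric])
    have "(\<Sum>J\<in>\<J>. c J * (\<Prod>i\<in>J. w i)) = (\<Sum>J\<in>\<J>. c J * (\<Prod>i\<in>J. l i)) / B ^ k"
      by (simp add: w_def prod_dividef JJ(2) sum_divide_distrib)
    also have "\<dots> \<le> D" using cl B by (simp add: divide_le_eq)
    finally show "(\<Sum>J\<in>\<J>. c J * (\<Prod>i\<in>J. w i)) \<le> D" .
    show "0 \<le> K ^ (?p * k) * B ^ (h * (2 * k - 1))" using K B by simp
  qed auto
  finally show ?bd by (simp add: mult_ac)
qed

section \<open>Dyadic cells and tuples of points\<close>

text \<open>A dyadic cell of side \<open>2\<^sup>-\<^sup>j\<close> is represented by its lowest corner, so cells are the fibres of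
  \<open>corner j\<close> and a cell index is itself a point of the space.\<close>

definition corner :: "nat \<Rightarrow> 'a::euclidean_space \<Rightarrow> 'a" where
  "corner j x = (\<Sum>b\<in>Basis. (of_int \<lfloor>2 ^ j * (x \<bullet> b)\<rfloor> / 2 ^ j) *\<^sub>R b)"

lemma corner_inner: "b \<in> Basis \<Longrightarrow> corner j x \<bullet> b = of_int \<lfloor>2 ^ j * (x \<bullet> b)\<rfloor> / 2 ^ j"
  by (simp add: corner_def inner_sum_left inner_Basis if_distrib sum.delta cong: if_cong)

lemma borel_measurable_corner[measurable]: "corner j \<in> borel_measurable borel"
  unfolding corner_def by measurable

lemma norm_diff_corner_le: "norm (x - corner j x) \<le> DIM('a) / 2 ^ j" for x :: "'a::euclidean_space"
proof -
  have "norm (x - corner j x) \<le> (\<Sum>b\<in>Basis. \<bar>(x - corner j x) \<bullet> b\<bar>)" by (rule norm_le_l1)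
  also have "\<dots> \<le> (\<Sum>b\<in>(Basis :: 'a set). 1 / 2 ^ j)"
  proof (rule sum_mono)
    fix b :: 'a assume b: "b \<in> Basis"
    have "\<bar>2 ^ j * (x \<bullet> b) - of_int \<lfloor>2 ^ j * (x \<bullet> b)\<rfloor>\<bar> \<le> 1" by linarith
    hence "\<bar>2 ^ j * (x \<bullet> b) - of_int \<lfloor>2 ^ j * (x \<bullet> b)\<rfloor>\<bar> / 2 ^ j \<le> 1 / 2 ^ j"
      by (intro divide_right_mono) auto
    moreover have "(x - corner j x) \<bullet> b = (2 ^ j * (x \<bullet> b) - of_int \<lfloor>2 ^ j * (x \<bullet> b)\<rfloor>) / 2 ^ j"
      using b by (simp add: inner_diff_left corner_inner diff_divide_distrib)
    ultimately show "\<bar>(x - corner j x) \<bullet> b\<bar> \<le> 1 / 2 ^ j" by simp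
  qed
  also have "\<dots> = DIM('a) / 2 ^ j" by simp
  finally show ?thesis .
qed

text \<open>Dyadic grids are nested, because the floor of a real number divided by a positive
  integer depends only on the floor of the number. Approximations on different grids can thus be
  moved to a common one.\<close>

lemma corner_corner:
  assumes "i \<le> j"
  shows "corner i (corner j x) = corner i x"
proof (rule euclidean_eqI)
  fix b :: 'a assume b: "b \<in> Basis"
  define n :: int where "n = 2 ^ (j - i)"
  have "real_of_int n = 2 ^ (j - i)" by (simp add: n_def)
  also have "\<dots> = 2 ^ j / 2 ^ i" by (rule power_diff[OF _ assms]) simp
  finally have n: "real_of_int n = 2 ^ j / 2 ^ i" .
  have n0: "0 \<le> n" by (simp add: n_def)
  have "\<lfloor>2 ^ i * (x \<bullet> b)\<rfloor> = \<lfloor>(2 ^ j * (x \<bullet> b)) / real_of_int n\<rfloor>" by (simp add: n mult.commute)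
  also have "\<dots> = \<lfloor>2 ^ j * (x \<bullet> b)\<rfloor> div n" by (rule floor_divide_real_eq_div[OF n0])
  also have "\<dots> = \<lfloor>real_of_int \<lfloor>2 ^ j * (x \<bullet> b)\<rfloor> / real_of_int n\<rfloor>" by (simp add: floor_divide_of_int_eq)
  also have "\<dots> = \<lfloor>2 ^ i * (corner j x \<bullet> b)\<rfloor>" using b by (simp add: n corner_inner mult.commute)
  finally show "corner i (corner j x) \<bullet> b = corner i x \<bullet> b" using b by (simp add: corner_inner)
qed

lemma finite_corner_image:
  fixes W :: "'a::euclidean_space set"
  assumes "bounded W"
  shows "finite (corner j ` W)"
proof -
  obtain r where r: "\<And>x. x \<in> W \<Longrightarrow> norm x \<le> r" using assms by (auto simp: bounded_iff)
  define m where "m = \<lceil>2 ^ j * \<bar>r\<bar>\<rceil> + 1"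
  define f :: "('a \<Rightarrow> int) \<Rightarrow> 'a" where "f z = (\<Sum>b\<in>Basis. (of_int (z b) / 2 ^ j) *\<^sub>R b)" for z
  have "corner j ` W \<subseteq> f ` (Basis \<rightarrow>\<^sub>E {-m..m})"
  proof
    fix y assume "y \<in> corner j ` W"
    then obtain x where x: "x \<in> W" "y = corner j x" by auto
    have "\<lfloor>2 ^ j * (x \<bullet> b)\<rfloor> \<in> {-m..m}" if "b \<in> Basis" for b
    proof -
      have "\<bar>x \<bullet> b\<bar> \<le> \<bar>r\<bar>" using Basis_le_norm[OF that, of x] r[OF x(1)] by linarith
      hence "2 ^ j * \<bar>x \<bullet> b\<bar> \<le> 2 ^ j * \<bar>r\<bar>" by (intro mult_left_mono) auto
      hence "\<bar>2 ^ j * (x \<bullet> b)\<bar> \<le> 2 ^ j * \<bar>r\<bar>" by (simp add: abs_mult)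
      moreover have "\<lfloor>z\<rfloor> \<in> {- (\<lceil>u\<rceil> + 1)..\<lceil>u\<rceil> + 1}" if "\<bar>z\<bar> \<le> u" for z u :: real
        using that by (simp add: abs_le_iff) linarith
      ultimately show ?thesis unfolding m_def by blast
    qed
    hence "(\<lambda>b\<in>Basis. \<lfloor>2 ^ j * (x \<bullet> b)\<rfloor>) \<in> Basis \<rightarrow>\<^sub>E {-m..m}" by auto
    moreover have "y = f (\<lambda>b\<in>Basis. \<lfloor>2 ^ j * (x \<bullet> b)\<rfloor>)" by (simp add: x corner_def f_def)
    ultimately show "y \<in> f ` (Basis \<rightarrow>\<^sub>E {-m..m})" by blast
  qed
  thus ?thesis by (rule finite_subset) (auto intro!: finite_imageI finite_PiE)
qed

text \<open>There are only countably many corners, so \<open>A\<close> can be replaced by a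
  countable, hence Borel, subset. Any union of cells is therefore Borel, for arbitrary
  \<open>A\<close>.\<close>

lemma corner_vimage_borel: "corner j -` A \<in> sets (borel :: 'a::euclidean_space measure)"
proof -
  have "range (corner j :: 'a \<Rightarrow> 'a) = (\<Union>n::nat. corner j ` cball 0 (real n))"
  proof (intro equalityI subsetI)
    fix y :: 'a assume "y \<in> range (corner j)"
    then obtain x where x: "y = corner j x" by auto
    obtain n :: nat where "norm x \<le> real n" using real_arch_simple by blast
    thus "y \<in> (\<Union>n::nat. corner j ` cball 0 (real n))" using x by (intro UN_I[of n]) auto
  qed auto
  moreover have "countable (\<Union>n::nat. corner j ` cball (0 :: 'a) (real n))"
    by (intro countable_UN countable_finite[OF finite_corner_image]) auto
  ultimately have cA: "countable (A \<inter> range (corner j :: 'a \<Rightarrow> 'a))" by (intro countable_Int2) simp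
  have "{a} \<in> sets borel" for a :: 'a by simp
  hence "A \<inter> range (corner j :: 'a \<Rightarrow> 'a) \<in> sets borel" by (rule sets.countable[OF _ cA])
  from measurable_sets[OF borel_measurable_corner[of j] this]
  show ?thesis by (simp add: vimage_Int vimage_def cong: conj_cong)
qed

lemma eventually_inj_on_corner:
  fixes X :: "'a::euclidean_space set"
  assumes "finite X"
  shows "eventually (\<lambda>j. inj_on (corner j) X) sequentially"
proof -
  have "eventually (\<lambda>j. corner j x \<noteq> corner j y) sequentially" if "x \<noteq> y" for x y :: 'a
  proof -
    have "(\<lambda>j. 2 * (DIM('a) / 2 ^ j)) \<longlonglongrightarrow> 0"
      using tendsto_mult_right_zero[OF LIMSEQ_divide_realpow_zero[of 2 "real DIM('a)"], of 2] by simp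
    hence "eventually (\<lambda>j. 2 * (DIM('a) / 2 ^ j) < norm (x - y)) sequentially"
      using that by (intro order_tendstoD) auto
    thus ?thesis
    proof eventually_elim
      case (elim j)
      show ?case
      proof
        assume "corner j x = corner j y"
        hence "norm (x - y) = norm ((x - corner j x) - (y - corner j y))" by simp
        also have "\<dots> \<le> norm (x - corner j x) + norm (y - corner j y)" by (rule norm_triangle_ineq4)
        also have "\<dots> \<le> DIM('a) / 2 ^ j + DIM('a) / 2 ^ j" by (intro add_mono norm_diff_corner_le)
        finally show False using elim by simp
      qed
    qed
  qed
  moreover have "finite {z \<in> X \<times> X. fst z \<noteq> snd z}" using assms by simp
  ultimately have "eventually (\<lambda>j. \<forall>z\<in>{z \<in> X \<times> X. fst z \<noteq> snd z}. corner j (fst z) \<noteq> corner j (snd z)) sequentially"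
    by (intro eventually_ball_finite) auto
  thus ?thesis by eventually_elim (force simp: inj_on_def)
qed

text \<open>Tuples are extensional functions on \<open>{..<k}\<close> and not lists, so that they
  are points of the product space over \<open>{..<k}\<close> and sets of tuples can be
  measured.\<close>

definition inj_tuples :: "nat \<Rightarrow> 'a set \<Rightarrow> (nat \<Rightarrow> 'a) set" where
  "inj_tuples k X = {x \<in> {..<k} \<rightarrow>\<^sub>E X. inj_on x {..<k}}"

lemma finite_inj_tuples: "finite X \<Longrightarrow> finite (inj_tuples k X)"
  unfolding inj_tuples_def by (rule finite_subset[of _ "{..<k} \<rightarrow>\<^sub>E X"]) (auto intro: finite_PiE)

lemma inj_tuples_mono: "X \<subseteq> Y \<Longrightarrow> inj_tuples k X \<subseteq> inj_tuples k Y"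
  by (auto simp: inj_tuples_def PiE_iff)

lemma card_inj_tuples: "finite X \<Longrightarrow> card (inj_tuples k X) = (\<Prod>i<k. card X - i)"
  using card_inj_on_subset_funcset[of "{..<k}" X "{..<k}"] by (simp add: inj_tuples_def atLeast0LessThan)

lemma card_Int_eq_sum: "finite A \<Longrightarrow> real (card (A \<inter> B)) = (\<Sum>x\<in>A. of_bool (x \<in> B))"
  by (simp add: of_bool_def sum.If_cases)

text \<open>For a fixed tuple \<open>c\<close> of distinct labels the entries can be chosen
  independently from their fibres, and distinct labels already make the points distinct. This turns
  a tuple sum into a multilinear polynomial in counts. The sets \<open>X i\<close> may differ, which
  serves the rectangles.\<close>

lemma sum_tuples_by_fibres:
  fixes \<phi> :: "(nat \<Rightarrow> 'b) \<Rightarrow> real" and q :: "'a \<Rightarrow> 'b"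
  assumes X: "\<And>i. i < k \<Longrightarrow> finite (X i)" and Q: "finite Q" "\<And>i. i < k \<Longrightarrow> q ` X i \<subseteq> Q"
  shows "(\<Sum>x\<in>{x \<in> PiE {..<k} X. inj_on (\<lambda>i. q (x i)) {..<k}}. \<phi> (\<lambda>i\<in>{..<k}. q (x i)))
    = (\<Sum>c\<in>inj_tuples k Q. \<phi> c * (\<Prod>i<k. real (card {y \<in> X i. q y = c i})))"
proof -
  let ?S = "{x \<in> PiE {..<k} X. inj_on (\<lambda>i. q (x i)) {..<k}}"
  let ?g = "\<lambda>x. \<lambda>i\<in>{..<k}. q (x i)"
  have fS: "finite ?S" by (rule finite_subset[of _ "PiE {..<k} X"]) (auto intro: finite_PiE X)
  have gS: "?g ` ?S \<subseteq> inj_tuples k Q"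
    using Q(2) by (fastforce simp: inj_tuples_def PiE_iff inj_on_def)
  have "(\<Sum>x\<in>?S. \<phi> (?g x)) = (\<Sum>c\<in>inj_tuples k Q. \<Sum>x\<in>{x \<in> ?S. ?g x = c}. \<phi> (?g x))"
    by (rule sum.group[symmetric, OF fS finite_inj_tuples[OF Q(1)] gS])
  also have "\<dots> = (\<Sum>c\<in>inj_tuples k Q. \<phi> c * (\<Prod>i<k. real (card {y \<in> X i. q y = c i})))"
  proof (rule sum.cong[OF refl])
    fix c assume c: "c \<in> inj_tuples k Q"
    have eq: "{x \<in> ?S. ?g x = c} = PiE {..<k} (\<lambda>i. {y \<in> X i. q y = c i})"
    proof (intro equalityI subsetI)
      fix x assume "x \<in> {x \<in> ?S. ?g x = c}"
      hence x: "x \<in> PiE {..<k} X" "?g x = c" by auto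
      have "q (x i) = c i" if "i < k" for i using that x(2) by auto
      thus "x \<in> PiE {..<k} (\<lambda>i. {y \<in> X i. q y = c i})" using x(1) by (auto simp: PiE_iff)
    next
      fix x assume x: "x \<in> PiE {..<k} (\<lambda>i. {y \<in> X i. q y = c i})"
      have qx: "q (x i) = c i" if "i < k" for i using x that by (auto simp: PiE_iff)
      have "x \<in> PiE {..<k} X" using x by (auto simp: PiE_iff)
      moreover have "?g x = c" using qx c by (auto simp: inj_tuples_def PiE_iff extensional_def fun_eq_iff)
      moreover have "inj_on (\<lambda>i. q (x i)) {..<k}" using qx c by (auto simp: inj_tuples_def inj_on_def)
      ultimately show "x \<in> {x \<in> ?S. ?g x = c}" by simp
    qed
    have "(\<Sum>x\<in>{x \<in> ?S. ?g x = c}. \<phi> (?g x)) = (\<Sum>x\<in>{x \<in> ?S. ?g x = c}. \<phi> c)"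
      by (rule sum.cong) auto
    also have "\<dots> = \<phi> c * real (card {x \<in> ?S. ?g x = c})" by simp
    also have "\<dots> = \<phi> c * (\<Prod>i<k. real (card {y \<in> X i. q y = c i}))"
      unfolding eq by (simp add: card_PiE)
    finally show "(\<Sum>x\<in>{x \<in> ?S. ?g x = c}. \<phi> (?g x)) = \<phi> c * (\<Prod>i<k. real (card {y \<in> X i. q y = c i}))" .
  qed
  finally show ?thesis .
qed

locale point_process = prob_space M for M :: "'w measure" +
  fixes \<xi> :: "'w \<Rightarrow> 'a::euclidean_space set"
  assumes locally_finite: "\<omega> \<in> space M \<Longrightarrow> bounded B \<Longrightarrow> finite (\<xi> \<omega> \<inter> B)"
    and measurable_count: "B \<in> sets borel \<Longrightarrow> bounded B \<Longrightarrow> (\<lambda>\<omega>. real (card (\<xi> \<omega> \<inter> B))) \<in> borel_measurable M"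

text \<open>Approximating tuple sums uses nothing specific to Poisson processes: measurable counts
  and a finite mean number of tuples in a bounded window suffice.\<close>

locale window_process = point_process M \<xi> for M :: "'w measure" and \<xi> :: "'w \<Rightarrow> 'a::euclidean_space set" +
  fixes W :: "'a set" and k :: nat
  assumes W: "W \<in> sets borel" "bounded W"
    and integrable_card: "integrable M (\<lambda>\<omega>. real (card (inj_tuples k (\<xi> \<omega> \<inter> W))))"

context window_process
begin

abbreviation "PB \<equiv> PiM {..<k} (\<lambda>_. borel :: 'a measure)"

definition tuples :: "'w \<Rightarrow> (nat \<Rightarrow> 'a) set" where
  "tuples \<omega> = inj_tuples k (\<xi> \<omega> \<inter> W)"

lemma finite_tuples: "\<omega> \<in> space M \<Longrightarrow> finite (tuples \<omega>)"
  unfolding tuples_def by (intro finite_inj_tuples locally_finite W)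

section \<open>Measurability and approximation by level sets\<close>

text \<open>The points of a locally finite set in a bounded window are separated by all sufficiently fine
  grids, so the number of tuples in a rectangle is a limit of polynomials in cell counts.\<close>

lemma measurable_card_rectangle:
  assumes A: "\<And>i. i < k \<Longrightarrow> A i \<in> sets borel"
  shows "(\<lambda>\<omega>. real (card (tuples \<omega> \<inter> PiE {..<k} A))) \<in> borel_measurable M"
proof -
  define Y where "Y j \<omega> = (\<Sum>c\<in>inj_tuples k (corner j ` W).
      \<Prod>i<k. real (card (\<xi> \<omega> \<inter> (W \<inter> A i \<inter> corner j -` {c i}))))" for j \<omega>
  have "Y j \<in> borel_measurable M" for j
    unfolding Y_def[abs_def] using A W
    by (intro borel_measurable_sum borel_measurable_prod measurable_count)
       (auto intro!: sets.Int corner_vimage_borel intro: bounded_subset)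
  moreover have "(\<lambda>j. Y j \<omega>) \<longlonglongrightarrow> real (card (tuples \<omega> \<inter> PiE {..<k} A))" if \<omega>: "\<omega> \<in> space M" for \<omega>
  proof (rule tendsto_eventually)
    have fX: "finite (\<xi> \<omega> \<inter> W)" by (intro locally_finite W \<omega>)
    show "eventually (\<lambda>j. Y j \<omega> = real (card (tuples \<omega> \<inter> PiE {..<k} A))) sequentially"
      using eventually_inj_on_corner[OF fX]
    proof eventually_elim
      case (elim j)
      let ?X = "\<lambda>i. \<xi> \<omega> \<inter> W \<inter> A i"
      have inj: "inj_on (\<lambda>i. corner j (x i)) {..<k} \<longleftrightarrow> inj_on x {..<k}" if "x \<in> PiE {..<k} ?X" for x
      proof -
        have "inj_on (corner j) (x ` {..<k})" using that by (intro inj_on_subset[OF elim]) (auto simp: PiE_iff)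
        thus ?thesis using comp_inj_on[of x "{..<k}" "corner j"] inj_on_imageI2[of "corner j" x "{..<k}"]
          unfolding o_def by blast
      qed
      have "tuples \<omega> \<inter> PiE {..<k} A = {x \<in> PiE {..<k} ?X. inj_on (\<lambda>i. corner j (x i)) {..<k}}" (is "_ = ?S")
      proof (intro equalityI subsetI)
        fix x assume "x \<in> tuples \<omega> \<inter> PiE {..<k} A"
        hence "x \<in> PiE {..<k} ?X" "inj_on x {..<k}" by (auto simp: tuples_def inj_tuples_def PiE_iff)
        thus "x \<in> ?S" using inj[of x] by simp
      next
        fix x assume "x \<in> ?S"
        hence "x \<in> PiE {..<k} ?X" "inj_on x {..<k}" using inj[of x] by auto
        thus "x \<in> tuples \<omega> \<inter> PiE {..<k} A" by (auto simp: tuples_def inj_tuples_def PiE_iff)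
      qed
      hence "real (card (tuples \<omega> \<inter> PiE {..<k} A)) = (\<Sum>x\<in>?S. (\<lambda>_. 1) (\<lambda>i\<in>{..<k}. corner j (x i)))" by simp
      also have "\<dots> = (\<Sum>c\<in>inj_tuples k (corner j ` W). 1 * (\<Prod>i<k. real (card {y \<in> ?X i. corner j y = c i})))"
        by (rule sum_tuples_by_fibres) (use fX W(2) in \<open>auto intro: finite_corner_image\<close>)
      also have "\<dots> = Y j \<omega>" unfolding Y_def
        by (intro sum.cong refl, simp, intro prod.cong refl arg_cong[of _ _ card] arg_cong[of _ _ real]) auto
      finally show ?case by simp
    qed
  qed
  ultimately show ?thesis by (rule borel_measurable_LIMSEQ_real[rotated])
qed

text \<open>Dynkin argument from the rectangles, an intersection-stable generator. Complements pass
  through because a configuration has finitely many tuples in the window, so that counts can be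
  subtracted.\<close>

lemma measurable_card_tuples:
  assumes "C \<in> sets PB"
  shows "(\<lambda>\<omega>. real (card (tuples \<omega> \<inter> C))) \<in> borel_measurable M"
proof -
  let ?G = "prod_algebra {..<k} (\<lambda>_. borel :: 'a measure)"
  let ?\<Omega> = "\<Pi>\<^sub>E i\<in>{..<k}. space (borel :: 'a measure)"
  have rectangle: "(\<lambda>\<omega>. real (card (tuples \<omega> \<inter> A))) \<in> borel_measurable M" if "A \<in> ?G" for A
  proof -
    from that obtain X where "A = PiE {..<k} X" "X \<in> (\<Pi> i\<in>{..<k}. sets borel)"
      by (subst (asm) prod_algebra_eq_finite) auto
    thus ?thesis using measurable_card_rectangle[of X] by auto
  qed
  have "C \<in> sigma_sets ?\<Omega> ?G" using assms by (simp add: sets_PiM)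
  with Int_stable_prod_algebra prod_algebra_sets_into_space show ?thesis
  proof (induction rule: sigma_sets_induct_disjoint)
    case (basic A)
    thus ?case by (rule rectangle)
  next
    case empty show ?case by simp
  next
    case (compl A)
    have "?\<Omega> \<in> ?G" by (subst prod_algebra_eq_finite) auto
    note b = rectangle[OF this]
    have "real (card (tuples \<omega> \<inter> (?\<Omega> - A))) = real (card (tuples \<omega> \<inter> ?\<Omega>)) - real (card (tuples \<omega> \<inter> A))"
      if \<omega>: "\<omega> \<in> space M" for \<omega>
    proof -
      have "A \<subseteq> ?\<Omega>" by (rule sigma_sets_into_sp[OF prod_algebra_sets_into_space compl(1)])
      hence sub: "tuples \<omega> \<inter> A \<subseteq> tuples \<omega> \<inter> ?\<Omega>" by blast
      have "tuples \<omega> \<inter> (?\<Omega> - A) = (tuples \<omega> \<inter> ?\<Omega>) - (tuples \<omega> \<inter> A)" by blast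
      hence "card (tuples \<omega> \<inter> (?\<Omega> - A)) = card (tuples \<omega> \<inter> ?\<Omega>) - card (tuples \<omega> \<inter> A)"
        using card_Diff_subset[OF _ sub] finite_tuples[OF \<omega>] by simp
      moreover have "card (tuples \<omega> \<inter> A) \<le> card (tuples \<omega> \<inter> ?\<Omega>)"
        by (rule card_mono[OF _ sub]) (use finite_tuples[OF \<omega>] in simp)
      ultimately show ?thesis by simp
    qed
    hence "(\<lambda>\<omega>. real (card (tuples \<omega> \<inter> (?\<Omega> - A)))) \<in> borel_measurable M \<longleftrightarrow>
        (\<lambda>\<omega>. real (card (tuples \<omega> \<inter> ?\<Omega>)) - real (card (tuples \<omega> \<inter> A))) \<in> borel_measurable M"
      by (rule measurable_cong)
    thus ?case using b compl(2) by simp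
  next
    case (union A)
    have "real (card (tuples \<omega> \<inter> (\<Union>i. A i))) = (\<Sum>i. real (card (tuples \<omega> \<inter> A i)))" if \<omega>: "\<omega> \<in> space M" for \<omega>
    proof -
      have "finite_measure (count_space (tuples \<omega>))" using finite_tuples[OF \<omega>] by (rule finite_measure_count_space)
      hence "(\<lambda>i. measure (count_space (tuples \<omega>)) (tuples \<omega> \<inter> A i)) sums measure (count_space (tuples \<omega>)) (\<Union>i. tuples \<omega> \<inter> A i)"
        using union(1) by (intro finite_measure.finite_measure_UNION) (auto simp: disjoint_family_on_def)
      moreover have "measure (count_space (tuples \<omega>)) (tuples \<omega> \<inter> X) = real (card (tuples \<omega> \<inter> X))" for X
        using finite_tuples[OF \<omega>] by (simp add: measure_def emeasure_count_space_finite)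
      ultimately show ?thesis by (simp add: sums_iff flip: Int_UN_distrib)
    qed
    moreover have "(\<lambda>\<omega>. \<Sum>i. real (card (tuples \<omega> \<inter> A i))) \<in> borel_measurable M"
      using union by (intro borel_measurable_suminf) auto
    ultimately show ?case by (subst measurable_cong) auto
  qed
qed

lemma integrable_card_tuples: "C \<in> sets PB \<Longrightarrow> integrable M (\<lambda>\<omega>. real (card (tuples \<omega> \<inter> C)))"
  by (rule Bochner_Integration.integrable_bound[OF integrable_card measurable_card_tuples])
     (auto intro!: AE_I2 card_mono finite_tuples[unfolded tuples_def] simp: tuples_def)

text \<open>On measurable sets this is the \<open>k\<close>-th factorial moment measure of the
  process restricted to \<open>W\<close>; it is finite by \<open>integrable_card\<close>.\<close>

definition mean_count :: "(nat \<Rightarrow> 'a) set \<Rightarrow> real" where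
  "mean_count C = expectation (\<lambda>\<omega>. real (card (tuples \<omega> \<inter> C)))"

lemma mean_count_subadd:
  assumes "C \<in> sets PB" "C1 \<in> sets PB" "C2 \<in> sets PB" "C \<subseteq> C1 \<union> C2"
  shows "mean_count C \<le> mean_count C1 + mean_count C2"
proof -
  have "mean_count C \<le> expectation (\<lambda>\<omega>. real (card (tuples \<omega> \<inter> C1)) + real (card (tuples \<omega> \<inter> C2)))"
    unfolding mean_count_def
  proof (intro integral_mono Bochner_Integration.integrable_add integrable_card_tuples assms)
    fix \<omega> assume "\<omega> \<in> space M"
    hence "card (tuples \<omega> \<inter> C) \<le> card (tuples \<omega> \<inter> C1 \<union> tuples \<omega> \<inter> C2)"
      using assms(4) finite_tuples by (intro card_mono) auto
    also have "\<dots> \<le> card (tuples \<omega> \<inter> C1) + card (tuples \<omega> \<inter> C2)" by (rule card_Un_le)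
    finally show "real (card (tuples \<omega> \<inter> C)) \<le> real (card (tuples \<omega> \<inter> C1)) + real (card (tuples \<omega> \<inter> C2))" by simp
  qed
  also have "\<dots> = mean_count C1 + mean_count C2"
    unfolding mean_count_def by (intro Bochner_Integration.integral_add integrable_card_tuples assms)
  finally show ?thesis .
qed

text \<open>Each outcome has finitely many tuples in the window and each of them eventually leaves
  \<open>C n\<close>, so the counts are eventually 0. Dominated convergence applies, with the total
  number of tuples as the majorant.\<close>

lemma mean_count_tendsto_0:
  assumes C: "\<And>n. C n \<in> sets PB"
    and ev: "\<And>x. eventually (\<lambda>n. x \<notin> C n) sequentially"
  shows "(\<lambda>n. mean_count (C n)) \<longlonglongrightarrow> 0"
proof -
  have "(\<lambda>n. mean_count (C n)) \<longlonglongrightarrow> expectation (\<lambda>_. 0)"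
    unfolding mean_count_def
  proof (rule integral_dominated_convergence[where w = "\<lambda>\<omega>. real (card (inj_tuples k (\<xi> \<omega> \<inter> W)))"])
    show "AE \<omega> in M. (\<lambda>n. real (card (tuples \<omega> \<inter> C n))) \<longlonglongrightarrow> 0"
    proof (intro AE_I2 tendsto_eventually)
      fix \<omega> assume \<omega>: "\<omega> \<in> space M"
      have "eventually (\<lambda>n. \<forall>x\<in>tuples \<omega>. x \<notin> C n) sequentially"
        using finite_tuples[OF \<omega>] ev by (intro eventually_ball_finite) auto
      thus "eventually (\<lambda>n. real (card (tuples \<omega> \<inter> C n)) = 0) sequentially"
      proof eventually_elim
        case (elim n)
        hence "tuples \<omega> \<inter> C n = {}" by auto
        thus ?case by simp
      qed
    qed
    show "AE \<omega> in M. norm (real (card (tuples \<omega> \<inter> C n))) \<le> real (card (inj_tuples k (\<xi> \<omega> \<inter> W)))" for n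
      by (auto intro!: AE_I2 card_mono finite_tuples[unfolded tuples_def] simp: tuples_def)
  qed (auto intro!: integrable_card measurable_card_tuples C)
  thus ?thesis by simp
qed

section \<open>Density of the unions of grid boxes among the measurable sets of tuples\<close>

definition level_set :: "nat \<Rightarrow> (nat \<Rightarrow> 'a) set \<Rightarrow> (nat \<Rightarrow> 'a) set" where
  "level_set j A = {x \<in> space PB. (\<lambda>i\<in>{..<k}. corner j (x i)) \<in> A}"

text \<open>Membership in the closure of the grid unions, for the pseudometric that assigns to two
  sets the mean count of their symmetric difference. Measurability of the level set is carried along
  as part of the condition.\<close>

definition approximable :: "(nat \<Rightarrow> 'a) set \<Rightarrow> bool" where
  "approximable C \<longleftrightarrow> C \<in> sets PB \<and>
     (\<forall>e>0. \<exists>j A. level_set j A \<in> sets PB \<and> mean_count ((C - level_set j A) \<union> (level_set j A - C)) < e)"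

lemma level_set_refine:
  assumes "i \<le> j"
  shows "level_set i A = level_set j {c. (\<lambda>a\<in>{..<k}. corner i (c a)) \<in> A}"
proof -
  have "(\<lambda>a\<in>{..<k}. corner i ((\<lambda>a\<in>{..<k}. corner j (x a)) a)) = (\<lambda>a\<in>{..<k}. corner i (x a))" for x :: "nat \<Rightarrow> 'a"
    using corner_corner[OF assms] by (auto simp: restrict_def fun_eq_iff)
  thus ?thesis by (simp add: level_set_def)
qed

lemma level_set_Un: "level_set j A \<union> level_set j B = level_set j (A \<union> B)"
  by (auto simp: level_set_def)

lemma approximable_level_set:
  assumes "level_set j A \<in> sets PB"
  shows "approximable (level_set j A)"
  unfolding approximable_def
proof (intro conjI assms allI impI)
  fix e :: real assume "e > 0"
  thus "\<exists>ja Aa. level_set ja Aa \<in> sets PB \<and>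
      mean_count (level_set j A - level_set ja Aa \<union> (level_set ja Aa - level_set j A)) < e"
    using assms by (intro exI[of _ j] exI[of _ A]) (simp add: mean_count_def)
qed

lemma approximable_compl:
  assumes "approximable C"
  shows "approximable (space PB - C)"
  unfolding approximable_def
proof (intro conjI allI impI)
  show "space PB - C \<in> sets PB" using assms by (auto simp: approximable_def)
  have sub: "C \<subseteq> space PB" using assms sets.sets_into_space by (auto simp: approximable_def)
  fix e :: real assume "e > 0"
  then obtain j A where jA: "level_set j A \<in> sets PB" "mean_count ((C - level_set j A) \<union> (level_set j A - C)) < e"
    using assms by (auto simp: approximable_def)
  have eq: "level_set j (- A) = space PB - level_set j A" by (auto simp: level_set_def)
  have "(space PB - C - level_set j (- A)) \<union> (level_set j (- A) - (space PB - C))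
    = (C - level_set j A) \<union> (level_set j A - C)"
    unfolding eq using sub by (auto simp: level_set_def)
  thus "\<exists>j A. level_set j A \<in> sets PB \<and>
      mean_count ((space PB - C - level_set j A) \<union> (level_set j A - (space PB - C))) < e"
    using jA by (intro exI[of _ j] exI[of _ "- A"]) (simp add: eq sets.compl_sets)
qed

lemma approximable_Un:
  assumes "approximable C" "approximable D"
  shows "approximable (C \<union> D)"
  unfolding approximable_def
proof (intro conjI allI impI)
  have CD: "C \<in> sets PB" "D \<in> sets PB" using assms by (auto simp: approximable_def)
  show "C \<union> D \<in> sets PB" using CD by auto
  fix e :: real assume "e > 0"
  hence e: "e / 2 > 0" by simp
  obtain i A where iA: "level_set i A \<in> sets PB" "mean_count ((C - level_set i A) \<union> (level_set i A - C)) < e / 2"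
    using assms(1) e unfolding approximable_def by blast
  obtain j B where jB: "level_set j B \<in> sets PB" "mean_count ((D - level_set j B) \<union> (level_set j B - D)) < e / 2"
    using assms(2) e unfolding approximable_def by blast
  \<comment> \<open>Both level sets are rewritten over the finer of the two grids, where their union
    is again a level set.\<close>
  define l where "l = max i j"
  have "\<exists>E. level_set i A \<union> level_set j B = level_set l E"
    unfolding level_set_refine[of i l, OF max.cobounded1[of i j, folded l_def]]
      level_set_refine[of j l, OF max.cobounded2[of j i, folded l_def]]
    by (rule exI, rule level_set_Un)
  then obtain E where E: "level_set i A \<union> level_set j B = level_set l E" by blast
  have "mean_count ((C \<union> D - level_set l E) \<union> (level_set l E - (C \<union> D)))
    \<le> mean_count ((C - level_set i A) \<union> (level_set i A - C)) + mean_count ((D - level_set j B) \<union> (level_set j B - D))"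
    unfolding E[symmetric] using CD iA jB by (intro mean_count_subadd) auto
  also have "\<dots> < e" using iA jB by simp
  finally have "mean_count ((C \<union> D - level_set l E) \<union> (level_set l E - (C \<union> D))) < e" .
  moreover have "level_set l E \<in> sets PB" unfolding E[symmetric] using iA jB by auto
  ultimately show "\<exists>j A. level_set j A \<in> sets PB \<and>
      mean_count ((C \<union> D - level_set j A) \<union> (level_set j A - (C \<union> D))) < e" by blast
qed

lemma approximable_empty: "approximable {}"
  using approximable_level_set[of 0 "{}"] by (simp add: level_set_def)

lemma approximable_UN:
  fixes C :: "nat \<Rightarrow> _"
  assumes "\<And>n. approximable (C n)"
  shows "approximable (\<Union>n. C n)"
  unfolding approximable_def
proof (intro conjI allI impI)
  have C: "C n \<in> sets PB" for n using assms by (auto simp: approximable_def)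
  show UC: "(\<Union>n. C n) \<in> sets PB" using C by auto
  fix e :: real assume "e > 0"
  hence e: "e / 2 > 0" by simp
  \<comment> \<open>A finite partial union exhausts the countable one up to mean count
    \<open>e / 2\<close>; the other half is spent on approximating that finite union.\<close>
  let ?F = "\<lambda>m. \<Union>n<m. C n"
  have F: "approximable (?F m)" for m
    by (induction m) (auto simp: approximable_empty lessThan_Suc intro!: approximable_Un assms)
  have FC: "?F m \<in> sets PB" for m using C by auto
  have "(\<lambda>m. mean_count ((\<Union>n. C n) - ?F m)) \<longlonglongrightarrow> 0"
  proof (rule mean_count_tendsto_0)
    show "(\<Union>n. C n) - ?F m \<in> sets PB" for m using UC FC by (rule sets.Diff)
    fix x
    show "eventually (\<lambda>m. x \<notin> (\<Union>n. C n) - ?F m) sequentially"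
    proof (cases "x \<in> (\<Union>n. C n)")
      case True
      then obtain n where "x \<in> C n" by auto
      thus ?thesis unfolding eventually_sequentially by (intro exI[of _ "Suc n"]) auto
    qed auto
  qed
  hence "eventually (\<lambda>m. mean_count ((\<Union>n. C n) - ?F m) < e / 2) sequentially"
    using e by (rule order_tendstoD)
  then obtain m where m: "mean_count ((\<Union>n. C n) - ?F m) < e / 2" by (auto simp: eventually_sequentially)
  obtain j A where jA: "level_set j A \<in> sets PB" "mean_count ((?F m - level_set j A) \<union> (level_set j A - ?F m)) < e / 2"
    using F[of m] e unfolding approximable_def by blast
  have "mean_count (((\<Union>n. C n) - level_set j A) \<union> (level_set j A - (\<Union>n. C n)))
    \<le> mean_count ((\<Union>n. C n) - ?F m) + mean_count ((?F m - level_set j A) \<union> (level_set j A - ?F m))"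
    using UC FC jA(1) by (intro mean_count_subadd sets.Un sets.Diff) auto
  also have "\<dots> < e" using m jA by simp
  finally show "\<exists>j A. level_set j A \<in> sets PB \<and>
      mean_count (((\<Union>n. C n) - level_set j A) \<union> (level_set j A - (\<Union>n. C n))) < e"
    using jA(1) by blast
qed

lemma approximable_coordinate_open:
  assumes "a < k" "open U"
  shows "approximable {x \<in> space PB. x a \<in> U}"
proof -
  \<comment> \<open>The cells of level \<open>j\<close> that lie entirely inside \<open>U\<close>.
    As \<open>U\<close> is open, each of its points has such a cell at some level.\<close>
  define A where "A j = {q. \<forall>z. corner j z = q \<longrightarrow> z \<in> U}" for j
  define L where "L j = level_set j {c. c a \<in> A j}" for j
  have L: "L j = {x \<in> space PB. x a \<in> corner j -` A j}" for j
    using assms(1) by (auto simp: L_def level_set_def)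
  have LP: "L j \<in> sets PB" for j
    unfolding L using measurable_sets[OF measurable_component_singleton[of a "{..<k}" "\<lambda>_. borel"] corner_vimage_borel[of j "A j"]] assms(1)
    by (simp add: vimage_def Int_def conj_commute)
  have "{x \<in> space PB. x a \<in> U} = (\<Union>j. L j)"
  proof (intro equalityI subsetI)
    fix x assume x: "x \<in> {x \<in> space PB. x a \<in> U}"
    then obtain e where e: "e > 0" "\<And>y. dist y (x a) < e \<Longrightarrow> y \<in> U" using assms(2) by (auto simp: open_dist)
    have "(\<lambda>j. 2 * (DIM('a) / 2 ^ j)) \<longlonglongrightarrow> 0"
      using tendsto_mult_right_zero[OF LIMSEQ_divide_realpow_zero[of 2 "real DIM('a)"], of 2] by simp
    hence "eventually (\<lambda>j. 2 * (DIM('a) / 2 ^ j) < e) sequentially" using e by (intro order_tendstoD) auto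
    then obtain j where j: "2 * (DIM('a) / 2 ^ j) < e" by (auto simp: eventually_sequentially)
    have "z \<in> U" if z: "corner j z = corner j (x a)" for z
    proof (rule e(2))
      have "dist z (x a) = norm ((z - corner j z) - (x a - corner j (x a)))" using z by (simp add: dist_norm)
      also have "\<dots> \<le> norm (z - corner j z) + norm (x a - corner j (x a))" by (rule norm_triangle_ineq4)
      also have "\<dots> \<le> DIM('a) / 2 ^ j + DIM('a) / 2 ^ j" by (intro add_mono norm_diff_corner_le)
      finally show "dist z (x a) < e" using j by simp
    qed
    thus "x \<in> (\<Union>j. L j)" using x by (auto simp: L A_def)
  qed (auto simp: L A_def)
  thus ?thesis using LP by (auto intro!: approximable_UN approximable_level_set simp: L_def)
qed

text \<open>The approximable sets are closed under complements and countable unions and contain the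
  sets that place one coordinate in an open set. Induction over the Borel sets of one coordinate,
  and then over the product sigma-algebra, reaches all measurable sets.\<close>

lemma approximable:
  assumes "C \<in> sets PB"
  shows "approximable C"
proof -
  have coord: "approximable {x \<in> space PB. x a \<in> A}" if "a < k" "A \<in> sets borel" for a and A :: "'a set"
  proof -
    have "A \<in> sigma_sets UNIV {S. open S}" using that(2) by (simp add: borel_def)
    thus ?thesis
    proof (induction rule: sigma_sets.induct)
      case (Basic U) thus ?case using approximable_coordinate_open[OF that(1)] by auto
    next
      case Empty thus ?case by (simp add: approximable_empty)
    next
      case (Compl U)
      have "{x \<in> space PB. x a \<in> UNIV - U} = space PB - {x \<in> space PB. x a \<in> U}" by auto
      thus ?case using approximable_compl[OF Compl.IH] by simp
    next
      case (Union U)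
      have "{x \<in> space PB. x a \<in> (\<Union>i. U i)} = (\<Union>i. {x \<in> space PB. x a \<in> U i})" by auto
      thus ?case using approximable_UN[OF Union.IH] by simp
    qed
  qed
  have "C \<in> sigma_sets (\<Pi>\<^sub>E i\<in>{..<k}. space (borel :: 'a measure))
     {{f \<in> \<Pi>\<^sub>E i\<in>{..<k}. space borel. f i \<in> A} | i A. i \<in> {..<k} \<and> A \<in> sets borel}"
    using assms unfolding sets_PiM_single .
  thus ?thesis
  proof (induction rule: sigma_sets.induct)
    case (Basic X)
    then obtain a A where "X = {f \<in> \<Pi>\<^sub>E i\<in>{..<k}. space borel. f a \<in> A}" "a < k" "A \<in> sets borel" by auto
    thus ?case using coord[of a A] by (simp add: space_PiM)
  next
    case Empty thus ?case by (simp add: approximable_empty)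
  next
    case (Compl U) thus ?case using approximable_compl[OF Compl.IH] by (simp add: space_PiM)
  next
    case (Union U) thus ?case using approximable_UN[OF Union.IH] by simp
  qed
qed

section \<open>Approximation in L^1 by multilinear polynomials in cell counts\<close>

definition cell_count :: "nat \<Rightarrow> 'a \<Rightarrow> 'w \<Rightarrow> real" where
  "cell_count j q \<omega> = real (card (\<xi> \<omega> \<inter> (W \<inter> corner j -` {q})))"

lemma sum_tuples_by_cells:
  fixes \<phi> :: "(nat \<Rightarrow> 'a) \<Rightarrow> real"
  assumes \<omega>: "\<omega> \<in> space M"
  shows "(\<Sum>x\<in>{x \<in> tuples \<omega>. inj_on (\<lambda>i. corner j (x i)) {..<k}}. \<phi> (\<lambda>i\<in>{..<k}. corner j (x i)))
    = (\<Sum>c\<in>inj_tuples k (corner j ` W). \<phi> c * (\<Prod>i<k. cell_count j (c i) \<omega>))"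
proof -
  have fX: "finite (\<xi> \<omega> \<inter> W)" by (intro locally_finite W \<omega>)
  have "inj_on x {..<k}" if "inj_on (\<lambda>i. corner j (x i)) {..<k}" for x :: "nat \<Rightarrow> 'a"
    using that by (auto simp: inj_on_def)
  hence "{x \<in> tuples \<omega>. inj_on (\<lambda>i. corner j (x i)) {..<k}}
    = {x \<in> PiE {..<k} (\<lambda>_. \<xi> \<omega> \<inter> W). inj_on (\<lambda>i. corner j (x i)) {..<k}}"
    by (auto simp: tuples_def inj_tuples_def)
  hence "(\<Sum>x\<in>{x \<in> tuples \<omega>. inj_on (\<lambda>i. corner j (x i)) {..<k}}. \<phi> (\<lambda>i\<in>{..<k}. corner j (x i)))
    = (\<Sum>c\<in>inj_tuples k (corner j ` W). \<phi> c * (\<Prod>i<k. real (card {y \<in> \<xi> \<omega> \<inter> W. corner j y = c i})))"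
    using sum_tuples_by_fibres[of k "\<lambda>_. \<xi> \<omega> \<inter> W" "corner j ` W" "corner j" \<phi>] fX finite_corner_image[OF W(2)]
    by auto
  moreover have "{y \<in> \<xi> \<omega> \<inter> W. corner j y = q} = \<xi> \<omega> \<inter> (W \<inter> corner j -` {q})" for q by auto
  ultimately show ?thesis by (simp add: cell_count_def)
qed

lemma tuples_subset_space: "tuples \<omega> \<subseteq> space PB"
  by (auto simp: tuples_def inj_tuples_def space_PiM PiE_def)

text \<open>A bounded integer-valued function is the sum of its values times the indicators of its
  level sets, and the value 0 contributes nothing. A tuple sum thereby becomes a combination of
  finitely many counts of tuples in sets.\<close>

lemma sum_tuples_eq_sum_levels:
  fixes f :: "(nat \<Rightarrow> 'a) \<Rightarrow> nat"
  assumes "\<omega> \<in> space M" "\<And>x. f x \<le> K"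
  shows "(\<Sum>x\<in>tuples \<omega>. real (f x)) = (\<Sum>v=1..K. real v * real (card (tuples \<omega> \<inter> {x \<in> space PB. f x = v})))"
proof -
  have "real (f x) = (\<Sum>v=1..K. real v * of_bool (x \<in> {x \<in> space PB. f x = v}))" if "x \<in> tuples \<omega>" for x
  proof -
    have "x \<in> space PB" using that tuples_subset_space by auto
    hence "(\<Sum>v=1..K. real v * of_bool (x \<in> {x \<in> space PB. f x = v})) = (\<Sum>v=1..K. if v = f x then real v else 0)"
      by (intro sum.cong) auto
    also have "\<dots> = real (f x)" using assms(2)[of x] by (simp add: sum.delta)
    finally show ?thesis by simp
  qed
  hence "(\<Sum>x\<in>tuples \<omega>. real (f x)) = (\<Sum>x\<in>tuples \<omega>. \<Sum>v=1..K. real v * of_bool (x \<in> {x \<in> space PB. f x = v}))"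
    by (rule sum.cong[OF refl])
  also have "\<dots> = (\<Sum>v=1..K. \<Sum>x\<in>tuples \<omega>. real v * of_bool (x \<in> {x \<in> space PB. f x = v}))" by (rule sum.swap)
  also have "\<dots> = (\<Sum>v=1..K. real v * real (card (tuples \<omega> \<inter> {x \<in> space PB. f x = v})))"
    by (simp only: sum_distrib_left card_Int_eq_sum[OF finite_tuples[OF assms(1)]])
  finally show ?thesis .
qed

lemma integrable_sum_tuples:
  fixes f :: "(nat \<Rightarrow> 'a) \<Rightarrow> nat"
  assumes f: "f \<in> PB \<rightarrow>\<^sub>M count_space UNIV" and K: "\<And>x. f x \<le> K"
  shows "integrable M (\<lambda>\<omega>. \<Sum>x\<in>tuples \<omega>. real (f x))"
proof -
  have C: "{x \<in> space PB. f x = v} \<in> sets PB" for v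
    using measurable_sets[OF f, of "{v}"] by (simp add: vimage_def Int_def conj_commute)
  have "integrable M (\<lambda>\<omega>. \<Sum>v=1..K. real v * real (card (tuples \<omega> \<inter> {x \<in> space PB. f x = v})))"
    using C by (intro Bochner_Integration.integrable_sum integrable_mult_right integrable_card_tuples)
  thus ?thesis
    by (subst Bochner_Integration.integrable_cong[OF refl sum_tuples_eq_sum_levels[OF _ K]])
qed

text \<open>Exactly the tuples of distinct points which a polynomial over tuples of distinct cells
  cannot see.\<close>

definition coincident :: "nat \<Rightarrow> (nat \<Rightarrow> 'a) set" where
  "coincident j = {x \<in> space PB. inj_on x {..<k} \<and> \<not> inj_on (\<lambda>i. corner j (x i)) {..<k}}"

lemma coincident_sets: "coincident j \<in> sets PB"
proof -
  have "{x \<in> space PB. \<forall>a\<in>{..<k}. \<forall>b\<in>{..<k}. a \<noteq> b \<longrightarrow> dist (x a) (x b) \<noteq> 0} \<in> sets PB"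
    by measurable
  moreover have "{x \<in> space PB. \<exists>a\<in>{..<k}. \<exists>b\<in>{..<k}. a \<noteq> b \<and> dist (corner j (x a)) (corner j (x b)) = 0} \<in> sets PB"
    by measurable
  moreover have "coincident j = {x \<in> space PB. \<forall>a\<in>{..<k}. \<forall>b\<in>{..<k}. a \<noteq> b \<longrightarrow> dist (x a) (x b) \<noteq> 0} \<inter>
     {x \<in> space PB. \<exists>a\<in>{..<k}. \<exists>b\<in>{..<k}. a \<noteq> b \<and> dist (corner j (x a)) (corner j (x b)) = 0}"
    by (auto simp: coincident_def inj_on_def)
  ultimately show ?thesis by (simp only: sets.Int)
qed

lemma mean_count_coincident: "(\<lambda>j. mean_count (coincident j)) \<longlonglongrightarrow> 0"
proof (rule mean_count_tendsto_0[OF coincident_sets])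
  fix x :: "nat \<Rightarrow> 'a"
  have "eventually (\<lambda>j. inj_on (corner j) (x ` {..<k})) sequentially"
    by (rule eventually_inj_on_corner) simp
  thus "eventually (\<lambda>j. x \<notin> coincident j) sequentially"
  proof eventually_elim
    case (elim j)
    thus ?case using comp_inj_on[OF _ elim] by (auto simp: coincident_def o_def)
  qed
qed

text \<open>The level sets of \<open>f\<close> are replaced by unions of boxes of one common grid,
  and coincident tuples are dropped. The predicate \<open>loc\<close> is quantified after
  \<open>j\<close>, since nearness of cells depends on the grid. It removes non-local coefficients
  that the approximation may have introduced; where \<open>loc\<close> fails \<open>f\<close>
  vanishes, so the removal does no harm. Through \<open>Q\<close> further eventual requirements can
  be imposed on the grid.\<close>

lemma L1_approximation:
  fixes f :: "(nat \<Rightarrow> 'a) \<Rightarrow> nat"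
  assumes f: "f \<in> PB \<rightarrow>\<^sub>M count_space UNIV" and K: "\<And>x. f x \<le> K"
    and e: "0 < e" and Q: "eventually Q sequentially"
  shows "\<exists>j A. Q j \<and> (\<forall>loc. (\<forall>x\<in>space PB. 0 < f x \<longrightarrow> loc (\<lambda>i\<in>{..<k}. corner j (x i))) \<longrightarrow>
     expectation (\<lambda>\<omega>. \<bar>(\<Sum>x\<in>tuples \<omega>. real (f x)) -
       (\<Sum>c\<in>inj_tuples k (corner j ` W). (if loc c then \<Sum>v=1..K. of_bool (c \<in> A v) * real v else 0) *
          (\<Prod>i<k. cell_count j (c i) \<omega>))\<bar>) \<le> e)"
proof -
  define C where "C v = {x \<in> space PB. f x = v}" for v
  have C: "C v \<in> sets PB" for v
    using measurable_sets[OF f, of "{v}"] by (simp add: vimage_def Int_def conj_commute C_def)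
  \<comment> \<open>The error is at most \<open>K\<close> times the mean count of coincident tuples
    plus \<open>K\<close> terms of size at most \<open>K * d\<close>, in all
    \<open>(K * K + K) * d\<close>. The summand 1 keeps the denominator positive for
    \<open>K = 0\<close>.\<close>
  define d where "d = e / (real K * real K + real K + 1)"
  have d: "0 < d" using e by (simp add: d_def add_nonneg_pos)
  have "\<forall>v. \<exists>j A. level_set j A \<in> sets PB \<and> mean_count ((C v - level_set j A) \<union> (level_set j A - C v)) < d"
    using approximable[OF C] d by (auto simp: approximable_def)
  then obtain J A' where JA: "\<And>v. level_set (J v) (A' v) \<in> sets PB"
    "\<And>v. mean_count ((C v - level_set (J v) (A' v)) \<union> (level_set (J v) (A' v) - C v)) < d"
    by metis
  have "eventually (\<lambda>j. \<forall>v\<in>{..K}. J v \<le> j) sequentially"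
    by (intro eventually_ball_finite) (auto intro: eventually_ge_at_top)
  moreover have "eventually (\<lambda>j. mean_count (coincident j) < d) sequentially"
    by (rule order_tendstoD(2)[OF mean_count_coincident d])
  ultimately have "eventually (\<lambda>j. Q j \<and> (\<forall>v\<in>{..K}. J v \<le> j) \<and> mean_count (coincident j) < d) sequentially"
    using Q by eventually_elim auto
  then obtain j where j: "Q j" "\<And>v. v \<le> K \<Longrightarrow> J v \<le> j" "mean_count (coincident j) < d"
    by (auto simp: eventually_sequentially)
  define A where "A v = {c. (\<lambda>a\<in>{..<k}. corner (J v) (c a)) \<in> A' v}" for v
  define L where "L v = level_set j (A v)" for v
  have L: "L v = level_set (J v) (A' v)" if "v \<le> K" for v
    unfolding L_def A_def by (rule level_set_refine[OF j(2)[OF that], symmetric])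
  define S where "S v = (C v - L v) \<union> (L v - C v)" for v
  have Ss: "S v \<in> sets PB" "mean_count (S v) < d" if "v \<le> K" for v
    using JA[of v] C unfolding S_def L[OF that] by auto
  show ?thesis
  proof (intro exI[of _ j] exI[of _ A] conjI allI impI j(1))
    fix loc assume loc: "\<forall>x\<in>space PB. 0 < f x \<longrightarrow> loc (\<lambda>i\<in>{..<k}. corner j (x i))"
    define \<phi> where "\<phi> c = (if loc c then \<Sum>v=1..K. of_bool (c \<in> A v) * real v else 0)" for c
    \<comment> \<open>A coincident tuple costs at most \<open>K\<close>. Any other tuple costs at
      most \<open>v\<close> for each value \<open>v\<close> at which \<open>C v\<close> and its
      approximation \<open>L v\<close> disagree about \<open>x\<close>.\<close>
    have pw: "\<bar>real (f x) - (if inj_on (\<lambda>i. corner j (x i)) {..<k} then \<phi> (\<lambda>i\<in>{..<k}. corner j (x i)) else 0)\<bar>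
        \<le> real K * of_bool (x \<in> coincident j) + (\<Sum>v=1..K. real v * of_bool (x \<in> S v))"
      if x: "x \<in> tuples \<omega>" for x \<omega>
    proof (cases "inj_on (\<lambda>i. corner j (x i)) {..<k}")
      case False
      have "x \<in> coincident j" using False x tuples_subset_space by (auto simp: coincident_def tuples_def inj_tuples_def)
      thus ?thesis using False K[of x] by (auto intro!: add_increasing2 sum_nonneg)
    next
      case True
      let ?c = "\<lambda>i\<in>{..<k}. corner j (x i)"
      have xs: "x \<in> space PB" using x tuples_subset_space by auto
      have "\<bar>real (f x) - \<phi> ?c\<bar> \<le> (\<Sum>v=1..K. real v * of_bool (x \<in> S v))"
      proof (cases "loc ?c")
        case False
        hence "f x = 0" using loc xs by auto
        thus ?thesis using False by (auto simp: \<phi>_def intro!: sum_nonneg)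
      next
        case True
        have "real (f x) = (\<Sum>v=1..K. if v = f x then real v else 0)" using K[of x] by (simp add: sum.delta)
        also have "\<dots> = (\<Sum>v=1..K. of_bool (x \<in> C v) * real v)" using xs by (intro sum.cong) (auto simp: C_def)
        finally have fx: "real (f x) = (\<Sum>v=1..K. of_bool (x \<in> C v) * real v)" .
        have "(?c \<in> A v) = (x \<in> L v)" for v using xs by (simp add: L_def level_set_def)
        hence "\<phi> ?c = (\<Sum>v=1..K. of_bool (x \<in> L v) * real v)" using True by (simp add: \<phi>_def)
        hence "\<bar>real (f x) - \<phi> ?c\<bar> = \<bar>\<Sum>v=1..K. (of_bool (x \<in> C v) - of_bool (x \<in> L v)) * real v\<bar>"
          by (simp add: fx sum_subtractf left_diff_distrib)
        also have "\<dots> \<le> (\<Sum>v=1..K. \<bar>(of_bool (x \<in> C v) - of_bool (x \<in> L v)) * real v\<bar>)" by (rule sum_abs)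
        also have "\<dots> \<le> (\<Sum>v=1..K. real v * of_bool (x \<in> S v))"
          by (intro sum_mono) (auto simp: S_def)
        finally show ?thesis .
      qed
      thus ?thesis using True by (simp add: add_increasing)
    qed
    have bd: "\<bar>(\<Sum>x\<in>tuples \<omega>. real (f x)) - (\<Sum>c\<in>inj_tuples k (corner j ` W). \<phi> c * (\<Prod>i<k. cell_count j (c i) \<omega>))\<bar>
       \<le> real K * real (card (tuples \<omega> \<inter> coincident j)) + (\<Sum>v=1..K. real v * real (card (tuples \<omega> \<inter> S v)))"
      if \<omega>: "\<omega> \<in> space M" for \<omega>
    proof -
      note fT = finite_tuples[OF \<omega>]
      have "(\<Sum>c\<in>inj_tuples k (corner j ` W). \<phi> c * (\<Prod>i<k. cell_count j (c i) \<omega>))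
        = (\<Sum>x\<in>tuples \<omega>. if inj_on (\<lambda>i. corner j (x i)) {..<k} then \<phi> (\<lambda>i\<in>{..<k}. corner j (x i)) else 0)"
        unfolding sum_tuples_by_cells[OF \<omega>, symmetric] using fT by (rule sum.inter_filter)
      hence "\<bar>(\<Sum>x\<in>tuples \<omega>. real (f x)) - (\<Sum>c\<in>inj_tuples k (corner j ` W). \<phi> c * (\<Prod>i<k. cell_count j (c i) \<omega>))\<bar>
        = \<bar>\<Sum>x\<in>tuples \<omega>. real (f x) - (if inj_on (\<lambda>i. corner j (x i)) {..<k} then \<phi> (\<lambda>i\<in>{..<k}. corner j (x i)) else 0)\<bar>"
        by (simp add: sum_subtractf)
      also have "\<dots> \<le> (\<Sum>x\<in>tuples \<omega>. \<bar>real (f x) - (if inj_on (\<lambda>i. corner j (x i)) {..<k} then \<phi> (\<lambda>i\<in>{..<k}. corner j (x i)) else 0)\<bar>)"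
        by (rule sum_abs)
      also have "\<dots> \<le> (\<Sum>x\<in>tuples \<omega>. real K * of_bool (x \<in> coincident j) + (\<Sum>v=1..K. real v * of_bool (x \<in> S v)))"
        by (intro sum_mono pw)
      also have "\<dots> = real K * (\<Sum>x\<in>tuples \<omega>. of_bool (x \<in> coincident j)) + (\<Sum>v=1..K. real v * (\<Sum>x\<in>tuples \<omega>. of_bool (x \<in> S v)))"
        unfolding sum.distrib sum_distrib_left by (subst sum.swap[of _ "{1..K}"]) (rule refl)
      finally show ?thesis by (simp only: card_Int_eq_sum[OF fT])
    qed
    have int: "integrable M (\<lambda>\<omega>. real K * real (card (tuples \<omega> \<inter> coincident j)) + (\<Sum>v=1..K. real v * real (card (tuples \<omega> \<inter> S v))))"
      using Ss coincident_sets
      by (intro Bochner_Integration.integrable_add Bochner_Integration.integrable_sum integrable_mult_right integrable_card_tuples) auto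
    have "expectation (\<lambda>\<omega>. \<bar>(\<Sum>x\<in>tuples \<omega>. real (f x)) -
       (\<Sum>c\<in>inj_tuples k (corner j ` W). \<phi> c * (\<Prod>i<k. cell_count j (c i) \<omega>))\<bar>)
       \<le> expectation (\<lambda>\<omega>. real K * real (card (tuples \<omega> \<inter> coincident j)) + (\<Sum>v=1..K. real v * real (card (tuples \<omega> \<inter> S v))))"
      by (rule integral_mono'[OF int bd]) (auto intro!: add_nonneg_nonneg sum_nonneg)
    also have "\<dots> = real K * mean_count (coincident j) + (\<Sum>v=1..K. real v * mean_count (S v))"
      unfolding mean_count_def using Ss coincident_sets
      by (subst Bochner_Integration.integral_add)
         (auto intro!: Bochner_Integration.integrable_sum integrable_mult_right integrable_card_tuples
           simp: Bochner_Integration.integral_sum integrable_card_tuples)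
    also have "\<dots> \<le> real K * d + (\<Sum>v=1..K. real K * d)"
    proof (intro add_mono sum_mono mult_mono)
      fix v assume v: "v \<in> {1..K}"
      show "mean_count (S v) \<le> d" using Ss(2)[of v] v by simp
      show "0 \<le> mean_count (S v)" by (simp add: mean_count_def)
    qed (use j(3) d in \<open>auto simp: mean_count_def\<close>)
    also have "\<dots> = (real K * real K + real K) * d" by (simp add: algebra_simps)
    also have "\<dots> \<le> (real K * real K + real K + 1) * d" using d by (intro mult_right_mono) auto
    also have "\<dots> = e" unfolding d_def by (simp add: add_nonneg_pos less_imp_neq[symmetric])
    finally show "expectation (\<lambda>\<omega>. \<bar>(\<Sum>x\<in>tuples \<omega>. real (f x)) -
       (\<Sum>c\<in>inj_tuples k (corner j ` W). (if loc c then \<Sum>v=1..K. of_bool (c \<in> A v) * real v else 0) *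
          (\<Prod>i<k. cell_count j (c i) \<omega>))\<bar>) \<le> e" unfolding \<phi>_def .
  qed
qed

end

section \<open>Poisson processes\<close>

text \<open>Independence of Poisson counts is given for families indexed by \<open>{..<n}\<close>;
  this carries it along an enumeration to families indexed by the cells themselves.\<close>

lemma (in prob_space) indep_vars_reindex:
  assumes inj: "inj_on f I" and ind: "indep_vars (\<lambda>_. N) (\<lambda>i. X (f i)) I"
  shows "indep_vars (\<lambda>_. N) X (f ` I)"
proof -
  let ?G = "\<lambda>j. {X j -` A \<inter> space M | A. A \<in> sets N}"
  have rv: "\<And>i. i \<in> I \<Longrightarrow> random_variable N (X (f i))" and isets: "indep_sets (\<lambda>i. ?G (f i)) I"
    using ind by (auto simp: indep_vars_def2)
  have "indep_sets ?G (f ` I)"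
  proof (rule indep_setsI)
    fix j assume "j \<in> f ` I"
    thus "?G j \<subseteq> events" using rv by (auto intro: measurable_sets)
  next
    fix A J assume J: "J \<noteq> {}" "J \<subseteq> f ` I" "finite J" and A: "\<forall>j\<in>J. A j \<in> ?G j"
    then obtain J' where J': "J' \<subseteq> I" "J = f ` J'" by (auto simp: subset_image_iff)
    have inj': "inj_on f J'" by (rule inj_on_subset[OF inj J'(1)])
    have "finite J'" using J(3) J' inj' by (simp add: finite_image_iff)
    hence "prob (\<Inter>i\<in>J'. A (f i)) = (\<Prod>i\<in>J'. prob (A (f i)))"
      using J J' A by (intro indep_setsD[OF isets]) auto
    thus "prob (\<Inter>j\<in>J. A j) = (\<Prod>j\<in>J. prob (A j))"
      by (simp add: J'(2) prod.reindex[OF inj'])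
  qed
  thus ?thesis using rv by (auto simp: indep_vars_def2)
qed

section \<open>Moments of Poisson counts\<close>

lemma power_div_fact_le_exp:
  fixes x :: real
  assumes "0 \<le> x"
  shows "x ^ p / fact p \<le> exp x"
proof -
  have s: "(\<lambda>n. x ^ n /\<^sub>R fact n) sums exp x" by (rule exp_converges)
  hence "sum (\<lambda>n. x ^ n /\<^sub>R fact n) {p} \<le> exp x"
    using sum_le_suminf[OF sums_summable[OF s], of "{p}"] assms by (simp add: sums_iff)
  thus ?thesis by (simp add: field_simps)
qed

text \<open>This is \<open>exp 1\<close> times the \<open>p\<close>-th moment of
  \<open>Z + 1\<close> for a Poisson variable \<open>Z\<close> of mean 1.\<close>

definition poisson_moment_const :: "nat \<Rightarrow> real" where
  "poisson_moment_const p = (\<Sum>m. (real m + 1) ^ p / fact m)"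

lemma summable_poisson_moment: "summable (\<lambda>m. (real m + 1) ^ p / fact m)"
proof (rule summable_comparison_test)
  have s: "summable (\<lambda>m. (exp 1 :: real) ^ m /\<^sub>R fact m)" by (rule sums_summable[OF exp_converges])
  show "summable (\<lambda>m. fact p * exp 1 * ((exp 1 :: real) ^ m /\<^sub>R fact m))"
    by (rule summable_mult[OF s])
  show "\<exists>N. \<forall>m\<ge>N. norm ((real m + 1) ^ p / fact m) \<le> fact p * exp 1 * ((exp 1 :: real) ^ m /\<^sub>R fact m)"
  proof (intro exI allI impI)
    fix m :: nat
    have "(real m + 1) ^ p \<le> fact p * exp (real m + 1)"
      using power_div_fact_le_exp[of "real m + 1" p] by (simp add: divide_le_eq mult.commute)
    also have "exp (real m + 1) = exp 1 * (exp 1 :: real) ^ m" by (simp add: exp_add exp_of_nat_mult[symmetric])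
    finally show "norm ((real m + 1) ^ p / fact m) \<le> fact p * exp 1 * ((exp 1 :: real) ^ m /\<^sub>R fact m)"
      by (simp add: divide_right_mono field_simps)
  qed
qed

lemma one_le_poisson_moment_const: "1 \<le> poisson_moment_const p"
  using sum_le_suminf[OF summable_poisson_moment[of p], of "{0}"] by (simp add: poisson_moment_const_def)

lemma prod_diff_times_fact: "k \<le> n \<Longrightarrow> (\<Prod>i<k. n - i) * fact (n - k) = (fact n :: nat)"
proof (induction k)
  case (Suc k)
  have "fact (n - k) = (n - k) * (fact (n - Suc k) :: nat)"
    using Suc.prems by (metis Suc_diff_Suc fact_Suc of_nat_id Suc_le_lessD)
  thus ?case using Suc by (simp add: mult.assoc)
qed simp

text \<open>Isolates what is used of the intensity measure at a fixed \<open>t\<close>: it is finite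
  on bounded sets and has no atoms, so that fine cells carry little mass.\<close>

locale poisson_points =
  fixes M :: "'w measure" and \<Lambda> :: "'a::euclidean_space measure" and \<xi> :: "'w \<Rightarrow> 'a set"
  assumes poisson: "poisson_process M \<Lambda> \<xi>"
    and sets_\<Lambda>: "sets \<Lambda> = sets borel"
    and bounded_\<Lambda>: "bounded B \<Longrightarrow> B \<in> sets borel \<Longrightarrow> emeasure \<Lambda> B < \<infinity>"
    and atomless: "emeasure \<Lambda> {x} = 0"

sublocale poisson_points \<subseteq> prob_space M
  using poisson by (simp add: poisson_process_def)

context poisson_points
begin

lemma finite_points: "\<omega> \<in> space M \<Longrightarrow> bounded B \<Longrightarrow> finite (\<xi> \<omega> \<inter> B)"
  using poisson by (auto simp: poisson_process_def)

lemma point_count_bounded: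
  "\<omega> \<in> space M \<Longrightarrow> bounded B \<Longrightarrow> point_count (\<xi> \<omega>) B = of_nat (card (\<xi> \<omega> \<inter> B))"
  using finite_points[of \<omega> B] by (simp add: point_count_def emeasure_count_space_finite)

lemma measurable_card_points:
  assumes "B \<in> sets borel" "bounded B"
  shows "(\<lambda>\<omega>. real (card (\<xi> \<omega> \<inter> B))) \<in> borel_measurable M"
proof -
  have "(\<lambda>\<omega>. enn2real (point_count (\<xi> \<omega>) B)) \<in> borel_measurable M"
    using poisson assms by (auto simp: poisson_process_def)
  moreover have "enn2real (point_count (\<xi> \<omega>) B) = real (card (\<xi> \<omega> \<inter> B))" if "\<omega> \<in> space M" for \<omega>
    using point_count_bounded[OF that assms(2)] by simp
  ultimately show ?thesis using measurable_cong[of M "\<lambda>\<omega>. enn2real (point_count (\<xi> \<omega>) B)"] by simp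
qed

end

sublocale poisson_points \<subseteq> point_process M \<xi>
  by unfold_locales (simp_all add: finite_points measurable_card_points)

context poisson_points
begin

lemma prob_card_points:
  assumes "B \<in> sets borel" "bounded B"
  shows "{\<omega> \<in> space M. card (\<xi> \<omega> \<inter> B) = m} \<in> events"
    "prob {\<omega> \<in> space M. card (\<xi> \<omega> \<inter> B) = m} = measure \<Lambda> B ^ m / fact m * exp (- measure \<Lambda> B)"
proof -
  have "{\<omega> \<in> space M. real (card (\<xi> \<omega> \<inter> B)) = real m} \<in> events"
    using measurable_card_points[OF assms] by measurable
  thus "{\<omega> \<in> space M. card (\<xi> \<omega> \<inter> B) = m} \<in> events" by simp
  have "{\<omega> \<in> space M. card (\<xi> \<omega> \<inter> B) = m} = {\<omega> \<in> space M. point_count (\<xi> \<omega>) B = of_nat m}"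
    using point_count_bounded[OF _ assms(2)] by (auto simp: of_nat_eq_iff)
  thus "prob {\<omega> \<in> space M. card (\<xi> \<omega> \<inter> B) = m} = measure \<Lambda> B ^ m / fact m * exp (- measure \<Lambda> B)"
    using poisson bounded_\<Lambda>[OF assms(2,1)] assms(1) by (simp add: poisson_process_def)
qed

text \<open>The nonnegative integral is decomposed over the values of the count, so that
  integrability and the expectation come out of the same convergent series.\<close>

lemma expectation_card_points:
  fixes g :: "nat \<Rightarrow> real"
  assumes B: "B \<in> sets borel" "bounded B" and g: "\<And>m. 0 \<le> g m"
    and s: "(\<lambda>m. g m * (measure \<Lambda> B ^ m / fact m * exp (- measure \<Lambda> B))) sums S"
  shows "integrable M (\<lambda>\<omega>. g (card (\<xi> \<omega> \<inter> B)))" "expectation (\<lambda>\<omega>. g (card (\<xi> \<omega> \<inter> B))) = S"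
proof -
  let ?E = "\<lambda>m. {\<omega> \<in> space M. card (\<xi> \<omega> \<inter> B) = m}"
  let ?n = "\<lambda>\<omega>. card (\<xi> \<omega> \<inter> B)"
  note ev = prob_card_points(1)[OF B]
  have "(\<integral>\<^sup>+\<omega>. ennreal (g (?n \<omega>)) \<partial>M) = (\<integral>\<^sup>+\<omega>. (\<Sum>m. ennreal (g m) * indicator (?E m) \<omega>) \<partial>M)"
  proof (rule nn_integral_cong)
    fix \<omega> assume \<omega>: "\<omega> \<in> space M"
    have "(\<lambda>m. ennreal (g m) * indicator (?E m) \<omega>) = (\<lambda>m. if m = ?n \<omega> then ennreal (g m) else 0)"
      using \<omega> by (auto simp: fun_eq_iff indicator_def)
    thus "ennreal (g (?n \<omega>)) = (\<Sum>m. ennreal (g m) * indicator (?E m) \<omega>)"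
      using sums_single[of "?n \<omega>" "\<lambda>m. ennreal (g m)"] by (simp add: sums_iff)
  qed
  also have "\<dots> = (\<Sum>m. \<integral>\<^sup>+\<omega>. ennreal (g m) * indicator (?E m) \<omega> \<partial>M)"
    using ev by (intro nn_integral_suminf) auto
  also have "\<dots> = (\<Sum>m. ennreal (g m * (measure \<Lambda> B ^ m / fact m * exp (- measure \<Lambda> B))))"
    by (intro suminf_cong)
       (simp only: nn_integral_cmult_indicator[OF ev] emeasure_eq_measure prob_card_points(2)[OF B] ennreal_mult'[OF g])
  also have "\<dots> = ennreal S" using g by (intro suminf_ennreal_eq s) auto
  finally have nn: "(\<integral>\<^sup>+\<omega>. ennreal (g (?n \<omega>)) \<partial>M) = ennreal S" .
  \<comment> \<open>Measurability is available for the real-valued count; the detour through the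
    floor writes \<open>g\<close> of the count as a Borel function of it.\<close>
  have "(\<lambda>\<omega>. g (nat \<lfloor>real (?n \<omega>)\<rfloor>)) \<in> borel_measurable M"
    by (intro measurable_compose[OF measurable_card_points[OF B], of "\<lambda>x. g (nat \<lfloor>x\<rfloor>)"]) measurable
  hence m: "(\<lambda>\<omega>. g (?n \<omega>)) \<in> borel_measurable M" by simp
  have S0: "0 \<le> S" using g by (intro sums_le[OF _ sums_zero s]) auto
  show "integrable M (\<lambda>\<omega>. g (?n \<omega>))" "expectation (\<lambda>\<omega>. g (?n \<omega>)) = S"
    using nn_integral_eq_integrable[OF m _ S0] nn g by auto
qed

text \<open>The number of injective tuples is a falling factorial of the count, and the
  \<open>k\<close>-th factorial moment of a Poisson variable is the \<open>k\<close>-th power of its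
  mean. For counts below \<open>k\<close> some factor \<open>m - i\<close> is 0, so the series can
  be shifted by \<open>k\<close>.\<close>

lemma expectation_card_inj_tuples:
  assumes B: "B \<in> sets borel" "bounded B"
  shows "integrable M (\<lambda>\<omega>. real (card (inj_tuples k (\<xi> \<omega> \<inter> B))))"
    "expectation (\<lambda>\<omega>. real (card (inj_tuples k (\<xi> \<omega> \<inter> B)))) = measure \<Lambda> B ^ k"
proof -
  let ?l = "measure \<Lambda> B"
  define g where "g m = real (\<Prod>i<k. m - i)" for m :: nat
  have eq: "real (card (inj_tuples k (\<xi> \<omega> \<inter> B))) = g (card (\<xi> \<omega> \<inter> B))" if "\<omega> \<in> space M" for \<omega>
    using card_inj_tuples[OF finite_points[OF that B(2)]] by (simp add: g_def)
  have g: "g (m + k) = fact (m + k) / fact m" for m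
  proof -
    have "real ((\<Prod>i<k. (m + k) - i) * fact (m + k - k)) = real (fact (m + k))"
      by (subst prod_diff_times_fact) auto
    thus ?thesis by (simp add: g_def field_simps del: of_nat_prod)
  qed
  have "(\<lambda>m. (?l ^ k * exp (- ?l)) * (?l ^ m /\<^sub>R fact m)) sums ((?l ^ k * exp (- ?l)) * exp ?l)"
    by (intro sums_mult exp_converges)
  hence "(\<lambda>m. g (m + k) * (?l ^ (m + k) / fact (m + k) * exp (- ?l))) sums (?l ^ k)"
    by (simp add: g power_add exp_minus field_simps)
  hence s: "(\<lambda>m. g m * (?l ^ m / fact m * exp (- ?l))) sums (?l ^ k)"
    by (subst (asm) sums_zero_iff_shift) (auto simp: g_def prod_zero_iff)
  have g0: "0 \<le> g m" for m by (simp add: g_def del: of_nat_prod)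
  note e = expectation_card_points[OF B g0 s]
  show "integrable M (\<lambda>\<omega>. real (card (inj_tuples k (\<xi> \<omega> \<inter> B))))"
    using e(1) by (subst Bochner_Integration.integrable_cong[OF refl eq])
  show "expectation (\<lambda>\<omega>. real (card (inj_tuples k (\<xi> \<omega> \<inter> B)))) = ?l ^ k"
    using e(2) by (subst Bochner_Integration.integral_cong[OF refl eq])
qed

lemma mean_card_points:
  assumes B: "B \<in> sets borel" "bounded B"
  shows "integrable M (\<lambda>\<omega>. real (card (\<xi> \<omega> \<inter> B)))"
    "expectation (\<lambda>\<omega>. real (card (\<xi> \<omega> \<inter> B))) = measure \<Lambda> B"
proof -
  have eq: "real (card (\<xi> \<omega> \<inter> B)) = real (card (inj_tuples 1 (\<xi> \<omega> \<inter> B)))" if "\<omega> \<in> space M" for \<omega>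
    using card_inj_tuples[OF finite_points[OF that B(2)], of 1] by simp
  note e = expectation_card_inj_tuples[OF B, of 1]
  show "integrable M (\<lambda>\<omega>. real (card (\<xi> \<omega> \<inter> B)))"
    using e(1) by (subst Bochner_Integration.integrable_cong[OF refl eq])
  show "expectation (\<lambda>\<omega>. real (card (\<xi> \<omega> \<inter> B))) = measure \<Lambda> B"
    using e(2) by (subst Bochner_Integration.integral_cong[OF refl eq]) auto
qed

text \<open>The point is linearity in the intensity \<open>l = measure \<Lambda> B\<close>. For
  \<open>m = 0\<close> the term contains \<open>l ^ s \<le> l\<close>, by \<open>s \<ge> 1\<close>;
  for \<open>m \<ge> 1\<close> the Poisson weight supplies \<open>l ^ m \<le> l\<close>. Both rest
  on \<open>l \<le> 1\<close>.\<close>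

lemma moment_card_points:
  assumes B: "B \<in> sets borel" "bounded B" and l1: "measure \<Lambda> B \<le> 1" and s: "1 \<le> s" "s \<le> p"
  shows "integrable M (\<lambda>\<omega>. (real (card (\<xi> \<omega> \<inter> B)) + measure \<Lambda> B) ^ s)"
    "expectation (\<lambda>\<omega>. (real (card (\<xi> \<omega> \<inter> B)) + measure \<Lambda> B) ^ s) \<le> poisson_moment_const p * measure \<Lambda> B"
proof -
  let ?l = "measure \<Lambda> B"
  have le: "(real m + ?l) ^ s * (?l ^ m / fact m * exp (- ?l)) \<le> ?l * ((real m + 1) ^ p / fact m)" for m
  proof -
    have "(real m + ?l) ^ s * ?l ^ m \<le> ?l * (real m + 1) ^ p"
    proof (cases m)
      case 0
      have "?l ^ s \<le> ?l ^ 1" by (rule power_decreasing) (use s l1 in auto)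
      thus ?thesis using 0 by simp
    next
      case (Suc m')
      have "?l ^ m \<le> ?l ^ 1" by (rule power_decreasing) (use Suc l1 in auto)
      moreover have "(real m + ?l) ^ s \<le> (real m + 1) ^ s" using l1 by (intro power_mono) auto
      moreover have "(real m + 1) ^ s \<le> (real m + 1) ^ p" using s by (intro power_increasing) auto
      ultimately have "(real m + ?l) ^ s * ?l ^ m \<le> (real m + 1) ^ p * ?l" by (intro mult_mono) auto
      thus ?thesis by (simp add: mult.commute)
    qed
    hence "(real m + ?l) ^ s * ?l ^ m / fact m \<le> ?l * (real m + 1) ^ p / fact m" by (intro divide_right_mono) auto
    moreover have "(real m + ?l) ^ s * ?l ^ m / fact m * exp (- ?l) \<le> (real m + ?l) ^ s * ?l ^ m / fact m * 1"
      by (intro mult_left_mono) auto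
    ultimately show ?thesis by (simp add: mult_ac)
  qed
  have sm: "summable (\<lambda>m. ?l * ((real m + 1) ^ p / fact m))" by (intro summable_mult summable_poisson_moment)
  have sm': "summable (\<lambda>m. (real m + ?l) ^ s * (?l ^ m / fact m * exp (- ?l)))"
    by (rule summable_comparison_test[OF _ sm]) (use le in auto)
  note e = expectation_card_points[OF B _ summable_sums[OF sm']]
  show "integrable M (\<lambda>\<omega>. (real (card (\<xi> \<omega> \<inter> B)) + ?l) ^ s)" by (rule e(1)) simp
  have "expectation (\<lambda>\<omega>. (real (card (\<xi> \<omega> \<inter> B)) + ?l) ^ s) = (\<Sum>m. (real m + ?l) ^ s * (?l ^ m / fact m * exp (- ?l)))"
    by (rule e(2)) simp
  also have "\<dots> \<le> (\<Sum>m. ?l * ((real m + 1) ^ p / fact m))" by (rule suminf_le[OF le sm' sm])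
  also have "\<dots> = poisson_moment_const p * ?l"
    unfolding suminf_mult[OF summable_poisson_moment] poisson_moment_const_def by (rule mult.commute)
  finally show "expectation (\<lambda>\<omega>. (real (card (\<xi> \<omega> \<inter> B)) + ?l) ^ s) \<le> poisson_moment_const p * ?l" .
qed

lemma indep_card_points:
  assumes I: "finite I" and B: "\<And>i. i \<in> I \<Longrightarrow> B i \<in> sets borel" "\<And>i. i \<in> I \<Longrightarrow> bounded (B i)"
    and disj: "disjoint_family_on B I"
  shows "indep_vars (\<lambda>_. borel) (\<lambda>i \<omega>. real (card (\<xi> \<omega> \<inter> B i))) I"
proof -
  obtain f where f: "bij_betw f {..<card I} I"
    using ex_bij_betw_nat_finite[OF I] by (auto simp: atLeast0LessThan)
  have fI: "f i \<in> I" if "i < card I" for i using f that by (auto simp: bij_betw_def)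
  have "indep_vars (\<lambda>_. borel) (\<lambda>i \<omega>. point_count (\<xi> \<omega>) (B (f i))) {..<card I}"
  proof -
    have "disjoint_family_on (\<lambda>i. B (f i)) {..<card I}"
      unfolding disjoint_family_on_def
    proof (intro ballI impI)
      fix m n assume mn: "m \<in> {..<card I}" "n \<in> {..<card I}" "m \<noteq> n"
      hence "f m \<noteq> f n" using f by (auto simp: bij_betw_def inj_on_def)
      thus "B (f m) \<inter> B (f n) = {}" using disj fI mn by (simp add: disjoint_family_on_def)
    qed
    thus ?thesis using poisson B fI by (auto simp: poisson_process_def)
  qed
  hence "indep_vars (\<lambda>_. borel) (\<lambda>i \<omega>. enn2real (point_count (\<xi> \<omega>) (B (f i)))) {..<card I}"
    by (rule indep_vars_compose2) auto
  hence "indep_vars (\<lambda>_. borel) (\<lambda>i \<omega>. enn2real (point_count (\<xi> \<omega>) (B i))) (f ` {..<card I})"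
    using f by (intro indep_vars_reindex) (auto simp: bij_betw_def)
  hence *: "indep_vars (\<lambda>_. borel) (\<lambda>i \<omega>. enn2real (point_count (\<xi> \<omega>) (B i))) I"
    using f by (simp add: bij_betw_def)
  have eq: "enn2real (point_count (\<xi> \<omega>) (B i)) = real (card (\<xi> \<omega> \<inter> B i))" if "\<omega> \<in> space M" "i \<in> I" for \<omega> i
    using point_count_bounded[OF that(1) B(2)[OF that(2)]] by simp
  have "{(\<lambda>\<omega>. enn2real (point_count (\<xi> \<omega>) (B i))) -` A \<inter> space M | A. A \<in> sets borel}
     = {(\<lambda>\<omega>. real (card (\<xi> \<omega> \<inter> B i))) -` A \<inter> space M | A. A \<in> sets borel}" if "i \<in> I" for i
  proof -
    have "(\<lambda>\<omega>. enn2real (point_count (\<xi> \<omega>) (B i))) -` A \<inter> space M = (\<lambda>\<omega>. real (card (\<xi> \<omega> \<inter> B i))) -` A \<inter> space M" for A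
      using eq[OF _ that] by auto
    thus ?thesis by simp
  qed
  thus ?thesis using * measurable_card_points[OF B] unfolding indep_vars_def2
    by (auto cong: indep_sets_cong)
qed

text \<open>Without atoms every point is the centre of a ball of intensity below 1. The closure of
  \<open>W\<close> is compact, so this cover has a Lebesgue number \<open>e\<close>, and once cells
  have diameter below \<open>e\<close> the part of any cell inside \<open>W\<close> lies in one of
  these balls.\<close>

lemma cell_intensity_le_1:
  assumes W: "W \<in> sets borel" "bounded W"
  shows "eventually (\<lambda>j. \<forall>q. measure \<Lambda> (W \<inter> corner j -` {q}) \<le> 1) sequentially"
proof -
  have "\<exists>r>0. emeasure \<Lambda> (ball x r) < 1" for x
  proof -
    have "(\<lambda>n. emeasure \<Lambda> (ball x (1 / Suc n))) \<longlonglongrightarrow> emeasure \<Lambda> (\<Inter>n. ball x (1 / Suc n))"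
    proof (rule Lim_emeasure_decseq)
      show "decseq (\<lambda>n. ball x (1 / Suc n))"
        by (auto simp: decseq_def intro!: subset_ball divide_left_mono)
      show "emeasure \<Lambda> (ball x (1 / Suc i)) \<noteq> \<infinity>" for i using bounded_\<Lambda>[of "ball x (1 / Suc i)"] by auto
    qed (auto simp: sets_\<Lambda>)
    also have "(\<Inter>n. ball x (1 / Suc n)) = {x}"
    proof (intro equalityI subsetI)
      fix y assume y: "y \<in> (\<Inter>n. ball x (1 / Suc n))"
      have "\<not> 0 < dist x y"
      proof
        assume "0 < dist x y"
        then obtain n where "1 / Suc n < dist x y" using nat_approx_posE by blast
        moreover have "dist x y < 1 / Suc n" using y by auto
        ultimately show False by simp
      qed
      thus "y \<in> {x}" by simp
    qed auto
    finally have "eventually (\<lambda>n. emeasure \<Lambda> (ball x (1 / Suc n)) < 1) sequentially"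
      using atomless[of x] by (intro order_tendstoD) auto
    then obtain n where "emeasure \<Lambda> (ball x (1 / Suc n)) < 1" by (auto simp: eventually_sequentially)
    thus ?thesis by (intro exI[of _ "1 / Suc n"]) auto
  qed
  then obtain r where r: "\<And>x. r x > 0" "\<And>x. emeasure \<Lambda> (ball x (r x)) < 1" by metis
  have "compact (closure W)" using W by (simp add: compact_closure)
  moreover have "closure W \<subseteq> \<Union>(range (\<lambda>x. ball x (r x)))" using r(1) centre_in_ball by blast
  ultimately obtain e where e: "0 < e" "\<And>x. x \<in> closure W \<Longrightarrow> \<exists>G\<in>range (\<lambda>x. ball x (r x)). ball x e \<subseteq> G"
    by (rule Heine_Borel_lemma) auto
  have "(\<lambda>j. 2 * (DIM('a) / 2 ^ j)) \<longlonglongrightarrow> 0"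
    using tendsto_mult_right_zero[OF LIMSEQ_divide_realpow_zero[of 2 "real DIM('a)"], of 2] by simp
  hence "eventually (\<lambda>j. 2 * (DIM('a) / 2 ^ j) < e) sequentially" using e by (intro order_tendstoD) auto
  thus ?thesis
  proof (eventually_elim, intro allI)
    fix j q assume j: "2 * (DIM('a) / 2 ^ j) < e"
    show "measure \<Lambda> (W \<inter> corner j -` {q}) \<le> 1"
    proof (cases "W \<inter> corner j -` {q} = {}")
      case False
      then obtain x where x: "x \<in> W" "corner j x = q" by auto
      have "W \<inter> corner j -` {q} \<subseteq> ball x e"
      proof
        fix z assume z: "z \<in> W \<inter> corner j -` {q}"
        have "dist x z = norm ((x - corner j x) - (z - corner j z))" using z x by (simp add: dist_norm)
        also have "\<dots> \<le> norm (x - corner j x) + norm (z - corner j z)" by (rule norm_triangle_ineq4)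
        also have "\<dots> \<le> DIM('a) / 2 ^ j + DIM('a) / 2 ^ j" by (intro add_mono norm_diff_corner_le)
        finally show "z \<in> ball x e" using j by simp
      qed
      moreover obtain y where "ball x e \<subseteq> ball y (r y)" using e(2)[of x] x(1) closure_subset by blast
      ultimately have "emeasure \<Lambda> (W \<inter> corner j -` {q}) \<le> emeasure \<Lambda> (ball y (r y))"
        by (intro emeasure_mono) (auto simp: sets_\<Lambda>)
      also have "\<dots> \<le> 1" using r(2)[of y] by simp
      finally show ?thesis unfolding measure_def by (metis enn2real_leI ennreal_1 zero_le_one)
    qed simp
  qed
qed

end

section \<open>Concentration of tuple sums\<close>

text \<open>A deviation of \<open>Y\<close> by \<open>r\<close> leaves at least \<open>r / 3\<close>
  for \<open>Y - F\<close> or for \<open>F - expectation F\<close>, because the two expectations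
  differ by at most \<open>r / 3\<close>. The first event has small probability by L^1 closeness and
  the second is controlled by the moment of \<open>F\<close>. Since \<open>C\<close> does not depend
  on \<open>e\<close>, the first contribution disappears in the limit and \<open>Y\<close> needs
  only to be integrable.\<close>

lemma (in prob_space) tail_from_approximation:
  fixes Y :: "'a \<Rightarrow> real"
  assumes Y: "integrable M Y" and r: "0 < r"
    and approx: "\<And>e. 0 < e \<Longrightarrow> e \<le> 1 \<Longrightarrow> \<exists>F. integrable M F \<and> expectation (\<lambda>\<omega>. \<bar>Y \<omega> - F \<omega>\<bar>) \<le> e \<and>
       integrable M (\<lambda>\<omega>. (F \<omega> - expectation F) ^ (2 * h)) \<and> expectation (\<lambda>\<omega>. (F \<omega> - expectation F) ^ (2 * h)) \<le> C"
  shows "prob {\<omega> \<in> space M. r \<le> \<bar>Y \<omega> - expectation Y\<bar>} \<le> (3 / r) ^ (2 * h) * C"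
proof (rule field_le_epsilon)
  fix \<epsilon> :: real assume \<epsilon>: "0 < \<epsilon>"
  \<comment> \<open>The entry 1 is the range in which approximations are supplied,
    \<open>r / 3\<close> controls the difference of the expectations, and
    \<open>\<epsilon> * r / 3\<close> makes Markov's bound for \<open>Y - F\<close> equal to at most
    \<open>\<epsilon>\<close>.\<close>
  define e where "e = min 1 (min (r / 3) (\<epsilon> * r / 3))"
  have e: "0 < e" "e \<le> 1" "e \<le> r / 3" "e \<le> \<epsilon> * r / 3" using \<epsilon> r by (auto simp: e_def)
  obtain F where F: "integrable M F" "expectation (\<lambda>\<omega>. \<bar>Y \<omega> - F \<omega>\<bar>) \<le> e"
    "integrable M (\<lambda>\<omega>. (F \<omega> - expectation F) ^ (2 * h))" "expectation (\<lambda>\<omega>. (F \<omega> - expectation F) ^ (2 * h)) \<le> C"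
    using approx[OF e(1,2)] by blast
  note [measurable] = borel_measurable_integrable[OF Y] borel_measurable_integrable[OF F(1)]
  let ?A = "{\<omega> \<in> space M. r / 3 \<le> \<bar>Y \<omega> - F \<omega>\<bar>}"
  let ?B = "{\<omega> \<in> space M. (r / 3) ^ (2 * h) \<le> (F \<omega> - expectation F) ^ (2 * h)}"
  have "\<bar>expectation Y - expectation F\<bar> = \<bar>expectation (\<lambda>\<omega>. Y \<omega> - F \<omega>)\<bar>" using Y F(1) by simp
  also have "\<dots> \<le> expectation (\<lambda>\<omega>. \<bar>Y \<omega> - F \<omega>\<bar>)" by (rule integral_abs_bound)
  also have "\<dots> \<le> r / 3" using F(2) e(3) by simp
  finally have EE: "\<bar>expectation Y - expectation F\<bar> \<le> r / 3" .
  have "{\<omega> \<in> space M. r \<le> \<bar>Y \<omega> - expectation Y\<bar>} \<subseteq> ?A \<union> ?B"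
  proof
    fix \<omega> assume \<omega>: "\<omega> \<in> {\<omega> \<in> space M. r \<le> \<bar>Y \<omega> - expectation Y\<bar>}"
    hence "r \<le> \<bar>Y \<omega> - expectation Y\<bar>" by simp
    hence "r / 3 \<le> \<bar>Y \<omega> - F \<omega>\<bar> \<or> r / 3 \<le> \<bar>F \<omega> - expectation F\<bar>" using EE by linarith
    thus "\<omega> \<in> ?A \<union> ?B"
    proof
      assume "r / 3 \<le> \<bar>F \<omega> - expectation F\<bar>"
      hence "(r / 3) ^ (2 * h) \<le> \<bar>F \<omega> - expectation F\<bar> ^ (2 * h)" using r by (intro power_mono) auto
      thus ?thesis using \<omega> by (simp add: power_even_abs)
    qed (use \<omega> in auto)
  qed
  hence "prob {\<omega> \<in> space M. r \<le> \<bar>Y \<omega> - expectation Y\<bar>} \<le> prob (?A \<union> ?B)" by (intro finite_measure_mono) auto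
  also have "\<dots> \<le> prob ?A + prob ?B" by (intro measure_Un_le) auto
  also have "prob ?A \<le> \<epsilon>"
  proof -
    have "prob ?A \<le> expectation (\<lambda>\<omega>. \<bar>Y \<omega> - F \<omega>\<bar>) / (r / 3)"
      using r Y F(1) by (intro integral_Markov_inequality_measure[where A = "{}"]) auto
    also have "\<dots> \<le> \<epsilon>" using F(2) e(4) r by (simp add: divide_le_eq)
    finally show ?thesis .
  qed
  also have "prob ?B \<le> (3 / r) ^ (2 * h) * C"
  proof -
    have "prob ?B \<le> expectation (\<lambda>\<omega>. (F \<omega> - expectation F) ^ (2 * h)) / (r / 3) ^ (2 * h)"
      using r F(3) by (intro integral_Markov_inequality_measure[where A = "{}"]) auto
    also have "\<dots> \<le> C / (r / 3) ^ (2 * h)" using r F(4) by (intro divide_right_mono) auto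
    finally show ?thesis by (simp add: power_divide mult.commute)
  qed
  finally show "prob {\<omega> \<in> space M. r \<le> \<bar>Y \<omega> - expectation Y\<bar>} \<le> (3 / r) ^ (2 * h) * C + \<epsilon>" by simp
qed

text \<open>The constant of \<open>centered_moment_bound\<close> for Poisson counts. It involves
  \<open>h\<close>, \<open>k\<close> and \<open>D\<close> alone and hence can serve all
  \<open>t\<close> at once.\<close>

definition moment_const :: "nat \<Rightarrow> nat \<Rightarrow> real \<Rightarrow> real" where
  "moment_const h k D = poisson_moment_const (2 * h) ^ (2 * h * k) * (D * (1 + 3 * 2 ^ (2 * h * k))) ^ (2 * h)"

text \<open>Passes from ordered tuples of cells to \<open>k\<close>-sets, the form in which the
  central moments are expanded; a set receives the coefficients of all its orderings.\<close>

lemma sum_inj_tuples_by_range: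
  fixes \<phi> :: "(nat \<Rightarrow> 'b) \<Rightarrow> real"
  assumes I: "finite I"
  shows "(\<Sum>c\<in>inj_tuples k I. \<phi> c * (\<Prod>i<k. g (c i)))
     = (\<Sum>J\<in>{J \<in> Pow I. card J = k}. (\<Sum>c\<in>{c \<in> inj_tuples k I. c ` {..<k} = J}. \<phi> c) * (\<Prod>q\<in>J. g q))"
proof -
  have sub: "(\<lambda>c. c ` {..<k}) ` inj_tuples k I \<subseteq> {J \<in> Pow I. card J = k}"
    by (auto simp: inj_tuples_def PiE_iff card_image)
  have "(\<Sum>c\<in>inj_tuples k I. \<phi> c * (\<Prod>i<k. g (c i)))
     = (\<Sum>J\<in>{J \<in> Pow I. card J = k}. \<Sum>c\<in>{c \<in> inj_tuples k I. c ` {..<k} = J}. \<phi> c * (\<Prod>i<k. g (c i)))"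
    by (rule sum.group[symmetric, OF finite_inj_tuples[OF I] _ sub]) (use I in simp)
  also have "\<dots> = (\<Sum>J\<in>{J \<in> Pow I. card J = k}. (\<Sum>c\<in>{c \<in> inj_tuples k I. c ` {..<k} = J}. \<phi> c) * (\<Prod>q\<in>J. g q))"
  proof (intro sum.cong refl)
    fix J assume "J \<in> {J \<in> Pow I. card J = k}"
    have "(\<Prod>i<k. g (c i)) = (\<Prod>q\<in>J. g q)" if "c \<in> inj_tuples k I" "c ` {..<k} = J" for c
      using that prod.reindex[of c "{..<k}" g] by (auto simp: inj_tuples_def)
    thus "(\<Sum>c\<in>{c \<in> inj_tuples k I. c ` {..<k} = J}. \<phi> c * (\<Prod>i<k. g (c i)))
      = (\<Sum>c\<in>{c \<in> inj_tuples k I. c ` {..<k} = J}. \<phi> c) * (\<Prod>q\<in>J. g q)"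
      by (simp add: sum_distrib_right)
  qed
  finally show ?thesis .
qed

context poisson_points
begin

text \<open>From the corner \<open>p\<close> to a point \<open>z\<close> of a near cell one passes
  through \<open>x\<close>, \<open>y\<close> and the corner of that cell: three offsets between a
  point and its corner, covered by \<open>d\<close>, and one distance at most \<open>R\<close>. So
  the disjoint sets in the sum all lie in one ball of radius \<open>R + d\<close>.\<close>

lemma sum_near_cells_le:
  assumes W: "W \<in> sets borel" "bounded W" and I: "finite I"
    and j: "3 * (DIM('a) / 2 ^ j) \<le> d"
    and B: "measure \<Lambda> (cball p (R + d)) \<le> B"
  shows "(\<Sum>q\<in>{q \<in> I. \<exists>x y. corner j x = p \<and> corner j y = q \<and> dist x y \<le> R}. measure \<Lambda> (W \<inter> corner j -` {q})) \<le> B"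
proof -
  let ?N = "{q \<in> I. \<exists>x y. corner j x = p \<and> corner j y = q \<and> dist x y \<le> R}"
  have s: "W \<inter> corner j -` {q} \<in> sets borel" for q using W corner_vimage_borel by auto
  have fin: "emeasure \<Lambda> X \<noteq> \<infinity>" if "bounded X" "X \<in> sets borel" for X
    using bounded_\<Lambda>[OF that] by simp
  have "(\<Sum>q\<in>?N. measure \<Lambda> (W \<inter> corner j -` {q})) = measure \<Lambda> (\<Union>q\<in>?N. W \<inter> corner j -` {q})"
  proof (rule measure_finite_Union[symmetric])
    show "finite ?N" using I by simp
    show "(\<lambda>q. W \<inter> corner j -` {q}) ` ?N \<subseteq> sets \<Lambda>" using s by (auto simp: sets_\<Lambda>)
    show "disjoint_family_on (\<lambda>q. W \<inter> corner j -` {q}) ?N" by (auto simp: disjoint_family_on_def)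
    show "emeasure \<Lambda> (W \<inter> corner j -` {q}) \<noteq> \<infinity>" for q
      by (rule fin[OF _ s]) (use W in \<open>auto intro: bounded_subset\<close>)
  qed
  also have "\<dots> \<le> measure \<Lambda> (cball p (R + d))"
  proof (rule measure_mono_fmeasurable)
    show "(\<Union>q\<in>?N. W \<inter> corner j -` {q}) \<subseteq> cball p (R + d)"
    proof
      fix z assume "z \<in> (\<Union>q\<in>?N. W \<inter> corner j -` {q})"
      then obtain x y where xy: "corner j x = p" "corner j y = corner j z" "dist x y \<le> R" by auto
      have "dist p z = norm ((corner j x - x) + (x - y) + (y - corner j y) + (corner j z - z))"
        using xy by (simp add: dist_norm)
      also have "\<dots> \<le> norm (corner j x - x) + norm (x - y) + norm (y - corner j y) + norm (corner j z - z)"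
        by (intro norm_triangle_le add_mono order_refl norm_triangle_ineq)
      also have "\<dots> \<le> DIM('a) / 2 ^ j + R + DIM('a) / 2 ^ j + DIM('a) / 2 ^ j"
        using norm_diff_corner_le[of x j] norm_diff_corner_le[of y j] norm_diff_corner_le[of z j] xy(3)
        by (simp add: norm_minus_commute dist_norm)
      finally show "z \<in> cball p (R + d)" using j by simp
    qed
    show "(\<Union>q\<in>?N. W \<inter> corner j -` {q}) \<in> sets \<Lambda>" unfolding sets_\<Lambda> by (intro sets.finite_UN s) (use I in simp)
    show "cball p (R + d) \<in> fmeasurable \<Lambda>"
      using fin[of "cball p (R + d)"] by (intro fmeasurableI) (auto simp: sets_\<Lambda> top.not_eq_extremum)
  qed
  finally show ?thesis using B by simp
qed

text \<open>Provides what \<open>tail_from_approximation\<close> requires, for a bounded window. The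
  moment bound mentions neither \<open>W\<close> nor \<open>e\<close>, although the grid and the
  polynomial depend on both.\<close>

lemma window_moment_approximation:
  fixes f :: "(nat \<Rightarrow> 'a) \<Rightarrow> nat"
  assumes W: "W \<in> sets borel" "bounded W" and k: "1 \<le> k"
    and f: "f \<in> PiM {..<k} (\<lambda>_. borel) \<rightarrow>\<^sub>M count_space UNIV" and K: "\<And>x. f x \<le> K"
    and R: "\<And>x a b. 0 < f x \<Longrightarrow> a < k \<Longrightarrow> b < k \<Longrightarrow> dist (x a) (x b) \<le> R"
    and d: "0 < d" and B: "\<And>x. measure \<Lambda> (cball x (R + d)) \<le> B" "1 \<le> B"
    and D: "real (k ^ k * (K * K)) \<le> D"
    and mean: "expectation (\<lambda>\<omega>. \<Sum>x\<in>inj_tuples k (\<xi> \<omega> \<inter> W). real (f x)) + 1 \<le> D * B ^ k"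
    and e: "0 < e" "e \<le> 1"
  shows "integrable M (\<lambda>\<omega>. \<Sum>x\<in>inj_tuples k (\<xi> \<omega> \<inter> W). real (f x))"
    "\<exists>F. integrable M F \<and> expectation (\<lambda>\<omega>. \<bar>(\<Sum>x\<in>inj_tuples k (\<xi> \<omega> \<inter> W). real (f x)) - F \<omega>\<bar>) \<le> e \<and>
       integrable M (\<lambda>\<omega>. (F \<omega> - expectation F) ^ (2 * h)) \<and>
       expectation (\<lambda>\<omega>. (F \<omega> - expectation F) ^ (2 * h)) \<le> moment_const h k D * B ^ (h * (2 * k - 1))"
proof -
  interpret window_process M \<xi> W k
    by unfold_locales (use W expectation_card_inj_tuples(1)[OF W] in auto)
  let ?X = "\<lambda>\<omega>. \<Sum>x\<in>inj_tuples k (\<xi> \<omega> \<inter> W). real (f x)"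
  show intX: "integrable M ?X" using integrable_sum_tuples[OF f K] by (simp add: tuples_def)
  let ?Q = "\<lambda>j. (\<forall>q. measure \<Lambda> (W \<inter> corner j -` {q}) \<le> 1) \<and> 3 * (DIM('a) / 2 ^ j) \<le> d"
  have "(\<lambda>j. 3 * (DIM('a) / 2 ^ j)) \<longlonglongrightarrow> 0"
    using tendsto_mult_right_zero[OF LIMSEQ_divide_realpow_zero[of 2 "real DIM('a)"], of 3] by simp
  hence "eventually (\<lambda>j. 3 * (DIM('a) / 2 ^ j) < d) sequentially" using d by (intro order_tendstoD) auto
  hence evQ: "eventually ?Q sequentially" using cell_intensity_le_1[OF W] by eventually_elim auto
  obtain j A where j: "?Q j" and jA: "\<And>loc. (\<forall>x\<in>space PB. 0 < f x \<longrightarrow> loc (\<lambda>i\<in>{..<k}. corner j (x i))) \<Longrightarrow>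
     expectation (\<lambda>\<omega>. \<bar>(\<Sum>x\<in>tuples \<omega>. real (f x)) -
       (\<Sum>c\<in>inj_tuples k (corner j ` W). (if loc c then \<Sum>v=1..K. of_bool (c \<in> A v) * real v else 0) *
          (\<Prod>i<k. cell_count j (c i) \<omega>))\<bar>) \<le> e"
    using L1_approximation[OF f K e(1) evQ] by blast
  define I where "I = corner j ` W"
  have fI: "finite I" unfolding I_def by (rule finite_corner_image[OF W(2)])
  define near where "near p q \<longleftrightarrow> (\<exists>x y. corner j x = p \<and> corner j y = q \<and> dist x y \<le> R)" for p q :: 'a
  define loc where "loc c \<longleftrightarrow> (\<forall>a<k. \<forall>b<k. near (c a) (c b))" for c
  define \<phi> where "\<phi> c = (if loc c then \<Sum>v=1..K. of_bool (c \<in> A v) * real v else 0)" for c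
  define l where "l q = measure \<Lambda> (W \<inter> corner j -` {q})" for q
  define n where "n = cell_count j"
  define \<J> where "\<J> = {J \<in> Pow I. card J = k}"
  define cJ where "cJ J = (\<Sum>c\<in>{c \<in> inj_tuples k I. c ` {..<k} = J}. \<phi> c)" for J
  define F where "F \<omega> = (\<Sum>J\<in>\<J>. cJ J * (\<Prod>i\<in>J. n i \<omega>))" for \<omega>
  have s: "W \<inter> corner j -` {q} \<in> sets borel" "bounded (W \<inter> corner j -` {q})" for q
    using W corner_vimage_borel by (auto intro: bounded_subset)
  have n0: "0 \<le> n i \<omega>" for i \<omega> by (simp add: n_def cell_count_def)
  have nint: "integrable M (n i)" "expectation (n i) = l i" for i
    using mean_card_points[OF s(1)[of i] s(2)[of i]] by (simp_all add: n_def cell_count_def[abs_def] l_def)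
  have nmom: "integrable M (\<lambda>\<omega>. (n i \<omega> + l i) ^ u)"
     "expectation (\<lambda>\<omega>. (n i \<omega> + l i) ^ u) \<le> poisson_moment_const (2 * h) * l i" if "1 \<le> u" "u \<le> 2 * h" for i u
    using moment_card_points[OF s(1)[of i] s(2)[of i] _ that] j by (simp_all add: n_def cell_count_def[abs_def] l_def)
  have ind: "indep_vars (\<lambda>_. borel) n I"
  proof -
    have "disjoint_family_on (\<lambda>q. W \<inter> corner j -` {q}) I" by (auto simp: disjoint_family_on_def)
    from indep_card_points[OF fI s this] show ?thesis by (simp add: n_def cell_count_def[abs_def])
  qed
  have \<phi>0: "0 \<le> \<phi> c" for c by (auto simp: \<phi>_def intro!: sum_nonneg)
  \<comment> \<open>The sets \<open>A v\<close> need not be disjoint, so \<open>\<phi> c\<close> can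
    exceed \<open>K\<close>; it is a sum of at most \<open>K\<close> terms of size at most
    \<open>K\<close>. With at most \<open>k ^ k\<close> orderings of each set this explains the
    lower bound on \<open>D\<close>.\<close>
  have \<phi>K: "\<phi> c \<le> real (K * K)" for c
  proof -
    have "(\<Sum>v=1..K. of_bool (c \<in> A v) * real v) \<le> (\<Sum>v=1..K. real K)" by (intro sum_mono) (auto simp: of_bool_def)
    thus ?thesis by (auto simp: \<phi>_def)
  qed
  have finJ: "finite J" "J \<subseteq> I" "card J = k" if "J \<in> \<J>" for J
    using that fI by (auto simp: \<J>_def intro: finite_subset)
  have F_eq: "F \<omega> = (\<Sum>c\<in>inj_tuples k (corner j ` W). \<phi> c * (\<Prod>i<k. cell_count j (c i) \<omega>))" for \<omega>
    unfolding F_def n_def I_def[symmetric] \<J>_def cJ_def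
    by (rule sum_inj_tuples_by_range[OF fI, symmetric])
  have ZF: "expectation (\<lambda>\<omega>. \<bar>?X \<omega> - F \<omega>\<bar>) \<le> e"
    unfolding F_eq \<phi>_def tuples_def[symmetric]
  proof (rule jA, intro ballI impI)
    fix x assume x: "x \<in> space PB" "0 < f x"
    show "loc (\<lambda>i\<in>{..<k}. corner j (x i))"
      unfolding loc_def near_def
    proof (intro allI impI)
      fix a b assume "a < k" "b < k"
      thus "\<exists>xa y. corner j xa = (\<lambda>i\<in>{..<k}. corner j (x i)) a \<and> corner j y = (\<lambda>i\<in>{..<k}. corner j (x i)) b \<and> dist xa y \<le> R"
        using R[OF x(2)] by (intro exI[of _ "x a"] exI[of _ "x b"]) auto
    qed
  qed
  have Jint: "integrable M (\<lambda>\<omega>. \<Prod>i\<in>J. n i \<omega>)" "expectation (\<lambda>\<omega>. \<Prod>i\<in>J. n i \<omega>) = (\<Prod>i\<in>J. l i)" if J: "J \<in> \<J>" for J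
    using indep_vars_integrable[OF finJ(1)[OF J] indep_vars_subset[OF ind finJ(2)[OF J]] nint(1)]
      indep_vars_lebesgue_integral[OF finJ(1)[OF J] indep_vars_subset[OF ind finJ(2)[OF J]] nint(1)]
    by (simp_all add: nint(2))
  have Fint: "integrable M F"
    unfolding F_def[abs_def] by (intro Bochner_Integration.integrable_sum integrable_mult_right Jint)
  have EF: "expectation F = (\<Sum>J\<in>\<J>. cJ J * (\<Prod>i\<in>J. l i))"
    unfolding F_def[abs_def]
    by (subst Bochner_Integration.integral_sum) (auto intro!: integrable_mult_right Jint sum.cong simp: Jint(2))
  \<comment> \<open>By independence \<open>expectation F\<close> is exactly the weighted coefficient
    sum that \<open>centered_moment_bound\<close> needs to be small. It is bounded by comparison
    with the mean of the tuple sum instead of by counting local sets; the extra 1 in the hypothesis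
    \<open>mean\<close> pays for the error \<open>e\<close>.\<close>
  have "expectation F \<le> expectation (\<lambda>\<omega>. ?X \<omega> + \<bar>?X \<omega> - F \<omega>\<bar>)"
    by (intro integral_mono Fint Bochner_Integration.integrable_add intX Bochner_Integration.integrable_abs Bochner_Integration.integrable_diff) auto
  also have "\<dots> = expectation ?X + expectation (\<lambda>\<omega>. \<bar>?X \<omega> - F \<omega>\<bar>)"
    by (intro Bochner_Integration.integral_add intX Bochner_Integration.integrable_abs Bochner_Integration.integrable_diff Fint)
  also have "\<dots> \<le> D * B ^ k" using ZF mean e(2) by simp
  finally have EFle: "(\<Sum>J\<in>\<J>. cJ J * (\<Prod>i\<in>J. l i)) \<le> D * B ^ k" unfolding EF .
  have cJ: "0 \<le> cJ J \<and> cJ J \<le> D" if J: "J \<in> \<J>" for J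
  proof
    show "0 \<le> cJ J" unfolding cJ_def by (intro sum_nonneg \<phi>0)
    have "cJ J \<le> (\<Sum>c\<in>{c \<in> inj_tuples k I. c ` {..<k} = J}. real (K * K))"
      unfolding cJ_def by (intro sum_mono \<phi>K)
    also have "\<dots> = real (card {c \<in> inj_tuples k I. c ` {..<k} = J}) * real (K * K)" by simp
    also have "card {c \<in> inj_tuples k I. c ` {..<k} = J} \<le> card ({..<k} \<rightarrow>\<^sub>E J)"
      using finJ(1)[OF J] by (intro card_mono finite_PiE) (auto simp: inj_tuples_def PiE_def)
    also have "card ({..<k} \<rightarrow>\<^sub>E J) = k ^ k" using finJ[OF J] by (simp add: card_funcsetE)
    finally have "cJ J \<le> real (k ^ k) * real (K * K)" by (simp add: mult_right_mono)
    also have "\<dots> \<le> D" using D by simp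
    finally show "cJ J \<le> D" .
  qed
  have near: "near p q" if J: "J \<in> \<J>" "cJ J \<noteq> 0" "p \<in> J" "q \<in> J" for J p q
  proof -
    obtain c where c: "c ` {..<k} = J" "\<phi> c \<noteq> 0" using J(2) unfolding cJ_def by (auto elim: sum.not_neutral_contains_not_neutral)
    hence "loc c" by (auto simp: \<phi>_def split: if_splits)
    moreover obtain a b where "p = c a" "q = c b" "a < k" "b < k" using c(1) J(3,4) by auto
    ultimately show ?thesis by (auto simp: loc_def)
  qed
  have l1: "(\<Sum>q\<in>{q \<in> I. near p q}. l q) \<le> B" if "p \<in> I" for p
    unfolding l_def near_def by (rule sum_near_cells_le[OF W fI conjunct2[OF j] B(1)])
  have JJ: "\<J> \<subseteq> Pow I" by (auto simp: \<J>_def)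
  note m = centered_moment_bound[OF fI ind n0 nint nmom one_le_poisson_moment_const B(2) k JJ finJ(3) cJ near l1 EFle,
      folded EF F_def]
  show "\<exists>F. integrable M F \<and> expectation (\<lambda>\<omega>. \<bar>?X \<omega> - F \<omega>\<bar>) \<le> e \<and>
       integrable M (\<lambda>\<omega>. (F \<omega> - expectation F) ^ (2 * h)) \<and>
       expectation (\<lambda>\<omega>. (F \<omega> - expectation F) ^ (2 * h)) \<le> moment_const h k D * B ^ (h * (2 * k - 1))"
    using Fint ZF m by (intro exI[of _ F]) (simp add: moment_const_def)
qed

end

section \<open>Counting copies of a graph in a tuple of points\<close>

definition copies :: "'v ugraph \<Rightarrow> 'u ugraph \<Rightarrow> 'u ugraph set" where
  "copies H G = {H'. subgraph_of H' G \<and> graph_iso H' H}"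

definition map_graph :: "('a \<Rightarrow> 'b) \<Rightarrow> 'a ugraph \<Rightarrow> 'b ugraph" where
  "map_graph g G = UGraph (g ` verts G) ((`) g ` edges G)"

lemma copies_subset: "H' \<in> copies H G \<Longrightarrow> verts H' \<subseteq> verts G \<and> edges H' \<subseteq> Pow (verts G)"
  by (auto simp: copies_def subgraph_of_def simple_graph_def)

lemma finite_copies:
  assumes "finite (verts G)"
  shows "finite (copies H G)"
proof (rule finite_subset)
  show "copies H G \<subseteq> (\<lambda>(V, E). UGraph V E) ` (Pow (verts G) \<times> Pow (Pow (verts G)))"
  proof
    fix H' assume H': "H' \<in> copies H G"
    hence "verts H' \<subseteq> verts G" "edges H' \<subseteq> Pow (verts G)"
      by (auto dest!: copies_subset)
    moreover have "H' = UGraph (verts H') (edges H')" by simp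
    ultimately show "H' \<in> (\<lambda>(V, E). UGraph V E) ` (Pow (verts G) \<times> Pow (Pow (verts G)))"
      by (intro image_eqI[of _ _ "(verts H', edges H')"]) auto
  qed
qed (use assms in auto)

lemma edges_subset_Pow_verts: "simple_graph G \<Longrightarrow> edges G \<subseteq> Pow (verts G)"
  by (auto simp: simple_graph_def)

lemma map_graph_copies:
  assumes g: "inj_on g (verts G)" and H': "H' \<in> copies H G"
  shows "map_graph g H' \<in> copies H (map_graph g G)"
proof -
  have s: "simple_graph H'" "verts H' \<subseteq> verts G" "edges H' \<subseteq> edges G" and iso: "graph_iso H' H"
    using H' by (auto simp: copies_def subgraph_of_def)
  have gi: "inj_on g (verts H')" by (rule inj_on_subset[OF g s(2)])
  have "simple_graph (map_graph g H')"
    unfolding simple_graph_def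
  proof
    fix e' assume "e' \<in> edges (map_graph g H')"
    then obtain e where e: "e \<in> edges H'" "e' = g ` e" by (auto simp: map_graph_def)
    hence "e \<subseteq> verts H'" "card e = 2" using s(1) by (auto simp: simple_graph_def)
    thus "e' \<subseteq> verts (map_graph g H') \<and> card e' = 2"
      using e(2) card_image[OF inj_on_subset[OF gi]] by (auto simp: map_graph_def)
  qed
  hence sub: "subgraph_of (map_graph g H') (map_graph g G)"
    using s by (auto simp: subgraph_of_def map_graph_def)
  obtain f where f: "bij_betw f (verts H') (verts H)"
    "\<And>u v. u \<in> verts H' \<Longrightarrow> v \<in> verts H' \<Longrightarrow> {u, v} \<in> edges H' \<longleftrightarrow> {f u, f v} \<in> edges H"
    using iso by (auto simp: graph_iso_def)
  let ?i = "inv_into (verts H') g"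
  have bi: "bij_betw ?i (g ` verts H') (verts H')"
    using gi by (intro bij_betw_inv_into) (simp add: bij_betw_def)
  have "graph_iso (map_graph g H') H"
    unfolding graph_iso_def
  proof (intro exI[of _ "f \<circ> ?i"] conjI ballI)
    show "bij_betw (f \<circ> ?i) (verts (map_graph g H')) (verts H)"
      using bij_betw_trans[OF bi f(1)] by (simp add: map_graph_def)
    fix u v assume "u \<in> verts (map_graph g H')" "v \<in> verts (map_graph g H')"
    then obtain a b where ab: "a \<in> verts H'" "b \<in> verts H'" "u = g a" "v = g b" by (auto simp: map_graph_def)
    have "{u, v} \<in> edges (map_graph g H') \<longleftrightarrow> g ` {a, b} \<in> (`) g ` edges H'" using ab by (simp add: map_graph_def)
    also have "\<dots> \<longleftrightarrow> {a, b} \<in> edges H'"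
    proof
      assume "g ` {a, b} \<in> (`) g ` edges H'"
      then obtain e where e: "e \<in> edges H'" "g ` {a, b} = g ` e" by auto
      hence "e \<subseteq> verts H'" using edges_subset_Pow_verts[OF s(1)] by auto
      hence "{a, b} = e" using e(2) inj_on_image_eq_iff[OF gi, of "{a, b}" e] ab by simp
      thus "{a, b} \<in> edges H'" using e by simp
    qed (rule imageI)
    also have "\<dots> \<longleftrightarrow> {(f \<circ> ?i) u, (f \<circ> ?i) v} \<in> edges H"
      using f(2)[OF ab(1,2)] ab gi by (simp add: inv_into_f_f)
    finally show "{u, v} \<in> edges (map_graph g H') \<longleftrightarrow> {(f \<circ> ?i) u, (f \<circ> ?i) v} \<in> edges H" .
  qed
  thus ?thesis using sub by (simp add: copies_def)
qed

lemma inj_on_map_graph: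
  assumes g: "inj_on g (verts G)"
  shows "inj_on (map_graph g) (copies H G)"
proof (rule inj_onI)
  fix X Y assume X: "X \<in> copies H G" and Y: "Y \<in> copies H G" and eq: "map_graph g X = map_graph g Y"
  have sX: "verts X \<subseteq> verts G" "edges X \<subseteq> Pow (verts G)" and sY: "verts Y \<subseteq> verts G" "edges Y \<subseteq> Pow (verts G)"
    using copies_subset[OF X] copies_subset[OF Y] by simp_all
  have "g ` verts X = g ` verts Y" "(`) g ` edges X = (`) g ` edges Y" using eq by (auto simp: map_graph_def)
  hence "verts X = verts Y" "edges X = edges Y"
    using inj_on_image_eq_iff[OF g sX(1) sY(1)] inj_on_image_eq_iff[OF inj_on_image_Pow[OF g] sX(2) sY(2)] by auto
  thus "X = Y" by (simp add: ugraph.expand)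
qed

text \<open>Relabelling along \<open>g\<close> maps copies injectively to copies, and the inverse
  relabelling gives the reverse inequality. The condition on the edges makes the inverse recover
  \<open>G\<close> itself.\<close>

lemma card_copies_map_graph:
  assumes fin: "finite (verts G)" and g: "inj_on g (verts G)" and G: "edges G \<subseteq> Pow (verts G)"
  shows "card (copies H (map_graph g G)) = card (copies H G)"
proof (rule antisym)
  let ?i = "inv_into (verts G) g"
  have gi: "inj_on ?i (verts (map_graph g G))" by (simp add: map_graph_def inj_on_inv_into)
  have "?i ` g ` A = A" if "A \<subseteq> verts G" for A using g that by (rule inv_into_image_cancel)
  hence v: "?i ` g ` verts G = verts G" and "\<And>e. e \<in> edges G \<Longrightarrow> ?i ` g ` e = e" using G by auto
  hence "(\<lambda>e. ?i ` g ` e) ` edges G = (\<lambda>e. e) ` edges G" by (intro image_cong refl)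
  hence E: "(`) ?i ` (`) g ` edges G = edges G" by (simp only: image_image image_ident)
  have inv: "map_graph ?i (map_graph g G) = G" by (simp only: map_graph_def ugraph.sel v E ugraph.collapse)
  show "card (copies H (map_graph g G)) \<le> card (copies H G)"
    using map_graph_copies[OF gi] inj_on_map_graph[OF gi] finite_copies[OF fin]
    by (intro card_inj_on_le[of "map_graph ?i"]) (auto simp: inv)
  show "card (copies H G) \<le> card (copies H (map_graph g G))"
    using map_graph_copies[OF g] inj_on_map_graph[OF g] fin
    by (intro card_inj_on_le[of "map_graph g"] finite_copies) (auto simp: map_graph_def)
qed

text \<open>The number of copies in a tuple depends only on which indices are adjacent. On the fixed
  vertex set \<open>{..<k}\<close> there are finitely many such patterns, whence both a uniform
  bound and measurability of the count.\<close>

definition relation_graph :: "nat \<Rightarrow> (nat \<times> nat) set \<Rightarrow> nat ugraph" where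
  "relation_graph k P = UGraph {..<k} {{a, b} | a b. a < k \<and> b < k \<and> a \<noteq> b \<and> (a, b) \<in> P}"

definition adjacency :: "nat \<Rightarrow> 'a::euclidean_space set \<Rightarrow> (nat \<Rightarrow> 'a) \<Rightarrow> (nat \<times> nat) set" where
  "adjacency k T x = {(a, b) \<in> {..<k} \<times> {..<k}. x a - x b \<in> T}"

definition tuple_count :: "'v ugraph \<Rightarrow> 'a::euclidean_space set \<Rightarrow> (nat \<Rightarrow> 'a) \<Rightarrow> nat" where
  "tuple_count H T x = card (copies H (relation_graph (card (verts H)) (adjacency (card (verts H)) T x)))"

lemma geometric_graph_eq_map_graph:
  assumes "inj_on x {..<k}"
  shows "geometric_graph T (x ` {..<k}) = map_graph x (relation_graph k (adjacency k T x))"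
proof -
  have "{{u, v} | u v. u \<in> x ` {..<k} \<and> v \<in> x ` {..<k} \<and> u \<noteq> v \<and> u - v \<in> T}
    = (`) x ` {{a, b} | a b. a < k \<and> b < k \<and> a \<noteq> b \<and> (a, b) \<in> adjacency k T x}" (is "?L = ?R")
  proof (intro equalityI subsetI)
    fix e assume "e \<in> ?L"
    then obtain a b where ab: "a < k" "b < k" "e = {x a, x b}" "x a \<noteq> x b" "x a - x b \<in> T" by auto
    hence "e = x ` {a, b}" "{a, b} \<in> {{a, b} | a b. a < k \<and> b < k \<and> a \<noteq> b \<and> (a, b) \<in> adjacency k T x}"
      by (auto simp: adjacency_def)
    thus "e \<in> ?R" by blast
  next
    fix e assume "e \<in> ?R"
    then obtain a b where ab: "a < k" "b < k" "a \<noteq> b" "e = {x a, x b}" "x a - x b \<in> T"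
      by (auto simp: adjacency_def)
    moreover have "x a \<noteq> x b" using assms ab by (auto simp: inj_on_def)
    ultimately show "e \<in> ?L" by blast
  qed
  thus ?thesis by (simp add: geometric_graph_def map_graph_def relation_graph_def)
qed

lemma card_copies_geometric_graph:
  assumes "inj_on x {..<card (verts H)}"
  shows "card {H'. subgraph_of H' (geometric_graph T (x ` {..<card (verts H)})) \<and> graph_iso H' H} = tuple_count H T x"
  using card_copies_map_graph[of "relation_graph (card (verts H)) (adjacency (card (verts H)) T x)" x H] assms
  unfolding geometric_graph_eq_map_graph[OF assms] tuple_count_def copies_def[symmetric]
  by (auto simp: relation_graph_def)

text \<open>Indexing identifies lists of distinct points with injective tuples, and copies in the
  geometric graph are copies in the index graph relabelled by the tuple.\<close>

lemma subgraph_count_eq: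
  "subgraph_count H T \<xi> = (\<integral>\<^sup>+x. of_nat (tuple_count H T x) \<partial>count_space (inj_tuples (card (verts H)) \<xi>))
     / of_nat (fact (card (verts H)))"
proof -
  let ?k = "card (verts H)"
  let ?L = "{xs. length xs = ?k \<and> distinct xs \<and> set xs \<subseteq> \<xi>}"
  let ?g = "\<lambda>xs. \<lambda>i\<in>{..<?k}. xs ! i"
  have bij: "bij_betw ?g ?L (inj_tuples ?k \<xi>)"
  proof (rule bij_betw_byWitness[where f' = "\<lambda>x. map x [0..<?k]"])
    show "\<forall>xs\<in>?L. map (?g xs) [0..<?k] = xs" by (auto intro!: nth_equalityI)
    show "\<forall>x\<in>inj_tuples ?k \<xi>. ?g (map x [0..<?k]) = x"
      by (auto simp: inj_tuples_def PiE_iff extensional_def fun_eq_iff)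
    show "?g ` ?L \<subseteq> inj_tuples ?k \<xi>"
      by (auto simp: inj_tuples_def PiE_iff inj_on_def nth_eq_iff_index_eq subset_iff)
    show "(\<lambda>x. map x [0..<?k]) ` inj_tuples ?k \<xi> \<subseteq> ?L"
      by (auto simp: inj_tuples_def PiE_iff distinct_map atLeast0LessThan)
  qed
  have "(\<integral>\<^sup>+xs. of_nat (card {H'. subgraph_of H' (geometric_graph T (set xs)) \<and> graph_iso H' H}) \<partial>count_space ?L)
    = (\<integral>\<^sup>+xs. of_nat (tuple_count H T (?g xs)) \<partial>count_space ?L)"
  proof (rule nn_integral_cong)
    fix xs assume "xs \<in> space (count_space ?L)"
    hence xs: "length xs = ?k" "distinct xs" by auto
    have "set xs = ?g xs ` {..<?k}" using xs by (auto simp: set_conv_nth)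
    moreover have "inj_on (?g xs) {..<?k}" using xs by (auto simp: inj_on_def nth_eq_iff_index_eq)
    ultimately show "of_nat (card {H'. subgraph_of H' (geometric_graph T (set xs)) \<and> graph_iso H' H})
       = (of_nat (tuple_count H T (?g xs)) :: ennreal)"
      using card_copies_geometric_graph[of "?g xs" H T] by simp
  qed
  also have "\<dots> = (\<integral>\<^sup>+x. of_nat (tuple_count H T x) \<partial>count_space (inj_tuples ?k \<xi>))"
    by (rule nn_integral_bij_count_space[OF bij])
  finally show ?thesis by (simp add: subgraph_count_def)
qed

text \<open>Free of \<open>T\<close> and of the points, so that one bound holds for all
  \<open>t\<close>.\<close>

definition max_copies :: "'v ugraph \<Rightarrow> nat" where
  "max_copies H = Max ((\<lambda>P. card (copies H (relation_graph (card (verts H)) P))) `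
     Pow ({..<card (verts H)} \<times> {..<card (verts H)}))"

lemma tuple_count_le_max: "tuple_count H T x \<le> max_copies H"
  unfolding tuple_count_def max_copies_def
  by (intro Max_ge finite_imageI imageI) (auto simp: adjacency_def)

text \<open>The map \<open>adjacency\<close> has finitely many values, and each fibre is a finite
  intersection of the measurable conditions \<open>x a - x b \<in> T\<close> and their
  negations.\<close>

lemma measurable_tuple_count:
  fixes T :: "'a::euclidean_space set"
  assumes T: "T \<in> sets borel"
  shows "tuple_count H T \<in> PiM {..<card (verts H)} (\<lambda>_. borel) \<rightarrow>\<^sub>M count_space UNIV"
proof -
  let ?k = "card (verts H)"
  let ?PB = "PiM {..<?k} (\<lambda>_. borel :: 'a measure)"
  let ?S = "Pow ({..<?k} \<times> {..<?k})"
  have "adjacency ?k T \<in> ?PB \<rightarrow>\<^sub>M count_space ?S"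
  proof (subst measurable_count_space_eq2)
    show "finite ?S" by simp
    show "adjacency ?k T \<in> space ?PB \<rightarrow> ?S \<and> (\<forall>P\<in>?S. adjacency ?k T -` {P} \<inter> space ?PB \<in> sets ?PB)"
    proof (intro conjI ballI)
      show "adjacency ?k T \<in> space ?PB \<rightarrow> ?S" by (auto simp: adjacency_def)
      fix P assume P: "P \<in> ?S"
      have m: "{x \<in> space ?PB. x a - x b \<in> T} \<in> sets ?PB" if "a < ?k" "b < ?k" for a b
      proof -
        have "(\<lambda>x. x a - x b) \<in> ?PB \<rightarrow>\<^sub>M borel"
          using that by (intro borel_measurable_diff measurable_component_singleton) auto
        from measurable_sets[OF this T] show ?thesis by (simp add: vimage_def Int_def conj_commute)
      qed
      have "{x \<in> space ?PB. \<forall>ab\<in>{..<?k} \<times> {..<?k}. (x (fst ab) - x (snd ab) \<in> T) = (ab \<in> P)} \<in> sets ?PB"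
      proof (rule sets.sets_Collect_finite_All)
        show "{x \<in> space ?PB. (x (fst ab) - x (snd ab) \<in> T) = (ab \<in> P)} \<in> sets ?PB" if "ab \<in> {..<?k} \<times> {..<?k}" for ab
        proof (cases "ab \<in> P")
          case True thus ?thesis using m[of "fst ab" "snd ab"] that by auto
        next
          case False
          have "{x \<in> space ?PB. \<not> x (fst ab) - x (snd ab) \<in> T} \<in> sets ?PB"
            by (intro sets.sets_Collect_neg m) (use that in auto)
          thus ?thesis using False by simp
        qed
      qed auto
      moreover have "adjacency ?k T -` {P} \<inter> space ?PB
        = {x \<in> space ?PB. \<forall>ab\<in>{..<?k} \<times> {..<?k}. (x (fst ab) - x (snd ab) \<in> T) = (ab \<in> P)}"
        using P by (auto simp: adjacency_def set_eq_iff)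
      ultimately show "adjacency ?k T -` {P} \<inter> space ?PB \<in> sets ?PB" by simp
    qed
  qed
  from measurable_compose[OF this, of "\<lambda>P. card (copies H (relation_graph ?k P))" "count_space UNIV"]
  show ?thesis by (simp add: tuple_count_def[abs_def])
qed

section \<open>Locality of copies, and existence of a copy in every tight cluster\<close>

lemma iso_lift_path:
  assumes H: "simple_graph H"
    and f: "bij_betw f (verts H') (verts H)"
      "\<And>u v. u \<in> verts H' \<Longrightarrow> v \<in> verts H' \<Longrightarrow> {u, v} \<in> edges H' \<longleftrightarrow> {f u, f v} \<in> edges H"
    and p: "(p, q) \<in> {(x, y). {x, y} \<in> edges H}\<^sup>*" and a: "a \<in> verts H'" "f a = p"
  shows "\<exists>b\<in>verts H'. f b = q \<and> (a, b) \<in> {(x, y). x \<in> verts H' \<and> y \<in> verts H' \<and> {x, y} \<in> edges H'}\<^sup>*"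
  using p
proof (induction rule: rtrancl_induct)
  case base
  show ?case using a by auto
next
  case (step y z)
  then obtain b where b: "b \<in> verts H'" "f b = y"
    "(a, b) \<in> {(x, y). x \<in> verts H' \<and> y \<in> verts H' \<and> {x, y} \<in> edges H'}\<^sup>*" by auto
  have e: "{y, z} \<in> edges H" using step by simp
  hence "z \<in> f ` verts H'" using H f(1) by (auto simp: simple_graph_def bij_betw_def)
  then obtain c where c: "c \<in> verts H'" "f c = z" by blast
  have "{b, c} \<in> edges H'" using f(2)[OF b(1) c(1)] b(2) c(2) e by simp
  hence "(b, c) \<in> {(x, y). x \<in> verts H' \<and> y \<in> verts H' \<and> {x, y} \<in> edges H'}" using b c by simp
  thus ?case using b c by (intro bexI[of _ c]) (auto intro: rtrancl_into_rtrancl)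
qed

lemma dist_relpow_le:
  fixes x :: "nat \<Rightarrow> 'a::metric_space"
  assumes "\<And>u v. (u, v) \<in> R \<Longrightarrow> dist (x u) (x v) \<le> L" "(a, b) \<in> R ^^ n"
  shows "dist (x a) (x b) \<le> real n * L"
  using assms(2)
proof (induction n arbitrary: b)
  case (Suc n)
  then obtain c where c: "(a, c) \<in> R ^^ n" "(c, b) \<in> R" by auto
  have "dist (x a) (x b) \<le> dist (x a) (x c) + dist (x c) (x b)" by (rule dist_triangle)
  also have "\<dots> \<le> real n * L + L" by (intro add_mono Suc.IH c assms(1))
  finally show ?case by (simp add: algebra_simps)
qed simp

text \<open>A copy has \<open>k\<close> vertices and therefore uses all of \<open>{..<k}\<close>, so
  any two indices are joined by a lifted path of the connected graph \<open>H\<close>. Such a path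
  can be chosen with at most \<open>k * k\<close> steps, each of length at most
  \<open>L\<close>.\<close>

lemma tuple_count_local:
  fixes T :: "'a::euclidean_space set"
  assumes H: "simple_graph H" "connected_graph H" and k: "card (verts H) = k" "0 < k"
    and T: "T \<subseteq> cball 0 L" and L: "0 \<le> L" and pos: "0 < tuple_count H T x" and ab: "a < k" "b < k"
  shows "dist (x a) (x b) \<le> real (k * k) * L"
proof -
  have "copies H (relation_graph k (adjacency k T x)) \<noteq> {}"
    using pos unfolding tuple_count_def k(1) by (metis card.empty less_irrefl)
  then obtain H' where H': "subgraph_of H' (relation_graph k (adjacency k T x))" "graph_iso H' H"
    by (auto simp: copies_def)
  obtain f where f: "bij_betw f (verts H') (verts H)"
    "\<And>u v. u \<in> verts H' \<Longrightarrow> v \<in> verts H' \<Longrightarrow> {u, v} \<in> edges H' \<longleftrightarrow> {f u, f v} \<in> edges H"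
    using H'(2) by (auto simp: graph_iso_def)
  have "verts H' \<subseteq> {..<k}" using H'(1) by (auto simp: subgraph_of_def relation_graph_def)
  moreover have "card (verts H') = k" using bij_betw_same_card[OF f(1)] k by simp
  ultimately have V: "verts H' = {..<k}" by (intro card_subset_eq) auto
  have "f a \<in> verts H" "f b \<in> verts H" using ab V f(1) by (auto simp: bij_betw_def)
  hence "(f a, f b) \<in> {(x, y). {x, y} \<in> edges H}\<^sup>*" using H(2) by (simp add: connected_graph_def)
  then obtain c where c: "c \<in> verts H'" "f c = f b"
    "(a, c) \<in> {(x, y). x \<in> verts H' \<and> y \<in> verts H' \<and> {x, y} \<in> edges H'}\<^sup>*"
    using iso_lift_path[OF H(1) f, of "f a" "f b" a] ab V by auto
  have cb: "c = b" using c f(1) ab V by (auto simp: bij_betw_def inj_on_def)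
  let ?R = "{(u, v). u \<in> verts H' \<and> v \<in> verts H' \<and> {u, v} \<in> edges H'}"
  have R: "?R \<subseteq> {..<k} \<times> {..<k}" using V by auto
  hence fR: "finite ?R" by (rule finite_subset) simp
  have cR: "card ?R \<le> k * k" using card_mono[OF _ R] by (simp add: card_cartesian_product)
  have "(a, b) \<in> (\<Union>n\<in>{n. n \<le> card ?R}. ?R ^^ n)"
    using c(3) cb rtrancl_finite_eq_relpow[OF fR] by simp
  then obtain n where n: "n \<le> card ?R" "(a, b) \<in> ?R ^^ n" by auto
  have "dist (x u) (x v) \<le> L" if "(u, v) \<in> ?R" for u v
  proof -
    have "{u, v} \<in> edges (relation_graph k (adjacency k T x))" using that H'(1) by (auto simp: subgraph_of_def)
    then obtain p q where pq: "{u, v} = {p, q}" "x p - x q \<in> T"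
      by (auto simp: relation_graph_def adjacency_def)
    have "norm (x p - x q) \<le> L" using pq(2) T by auto
    hence "dist (x p) (x q) \<le> L" by (simp add: dist_norm)
    thus ?thesis using pq(1) by (auto simp: doubleton_eq_iff dist_commute)
  qed
  hence "dist (x a) (x b) \<le> real n * L" by (rule dist_relpow_le[OF _ n(2)])
  also have "\<dots> \<le> real (k * k) * L" using n(1) cR L by (intro mult_right_mono) (auto simp del: of_nat_mult)
  finally show ?thesis .
qed

text \<open>When all pairs are adjacent, any numbering of the vertices of \<open>H\<close> embeds
  it. This is the source of the lower bound on the mean count, and through it of the upper bound on
  the intensity of small balls.\<close>

lemma tuple_count_complete:
  fixes T :: "'a::euclidean_space set"
  assumes H: "simple_graph H" and k: "card (verts H) = k" "0 < k"
    and T: "\<And>a b. a < k \<Longrightarrow> b < k \<Longrightarrow> x a - x b \<in> T"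
  shows "1 \<le> tuple_count H T x"
proof -
  let ?G = "relation_graph k (adjacency k T x)"
  have "finite (verts H)" using k card_ge_0_finite by auto
  then obtain h where h: "bij_betw h (verts H) {..<k}"
    using ex_bij_betw_finite_nat k(1) by (metis atLeast0LessThan)
  have "inj_on h (verts H)" using h by (simp add: bij_betw_def)
  moreover have "H \<in> copies H H"
  proof -
    have "graph_iso H H" unfolding graph_iso_def by (intro exI[of _ id]) auto
    thus ?thesis using H by (simp add: copies_def subgraph_of_def)
  qed
  ultimately have mH: "map_graph h H \<in> copies H (map_graph h H)" by (rule map_graph_copies)
  have vE: "verts (map_graph h H) \<subseteq> {..<k}" using h by (auto simp: map_graph_def bij_betw_def)
  have "edges (map_graph h H) \<subseteq> edges ?G"
  proof
    fix e assume e: "e \<in> edges (map_graph h H)"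
    hence "e \<subseteq> {..<k}" "card e = 2" using mH vE by (auto simp: copies_def subgraph_of_def simple_graph_def)
    then obtain a b where "e = {a, b}" "a \<noteq> b" "a < k" "b < k" by (auto simp: card_2_iff)
    thus "e \<in> edges ?G" using T by (auto simp: relation_graph_def adjacency_def)
  qed
  hence "map_graph h H \<in> copies H ?G" using mH vE by (auto simp: copies_def subgraph_of_def relation_graph_def)
  moreover have "finite (copies H ?G)" by (rule finite_copies) (simp add: relation_graph_def)
  ultimately have "0 < card (copies H ?G)" by (auto simp: card_gt_0_iff)
  thus ?thesis by (simp add: tuple_count_def k(1))
qed

section \<open>Tuple sums over the whole process\<close>

text \<open>Reading the sum as the value at \<open>X\<close> of a measure with density
  \<open>f\<close> provides monotonicity and continuity from below in \<open>X\<close>.\<close>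

lemma nn_integral_count_space_eq_emeasure_density:
  "(\<integral>\<^sup>+x. f x \<partial>count_space X) = emeasure (density (count_space UNIV) f) X"
  by (subst emeasure_density) (auto simp: nn_integral_indicator_singleton nn_integral_restrict_space[symmetric] restrict_count_space)

lemma nn_integral_count_space_UN_incseq:
  fixes f :: "'b \<Rightarrow> ennreal"
  assumes "incseq A"
  shows "(\<integral>\<^sup>+x. f x \<partial>count_space (\<Union>n. A n)) = (SUP n. \<integral>\<^sup>+x. f x \<partial>count_space (A n))"
  unfolding nn_integral_count_space_eq_emeasure_density using assms by (intro SUP_emeasure_incseq[symmetric]) auto

text \<open>Compactness is used once, for the ball of radius \<open>s\<close> about 0; translation
  and scaling produce covers with the same finite \<open>P\<close> for all centres and radii. The
  number of small balls is therefore independent of \<open>t\<close>.\<close>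

lemma cball_covering:
  fixes s :: real
  shows "\<exists>P :: 'a::euclidean_space set. finite P \<and>
    (\<forall>x r. 0 < r \<longrightarrow> cball x (s * r) \<subseteq> (\<Union>p\<in>P. cball (x + r *\<^sub>R p) (r / 2)))"
proof -
  have "cball (0 :: 'a) s \<subseteq> (\<Union>p\<in>UNIV. ball p (1 / 2))"
  proof
    fix x :: 'a
    show "x \<in> (\<Union>p\<in>UNIV. ball p (1 / 2))" by (rule UN_I[of x]) auto
  qed
  then obtain P :: "'a set" where P: "finite P" "cball 0 s \<subseteq> (\<Union>p\<in>P. ball p (1 / 2))"
    by (rule compactE_image[OF compact_cball, rotated]) auto
  have "cball x (s * r) \<subseteq> (\<Union>p\<in>P. cball (x + r *\<^sub>R p) (r / 2))" if r: "0 < r" for x :: 'a and r :: real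
  proof
    fix y assume y: "y \<in> cball x (s * r)"
    define z where "z = (1 / r) *\<^sub>R (y - x)"
    have "norm z = dist x y / r" using r by (simp add: z_def dist_norm norm_minus_commute)
    also have "\<dots> \<le> s" using y r by (simp add: divide_le_eq)
    finally have "z \<in> (\<Union>p\<in>P. ball p (1 / 2))" using P(2) by (simp add: subset_iff)
    then obtain p where p: "p \<in> P" "z \<in> ball p (1 / 2)" by blast
    have "x + r *\<^sub>R p - y = r *\<^sub>R (p - z)" using r by (simp add: z_def algebra_simps)
    hence "dist (x + r *\<^sub>R p) y = r * dist p z" using r by (simp add: dist_norm)
    also have "\<dots> \<le> r * (1 / 2)" using p(2) r by (intro mult_left_mono) auto
    finally show "y \<in> (\<Union>p\<in>P. cball (x + r *\<^sub>R p) (r / 2))" using p(1) by auto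
  qed
  thus ?thesis using P(1) by blast
qed

definition tuple_sum :: "nat \<Rightarrow> ((nat \<Rightarrow> 'a) \<Rightarrow> nat) \<Rightarrow> 'a set \<Rightarrow> ennreal" where
  "tuple_sum k f X = (\<integral>\<^sup>+x. of_nat (f x) \<partial>count_space (inj_tuples k X))"

context poisson_points
begin

lemma measure_cball_covering:
  assumes P: "finite P" "cball x (s * r) \<subseteq> (\<Union>p\<in>P. cball (x + r *\<^sub>R p) (r / 2))"
    and b: "\<And>y. measure \<Lambda> (cball y (r / 2)) \<le> b"
  shows "measure \<Lambda> (cball x (s * r)) \<le> real (card P) * b"
proof -
  have fm: "cball y u \<in> fmeasurable \<Lambda>" for y u
    using bounded_\<Lambda>[of "cball y u"] by (intro fmeasurableI) (auto simp: sets_\<Lambda>)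
  have "measure \<Lambda> (cball x (s * r)) \<le> measure \<Lambda> (\<Union>p\<in>P. cball (x + r *\<^sub>R p) (r / 2))"
    by (intro measure_mono_fmeasurable P(2) fmeasurable.finite_UN P(1) fm) (auto simp: sets_\<Lambda>)
  also have "\<dots> \<le> (\<Sum>p\<in>P. measure \<Lambda> (cball (x + r *\<^sub>R p) (r / 2)))"
    by (intro measure_UNION_le P(1)) (auto simp: sets_\<Lambda>)
  also have "\<dots> \<le> (\<Sum>p\<in>P. b)" by (intro sum_mono b)
  finally show ?thesis by simp
qed

lemma nn_integral_inj_tuples_window:
  fixes f :: "(nat \<Rightarrow> 'a) \<Rightarrow> nat"
  assumes "\<omega> \<in> space M" "bounded W"
  shows "(\<integral>\<^sup>+x. of_nat (f x) \<partial>count_space (inj_tuples k (\<xi> \<omega> \<inter> W)))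
    = ennreal (\<Sum>x\<in>inj_tuples k (\<xi> \<omega> \<inter> W). real (f x))"
  unfolding nn_integral_count_space_finite[OF finite_inj_tuples[OF finite_points[OF assms]]] ennreal_of_nat_eq_real_of_nat
  by (rule sum_ennreal) simp

lemma tuple_sum_window_le:
  fixes f :: "(nat \<Rightarrow> 'a) \<Rightarrow> nat"
  assumes "\<omega> \<in> space M" "bounded W" "tuple_sum k f (\<xi> \<omega>) < \<infinity>"
  shows "(\<Sum>x\<in>inj_tuples k (\<xi> \<omega> \<inter> W). real (f x)) \<le> enn2real (tuple_sum k f (\<xi> \<omega>))"
proof -
  have "(\<integral>\<^sup>+x. of_nat (f x) \<partial>count_space (inj_tuples k (\<xi> \<omega> \<inter> W)))
     \<le> (\<integral>\<^sup>+x. of_nat (f x) \<partial>count_space (inj_tuples k (\<xi> \<omega>)))"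
    unfolding nn_integral_count_space_eq_emeasure_density
    by (intro emeasure_mono inj_tuples_mono) auto
  hence "ennreal (\<Sum>x\<in>inj_tuples k (\<xi> \<omega> \<inter> W). real (f x)) \<le> tuple_sum k f (\<xi> \<omega>)"
    unfolding nn_integral_inj_tuples_window[OF assms(1,2)] tuple_sum_def .
  thus ?thesis using enn2real_mono[of _ "tuple_sum k f (\<xi> \<omega>)"] assms(3) by (fastforce simp: sum_nonneg)
qed

lemma tuple_sum_LIMSEQ:
  fixes f :: "(nat \<Rightarrow> 'a) \<Rightarrow> nat"
  assumes \<omega>: "\<omega> \<in> space M" and fin: "tuple_sum k f (\<xi> \<omega>) < \<infinity>"
  shows "(\<lambda>n. \<Sum>x\<in>inj_tuples k (\<xi> \<omega> \<inter> cball 0 (real n)). real (f x)) \<longlonglongrightarrow> enn2real (tuple_sum k f (\<xi> \<omega>))"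
proof -
  let ?A = "\<lambda>n. inj_tuples k (\<xi> \<omega> \<inter> cball 0 (real n))"
  have inc: "incseq ?A" by (auto simp: incseq_def intro!: inj_tuples_mono)
  have U: "(\<Union>n. ?A n) = inj_tuples k (\<xi> \<omega>)"
  proof (intro equalityI subsetI)
    fix x assume x: "x \<in> inj_tuples k (\<xi> \<omega>)"
    have "bounded (x ` {..<k})" by (rule finite_imp_bounded) simp
    then obtain b where b: "\<And>i. i < k \<Longrightarrow> norm (x i) \<le> b" by (auto simp: bounded_iff)
    obtain n :: nat where "b \<le> real n" using real_arch_simple by blast
    hence "x \<in> ?A n" using x b by (fastforce simp: inj_tuples_def PiE_iff)
    thus "x \<in> (\<Union>n. ?A n)" by blast
  qed (auto intro: inj_tuples_mono[THEN subsetD])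
  have inc': "incseq (\<lambda>n. ennreal (\<Sum>x\<in>?A n. real (f x)))"
    using inc finite_inj_tuples[OF finite_points[OF \<omega> bounded_cball]]
    by (auto simp: incseq_def intro!: ennreal_leI sum_mono2)
  have "tuple_sum k f (\<xi> \<omega>) = (SUP n. ennreal (\<Sum>x\<in>?A n. real (f x)))"
    unfolding tuple_sum_def U[symmetric] nn_integral_count_space_UN_incseq[OF inc]
    by (simp add: nn_integral_inj_tuples_window[OF \<omega>])
  hence "(\<lambda>n. ennreal (\<Sum>x\<in>?A n. real (f x))) \<longlonglongrightarrow> ennreal (enn2real (tuple_sum k f (\<xi> \<omega>)))"
    using LIMSEQ_SUP[OF inc'] fin by simp
  thus ?thesis by (subst (asm) tendsto_ennreal_iff) (auto intro!: always_eventually sum_nonneg)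
qed

text \<open>Each injective tuple of points in \<open>Q\<close> contributes at least 1 to the sum,
  and the mean number of these tuples is exactly \<open>measure \<Lambda> Q ^ k\<close>.\<close>

lemma measure_power_le_expectation:
  fixes f :: "(nat \<Rightarrow> 'a) \<Rightarrow> nat"
  assumes int: "integrable M (\<lambda>\<omega>. enn2real (tuple_sum k f (\<xi> \<omega>)))" and fin: "AE \<omega> in M. tuple_sum k f (\<xi> \<omega>) < \<infinity>"
    and Q: "Q \<in> sets borel" "bounded Q" and f: "\<And>x. (\<And>i. i < k \<Longrightarrow> x i \<in> Q) \<Longrightarrow> 1 \<le> f x"
  shows "measure \<Lambda> Q ^ k \<le> expectation (\<lambda>\<omega>. enn2real (tuple_sum k f (\<xi> \<omega>)))"
proof -
  have "measure \<Lambda> Q ^ k = expectation (\<lambda>\<omega>. real (card (inj_tuples k (\<xi> \<omega> \<inter> Q))))"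
    by (rule expectation_card_inj_tuples(2)[OF Q, symmetric])
  also have "\<dots> \<le> expectation (\<lambda>\<omega>. enn2real (tuple_sum k f (\<xi> \<omega>)))"
  proof (intro integral_mono_AE expectation_card_inj_tuples(1)[OF Q] int)
    show "AE \<omega> in M. real (card (inj_tuples k (\<xi> \<omega> \<inter> Q))) \<le> enn2real (tuple_sum k f (\<xi> \<omega>))"
      using fin
    proof (rule AE_mp, intro AE_I2 impI)
      fix \<omega> assume \<omega>: "\<omega> \<in> space M" "tuple_sum k f (\<xi> \<omega>) < \<infinity>"
      have "real (card (inj_tuples k (\<xi> \<omega> \<inter> Q))) = (\<Sum>x\<in>inj_tuples k (\<xi> \<omega> \<inter> Q). 1)" by simp
      also have "\<dots> \<le> (\<Sum>x\<in>inj_tuples k (\<xi> \<omega> \<inter> Q). real (f x))"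
      proof (rule sum_mono)
        fix x assume "x \<in> inj_tuples k (\<xi> \<omega> \<inter> Q)"
        hence "1 \<le> f x" by (intro f) (auto simp: inj_tuples_def PiE_iff)
        thus "1 \<le> real (f x)" by simp
      qed
      also have "\<dots> \<le> enn2real (tuple_sum k f (\<xi> \<omega>))" by (rule tuple_sum_window_le[OF \<omega>(1) Q(2) \<omega>(2)])
      finally show "real (card (inj_tuples k (\<xi> \<omega> \<inter> Q))) \<le> enn2real (tuple_sum k f (\<xi> \<omega>))" .
    qed
  qed
  finally show ?thesis .
qed

text \<open>Passage from windows to the whole process: growing balls exhaust the space, dominated
  convergence brings the truncation error below \<open>e / 2\<close>, and the polynomial may use the
  other half. The moment bound is the same for every window, so it survives.\<close>

lemma tuple_sum_tail:
  fixes f :: "(nat \<Rightarrow> 'a) \<Rightarrow> nat"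
  assumes k: "1 \<le> k"
    and f: "f \<in> PiM {..<k} (\<lambda>_. borel) \<rightarrow>\<^sub>M count_space UNIV" and K: "\<And>x. f x \<le> K"
    and R: "\<And>x a b. 0 < f x \<Longrightarrow> a < k \<Longrightarrow> b < k \<Longrightarrow> dist (x a) (x b) \<le> R"
    and d: "0 < d" and B: "\<And>x. measure \<Lambda> (cball x (R + d)) \<le> B" "1 \<le> B"
    and D: "real (k ^ k * (K * K)) \<le> D"
    and int: "integrable M (\<lambda>\<omega>. enn2real (tuple_sum k f (\<xi> \<omega>)))" and fin: "AE \<omega> in M. tuple_sum k f (\<xi> \<omega>) < \<infinity>"
    and mean: "expectation (\<lambda>\<omega>. enn2real (tuple_sum k f (\<xi> \<omega>))) + 1 \<le> D * B ^ k"
    and r: "0 < r"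
  shows "prob {\<omega> \<in> space M. r \<le> \<bar>enn2real (tuple_sum k f (\<xi> \<omega>)) - expectation (\<lambda>\<omega>. enn2real (tuple_sum k f (\<xi> \<omega>)))\<bar>}
    \<le> (3 / r) ^ (2 * h) * (moment_const h k D * B ^ (h * (2 * k - 1)))"
proof (rule tail_from_approximation[OF int r])
  fix e :: real assume e: "0 < e" "e \<le> 1"
  let ?Y = "\<lambda>\<omega>. enn2real (tuple_sum k f (\<xi> \<omega>))"
  let ?X = "\<lambda>n \<omega>. \<Sum>x\<in>inj_tuples k (\<xi> \<omega> \<inter> cball 0 (real n)). real (f x)"
  have Xint: "integrable M (?X n)" for n
  proof -
    interpret window_process M \<xi> "cball 0 (real n)" k
      by unfold_locales (use expectation_card_inj_tuples(1)[of "cball 0 (real n)" k] in auto)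
    show ?thesis using integrable_sum_tuples[OF f K] by (simp add: tuples_def)
  qed
  have XY: "AE \<omega> in M. ?X n \<omega> \<le> ?Y \<omega>" for n
    using fin by (rule AE_mp) (auto intro!: AE_I2 tuple_sum_window_le)
  have "(\<lambda>n. expectation (\<lambda>\<omega>. \<bar>?Y \<omega> - ?X n \<omega>\<bar>)) \<longlonglongrightarrow> expectation (\<lambda>_. 0)"
  proof (rule integral_dominated_convergence[where w = ?Y])
    show "(\<lambda>\<omega>. \<bar>?Y \<omega> - ?X n \<omega>\<bar>) \<in> borel_measurable M" for n
      using borel_measurable_integrable[OF int] borel_measurable_integrable[OF Xint] by measurable
    show "AE \<omega> in M. (\<lambda>n. \<bar>?Y \<omega> - ?X n \<omega>\<bar>) \<longlonglongrightarrow> 0"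
      using fin
    proof (rule AE_mp, intro AE_I2 impI)
      fix \<omega> assume "\<omega> \<in> space M" "tuple_sum k f (\<xi> \<omega>) < \<infinity>"
      from tuple_sum_LIMSEQ[OF this] have "(\<lambda>n. \<bar>?Y \<omega> - ?X n \<omega>\<bar>) \<longlonglongrightarrow> \<bar>?Y \<omega> - ?Y \<omega>\<bar>"
        by (intro tendsto_intros)
      thus "(\<lambda>n. \<bar>?Y \<omega> - ?X n \<omega>\<bar>) \<longlonglongrightarrow> 0" by simp
    qed
    show "AE \<omega> in M. norm \<bar>?Y \<omega> - ?X n \<omega>\<bar> \<le> ?Y \<omega>" for n
      using XY[of n]
    proof (rule AE_mp, intro AE_I2 impI)
      fix \<omega> assume "?X n \<omega> \<le> ?Y \<omega>"
      moreover have "0 \<le> ?X n \<omega>" by (intro sum_nonneg) simp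
      ultimately show "norm \<bar>?Y \<omega> - ?X n \<omega>\<bar> \<le> ?Y \<omega>" by simp
    qed
  qed (use int in auto)
  hence "eventually (\<lambda>n. expectation (\<lambda>\<omega>. \<bar>?Y \<omega> - ?X n \<omega>\<bar>) < e / 2) sequentially"
    using e by (intro order_tendstoD(2)) auto
  then obtain n where n: "expectation (\<lambda>\<omega>. \<bar>?Y \<omega> - ?X n \<omega>\<bar>) < e / 2" by (auto simp: eventually_sequentially)
  \<comment> \<open>The window sum lies below the full sum almost surely, so the window inherits the
    required bound on the mean.\<close>
  have "expectation (?X n) \<le> expectation ?Y" by (intro integral_mono_AE Xint int XY)
  hence "expectation (?X n) + 1 \<le> D * B ^ k" using mean by simp
  hence "\<exists>F. integrable M F \<and> expectation (\<lambda>\<omega>. \<bar>?X n \<omega> - F \<omega>\<bar>) \<le> e / 2 \<and>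
       integrable M (\<lambda>\<omega>. (F \<omega> - expectation F) ^ (2 * h)) \<and>
       expectation (\<lambda>\<omega>. (F \<omega> - expectation F) ^ (2 * h)) \<le> moment_const h k D * B ^ (h * (2 * k - 1))"
    using e by (intro window_moment_approximation(2)[OF _ bounded_cball k f K R d B D]) auto
  then obtain F where F: "integrable M F" "expectation (\<lambda>\<omega>. \<bar>?X n \<omega> - F \<omega>\<bar>) \<le> e / 2"
     "integrable M (\<lambda>\<omega>. (F \<omega> - expectation F) ^ (2 * h))"
     "expectation (\<lambda>\<omega>. (F \<omega> - expectation F) ^ (2 * h)) \<le> moment_const h k D * B ^ (h * (2 * k - 1))"
    by blast
  have "expectation (\<lambda>\<omega>. \<bar>?Y \<omega> - F \<omega>\<bar>) \<le> expectation (\<lambda>\<omega>. \<bar>?Y \<omega> - ?X n \<omega>\<bar> + \<bar>?X n \<omega> - F \<omega>\<bar>)"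
    using int Xint F(1) by (intro integral_mono Bochner_Integration.integrable_add Bochner_Integration.integrable_abs Bochner_Integration.integrable_diff) auto
  also have "\<dots> = expectation (\<lambda>\<omega>. \<bar>?Y \<omega> - ?X n \<omega>\<bar>) + expectation (\<lambda>\<omega>. \<bar>?X n \<omega> - F \<omega>\<bar>)"
    using int Xint F(1) by (intro Bochner_Integration.integral_add Bochner_Integration.integrable_abs Bochner_Integration.integrable_diff) auto
  also have "\<dots> \<le> e" using n F(2) by simp
  finally have "expectation (\<lambda>\<omega>. \<bar>?Y \<omega> - F \<omega>\<bar>) \<le> e" .
  thus "\<exists>F. integrable M F \<and> expectation (\<lambda>\<omega>. \<bar>?Y \<omega> - F \<omega>\<bar>) \<le> e \<and>
       integrable M (\<lambda>\<omega>. (F \<omega> - expectation F) ^ (2 * h)) \<and>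
       expectation (\<lambda>\<omega>. (F \<omega> - expectation F) ^ (2 * h)) \<le> moment_const h k D * B ^ (h * (2 * k - 1))"
    using F by blast
qed

end

section \<open>The strong law\<close>

lemma enn2real_divide_of_nat: "enn2real (x / of_nat n) = enn2real x / real n" if "0 < n"
proof (cases x)
  case (real r)
  thus ?thesis using that by (simp add: divide_ennreal ennreal_of_nat_eq_real_of_nat)
next
  case top
  thus ?thesis using that by (simp add: ennreal_top_divide)
qed

lemma (in prob_space) AE_tendsto_0_if_summable_tails:
  fixes Z :: "nat \<Rightarrow> 'a \<Rightarrow> real"
  assumes meas: "\<And>t. t0 \<le> t \<Longrightarrow> Z t \<in> borel_measurable M"
    and tail: "\<And>e. 0 < e \<Longrightarrow> \<exists>C. \<forall>t\<ge>t0. prob {\<omega> \<in> space M. e \<le> \<bar>Z t \<omega>\<bar>} \<le> C / real t ^ 2"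
  shows "AE \<omega> in M. (\<lambda>t. Z t \<omega>) \<longlonglongrightarrow> 0"
proof -
  have "AE \<omega> in M. eventually (\<lambda>t. \<bar>Z t \<omega>\<bar> < 1 / real (Suc n)) sequentially" for n
  proof -
    \<comment> \<open>Empty before \<open>t0\<close>, where nothing is known about
      \<open>Z t\<close>; finitely many indices do not affect the Borel-Cantelli argument.\<close>
    define A where "A t = (if t0 \<le> t then {\<omega> \<in> space M. 1 / real (Suc n) \<le> \<bar>Z t \<omega>\<bar>} else {})" for t
    have A: "A t \<in> events" for t
    proof (cases "t0 \<le> t")
      case True
      note [measurable] = meas[OF True]
      show ?thesis using True by (simp add: A_def)
    qed (simp add: A_def)
    obtain C where C: "\<And>t. t0 \<le> t \<Longrightarrow> prob {\<omega> \<in> space M. 1 / real (Suc n) \<le> \<bar>Z t \<omega>\<bar>} \<le> C / real t ^ 2"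
      using tail[of "1 / real (Suc n)"] by auto
    have "summable (\<lambda>t. C * inverse (real t ^ 2))" by (intro summable_mult inverse_power_summable) simp
    hence "summable (\<lambda>t. prob (A t))"
      by (rule summable_comparison_test[rotated])
         (use C in \<open>auto intro!: exI[of _ t0] simp: A_def divide_inverse\<close>)
    hence "AE \<omega> in M. eventually (\<lambda>t. \<omega> \<in> space M - A t) sequentially"
      by (intro borel_cantelli_AE1 A) (simp_all add: emeasure_eq_measure)
    thus ?thesis
    proof (rule AE_mp, intro AE_I2 impI)
      fix \<omega> assume "eventually (\<lambda>t. \<omega> \<in> space M - A t) sequentially"
      moreover have "eventually (\<lambda>t. t0 \<le> t) sequentially" by (rule eventually_ge_at_top)
      ultimately show "eventually (\<lambda>t. \<bar>Z t \<omega>\<bar> < 1 / real (Suc n)) sequentially"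
        by eventually_elim (auto simp: A_def)
    qed
  qed
  hence "AE \<omega> in M. \<forall>n. eventually (\<lambda>t. \<bar>Z t \<omega>\<bar> < 1 / real (Suc n)) sequentially" by (simp add: AE_all_countable)
  thus ?thesis
  proof (rule AE_mp, intro AE_I2 impI)
    fix \<omega> assume ev: "\<forall>n. eventually (\<lambda>t. \<bar>Z t \<omega>\<bar> < 1 / real (Suc n)) sequentially"
    show "(\<lambda>t. Z t \<omega>) \<longlonglongrightarrow> 0"
    proof (rule tendstoI)
      fix e :: real assume "0 < e"
      then obtain n where n: "1 / real (Suc n) < e" using nat_approx_posE by blast
      from ev have "eventually (\<lambda>t. \<bar>Z t \<omega>\<bar> < 1 / real (Suc n)) sequentially" by blast
      thus "eventually (\<lambda>t. dist (Z t \<omega>) 0 < e) sequentially"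
        by eventually_elim (use n in auto)
    qed
  qed
qed

text \<open>With \<open>h = k * q\<close> and \<open>V = u ^ k\<close>, the quotient of
  \<open>u ^ (h * (2 * k - 1))\<close> by \<open>V ^ (2 * h)\<close> is the inverse of
  \<open>u ^ h = V ^ q\<close>. The growth of \<open>V\<close> bounds \<open>V ^ q\<close> below by
  \<open>c ^ q * t powr (\<gamma> * q)\<close>, hence by \<open>c ^ q * t ^ 2\<close>.\<close>

lemma tail_algebra:
  fixes u V c r C0 m :: real
  assumes k: "1 \<le> k" and u: "1 \<le> u" "u ^ k = V" and V: "c * t powr \<gamma> \<le> V" and c: "0 < c" and t: "1 \<le> t"
    and q: "2 \<le> \<gamma> * real q" and r: "0 < r" and C: "0 \<le> m" "0 \<le> C0"
  shows "(3 / (r * V)) ^ (2 * (k * q)) * (m * (C0 * u) ^ (k * q * (2 * k - 1)))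
    \<le> ((3 / r) ^ (2 * (k * q)) * m * C0 ^ (k * q * (2 * k - 1)) / c ^ q) / t ^ 2"
proof -
  let ?h = "k * q"
  have hk: "?h * (2 * k - 1) + ?h = k * (2 * ?h)" using k by (cases k) (auto simp: algebra_simps)
  have u0: "0 < u" using u by simp
  have "c ^ q * t ^ 2 = c ^ q * t powr 2" using t by (simp add: powr_numeral)
  also have "\<dots> \<le> c ^ q * t powr (\<gamma> * real q)" using c t q by (intro mult_left_mono powr_mono) auto
  also have "\<dots> = (c * t powr \<gamma>) ^ q" using t by (simp add: power_mult_distrib powr_powr[symmetric] powr_realpow)
  also have "\<dots> \<le> V ^ q" using V c by (intro power_mono) auto
  also have "V ^ q = u ^ ?h" by (simp add: u(2)[symmetric] power_mult)
  finally have uh: "c ^ q * t ^ 2 \<le> u ^ ?h" .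
  have "V ^ (2 * ?h) = u ^ (?h * (2 * k - 1)) * u ^ ?h"
    by (simp only: u(2)[symmetric] power_mult[symmetric] power_add[symmetric] hk)
  hence "(3 / (r * V)) ^ (2 * ?h) * (m * (C0 * u) ^ (?h * (2 * k - 1)))
    = (3 / r) ^ (2 * ?h) * m * C0 ^ (?h * (2 * k - 1)) / u ^ ?h"
    using r u by (simp add: power_mult_distrib power_divide)
  also have "\<dots> \<le> (3 / r) ^ (2 * ?h) * m * C0 ^ (?h * (2 * k - 1)) / (c ^ q * t ^ 2)"
    using uh u0 c t r C by (intro divide_left_mono) (auto intro!: mult_pos_pos)
  finally show ?thesis by (simp only: divide_divide_eq_left)
qed

theorem theorem4p3:
  fixes H :: "'v ugraph" and k :: nat and \<theta> :: real
    and S :: "'a::euclidean_space set"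
    and \<mu> :: "'a measure" and m :: "'a \<Rightarrow> ennreal"
    and \<rho> :: "nat \<Rightarrow> real"
    and M :: "'w measure" and \<eta> :: "nat \<Rightarrow> 'w \<Rightarrow> 'a set"
    and N :: "nat \<Rightarrow> 'w \<Rightarrow> ennreal"
    and a \<gamma> :: real and A :: "nat \<Rightarrow> real"
  assumes H: "simple_graph H" "connected_graph H" "card (verts H) = k" "k \<ge> 2"
    and S: "\<theta> \<ge> 1" "S \<in> sets borel" "S = uminus ` S" "cball 0 1 \<subseteq> S" "S \<subseteq> cball 0 \<theta>"
    and \<mu>: "m \<in> borel_measurable borel" "\<mu> = density lborel m"
      "emeasure \<mu> UNIV \<noteq> 0" "\<And>B. compact B \<Longrightarrow> emeasure \<mu> B < \<infinity>"
    and \<rho>: "\<And>t. t \<ge> 1 \<Longrightarrow> \<rho> t > 0" "\<rho> \<longlonglongrightarrow> 0"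
    and M: "prob_space M"
    and \<eta>: "\<And>t. t \<ge> 1 \<Longrightarrow> poisson_process M (scale_measure (of_nat t) \<mu>) (\<eta> t)"
    and N: "\<And>t \<omega>. N t \<omega> = subgraph_count H ((\<lambda>x. \<rho> t *\<^sub>R x) ` S) (\<eta> t \<omega>)"
    and N_finite: "\<And>t. t \<ge> 1 \<Longrightarrow> AE \<omega> in M. N t \<omega> < \<infinity>"
    and i: "a > 0"
      "(\<lambda>t. prob_space.expectation M (\<lambda>\<omega>. enn2real (N t \<omega>)))
         \<sim>[sequentially] (\<lambda>t. a * real t ^ k * \<rho> t ^ (DIM('a) * (k - 1)))"
    and ii: "\<And>n. n \<in> {1..k} \<Longrightarrow> A n > 0"
      "(\<lambda>t. prob_space.variance M (\<lambda>\<omega>. enn2real (N t \<omega>)))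
         \<sim>[sequentially] (\<lambda>t. real t ^ k * \<rho> t ^ (DIM('a) * (k - 1))
                * (\<Sum>n=1..k. (real t * \<rho> t ^ DIM('a)) ^ (k - n) * A n))"
    and iii: "\<gamma> > 0"
      "liminf (\<lambda>t. ereal (real t powr (real k - \<gamma>) * \<rho> t ^ (DIM('a) * (k - 1)))) > 0"
  shows "AE \<omega> in M. (\<lambda>t. enn2real (N t \<omega>) / (real t ^ k * \<rho> t ^ (DIM('a) * (k - 1))))
           \<longlonglongrightarrow> a"
proof -
  interpret prob_space M by (rule M)
  have k: "1 \<le> k" "0 < k" using H(4) by auto
  define V where "V t = real t ^ k * \<rho> t ^ (DIM('a) * (k - 1))" for t
  define T where "T t = (\<lambda>x. \<rho> t *\<^sub>R x) ` S" for t
  define \<Lambda> where "\<Lambda> t = scale_measure (of_nat t) \<mu>" for t :: nat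
  define f where "f t = tuple_count H (T t)" for t
  define X where "X t \<omega> = tuple_sum k (f t) (\<eta> t \<omega>)" for t \<omega>
  define Y where "Y t \<omega> = enn2real (N t \<omega>)" for t \<omega>
  have NX: "N t \<omega> = X t \<omega> / of_nat (fact k)" for t \<omega>
    by (simp add: N X_def tuple_sum_def f_def T_def subgraph_count_eq H(3))
  \<comment> \<open>Valid also where the count is infinite: \<open>enn2real\<close> sends
    \<infinity> to 0, so both sides are 0 there.\<close>
  have XY: "enn2real (X t \<omega>) = fact k * Y t \<omega>" for t \<omega>
    unfolding Y_def NX by (subst enn2real_divide_of_nat) auto
  have X_finite: "AE \<omega> in M. X t \<omega> < \<infinity>" if "1 \<le> t" for t
    using N_finite[OF that]
  proof (rule AE_mp, intro AE_I2 impI)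
    fix \<omega> assume "N t \<omega> < \<infinity>"
    thus "X t \<omega> < \<infinity>" unfolding NX by (cases "X t \<omega>") (auto simp: ennreal_top_divide)
  qed
  have pp: "poisson_points M (\<Lambda> t) (\<eta> t)" if t: "1 \<le> t" for t
  proof
    show "poisson_process M (\<Lambda> t) (\<eta> t)" using \<eta>[OF t] by (simp add: \<Lambda>_def)
    show "sets (\<Lambda> t) = sets borel" by (simp add: \<Lambda>_def \<mu>(2))
    show "emeasure (\<Lambda> t) B < \<infinity>" if "bounded B" "B \<in> sets borel" for B
    proof -
      have "emeasure \<mu> B \<le> emeasure \<mu> (closure B)" by (intro emeasure_mono closure_subset) (simp add: \<mu>(2))
      also have "\<dots> < \<infinity>" using that by (intro \<mu>(4)) (simp add: compact_closure)
      finally show ?thesis by (simp add: \<Lambda>_def ennreal_mult_less_top of_nat_less_top)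
    qed
    show "emeasure (\<Lambda> t) {x} = 0" for x
    proof -
      have "{x} \<in> null_sets lborel" by (simp add: null_sets_def)
      moreover have "absolutely_continuous lborel \<mu>"
        unfolding \<mu>(2) using \<mu>(1) by (intro absolutely_continuousI_density) simp
      ultimately have "emeasure \<mu> {x} = 0" by (auto simp: absolutely_continuous_def)
      thus ?thesis by (simp add: \<Lambda>_def)
    qed
  qed
  have V0: "0 < V t" if "1 \<le> t" for t using \<rho>(1)[OF that] that by (simp add: V_def)
  have lim: "(\<lambda>t. expectation (Y t) / V t) \<longlonglongrightarrow> a"
  proof -
    have "(\<lambda>t. expectation (Y t)) \<sim>[sequentially] (\<lambda>t. a * V t)"
      using i(2) by (simp add: Y_def[abs_def] V_def mult.assoc)
    \<comment> \<open>Asymptotic equivalence counts 0/0 as 1. Since \<open>a * V t\<close> is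
      positive for \<open>t \<ge> 1\<close>, it becomes convergence of the plain quotient.\<close>
    moreover have "eventually (\<lambda>t. expectation (Y t) \<noteq> 0 \<or> a * V t \<noteq> 0) sequentially"
      using eventually_ge_at_top[of 1] by eventually_elim (use V0 i(1) in force)
    ultimately have "(\<lambda>t. expectation (Y t) / (a * V t)) \<longlonglongrightarrow> 1" by (rule asymp_equivD_strong)
    hence "(\<lambda>t. a * (expectation (Y t) / (a * V t))) \<longlonglongrightarrow> a * 1" by (intro tendsto_intros)
    thus ?thesis using i(1) by simp
  qed
  obtain c where c: "0 < c" "eventually (\<lambda>t. c < real t powr (real k - \<gamma>) * \<rho> t ^ (DIM('a) * (k - 1))) sequentially"
  proof -
    obtain y where y: "0 < ereal y" "ereal y < liminf (\<lambda>t. ereal (real t powr (real k - \<gamma>) * \<rho> t ^ (DIM('a) * (k - 1))))"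
      using ereal_dense2[OF iii(2)] by auto
    from less_LiminfD[OF y(2)] y(1) show ?thesis by (intro that[of y]) auto
  qed
  \<comment> \<open>From \<open>n0\<close> on \<open>c * t powr \<gamma>\<close> is at least 1. This
    will give \<open>V t \<ge> 1\<close>, needed because the moment bound requires
    \<open>B \<ge> 1\<close>.\<close>
  obtain n0 :: nat where n0: "(1 / c) powr (1 / \<gamma>) \<le> real n0" using real_arch_simple by blast
  have "eventually (\<lambda>t. 1 \<le> c * real t powr \<gamma>) sequentially"
    using eventually_ge_at_top[of n0]
  proof eventually_elim
    case (elim t)
    have "1 / c = ((1 / c) powr (1 / \<gamma>)) powr \<gamma>" using c(1) iii(1) by (simp add: powr_powr)
    also have "\<dots> \<le> real t powr \<gamma>" using n0 elim iii(1) by (intro powr_mono2) auto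
    finally show ?case using c(1) by (simp add: divide_le_eq mult.commute)
  qed
  moreover have "eventually (\<lambda>t. expectation (Y t) / V t > 0) sequentially"
    by (rule order_tendstoD(1)[OF lim i(1)])
  moreover have "eventually (\<lambda>t. expectation (Y t) / V t < 2 * a) sequentially"
    by (rule order_tendstoD(2)[OF lim]) (use i(1) in simp)
  ultimately have "eventually (\<lambda>t. 1 \<le> t \<and> integrable M (Y t) \<and> expectation (Y t) \<le> 2 * a * V t \<and>
      c * real t powr \<gamma> \<le> V t \<and> 1 \<le> V t) sequentially"
    using c(2) eventually_ge_at_top[of 1]
  proof eventually_elim
    case (elim t)
    note t = elim(5)
    \<comment> \<open>The Bochner integral of a non-integrable function is 0 by convention, so a
      positive expectation forces integrability.\<close>
    have "expectation (Y t) \<noteq> 0" using elim(2) by auto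
    hence "integrable M (Y t)" using not_integrable_integral_eq by blast
    moreover have "expectation (Y t) \<le> 2 * a * V t" using elim(3) V0[OF t] by (simp add: divide_less_eq)
    moreover have "c * real t powr \<gamma> \<le> V t"
    proof -
      have "c * real t powr \<gamma> \<le> real t powr (real k - \<gamma>) * \<rho> t ^ (DIM('a) * (k - 1)) * real t powr \<gamma>"
        using elim(4) by (intro mult_right_mono) auto
      also have "\<dots> = real t powr (real k - \<gamma> + \<gamma>) * \<rho> t ^ (DIM('a) * (k - 1))" by (simp only: powr_add mult_ac)
      also have "\<dots> = V t" using t by (simp add: V_def powr_realpow)
      finally show ?thesis .
    qed
    ultimately show ?case using t elim(1) by auto
  qed
  then obtain t0 where t0: "\<And>t. t0 \<le> t \<Longrightarrow> 1 \<le> t \<and> integrable M (Y t) \<and> expectation (Y t) \<le> 2 * a * V t \<and>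
      c * real t powr \<gamma> \<le> V t \<and> 1 \<le> V t" unfolding eventually_sequentially by blast
  define K where "K = max_copies H"
  \<comment> \<open>Locality gives \<open>R = k * k * (\<theta> * \<rho> t)\<close> and the slack
    for the cells is taken as \<open>d = \<rho> t\<close>; the ball of radius \<open>R + d\<close>
    then has radius \<open>s * \<rho> t\<close>.\<close>
  define s where "s = real (k * k) * \<theta> + 1"
  obtain P :: "'a set" where P: "finite P"
    "\<And>x r. 0 < r \<Longrightarrow> cball x (s * r) \<subseteq> (\<Union>p\<in>P. cball (x + r *\<^sub>R p) (r / 2))"
    using cball_covering[of s] by blast
  \<comment> \<open>Points of a ball of radius \<open>\<rho> t / 2\<close> are pairwise adjacent, so
    the \<open>k\<close>-th power of its intensity is at most \<open>fact k\<close> times the mean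
    count, hence at most \<open>fact k * (2 * a) * V t\<close>. Taking \<open>k\<close>-th roots
    produces \<open>c1\<close>.\<close>
  define c1 where "c1 = root k (fact k * (2 * a))"
  \<comment> \<open>A ball of radius \<open>s * \<rho> t\<close> is covered by \<open>card P\<close>
    small ones. The maximum with 1 keeps \<open>B = C0 * root k (V t)\<close> at least 1.\<close>
  define C0 where "C0 = max 1 (real (card P) * c1)"
  \<comment> \<open>The first entry bounds the coefficients of the polynomials; the second bounds
    the mean plus 1 relative to \<open>V t\<close>, by \<open>V t \<ge> 1\<close>.\<close>
  define D where "D = max (real (k ^ k * (K * K))) (fact k * (2 * a) + 1)"
  \<comment> \<open>Large enough for \<open>t powr (\<gamma> * q)\<close> to dominate
    \<open>t ^ 2\<close>. Taking \<open>h\<close> as a multiple of \<open>k\<close> makes the decay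
    an integral power of \<open>V t\<close>.\<close>
  define q where "q = nat \<lceil>2 / \<gamma>\<rceil>"
  define h where "h = k * q"
  have q: "2 \<le> \<gamma> * real q"
  proof -
    have "2 / \<gamma> \<le> real q" unfolding q_def by linarith
    thus ?thesis using iii(1) by (simp add: divide_le_eq mult.commute)
  qed
  have D0: "0 \<le> D" unfolding D_def by (intro max.coboundedI1) simp
  have mc: "0 \<le> moment_const h k D"
    unfolding moment_const_def using D0 one_le_poisson_moment_const[of "2 * h"] by simp
  have tail: "prob {\<omega> \<in> space M. r \<le> \<bar>enn2real (X t \<omega>) - expectation (\<lambda>\<omega>. enn2real (X t \<omega>))\<bar>}
      \<le> (3 / r) ^ (2 * h) * (moment_const h k D * (C0 * root k (V t)) ^ (h * (2 * k - 1)))"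
    if t: "t0 \<le> t" and r: "0 < r" for t r
  proof -
    note t1 = t0[OF t]
    interpret poisson_points M "\<Lambda> t" "\<eta> t" by (rule pp) (use t1 in simp)
    have \<rho>0: "0 < \<rho> t" using \<rho>(1) t1 by simp
    have T_borel: "T t \<in> sets borel"
    proof -
      have "(\<lambda>x. (1 / \<rho> t) *\<^sub>R x) -` S \<inter> space borel \<in> sets borel"
        by (rule measurable_sets[OF _ S(2)]) measurable
      also have "(\<lambda>x. (1 / \<rho> t) *\<^sub>R x) -` S \<inter> space borel = T t"
        using \<rho>0 by (force simp: T_def image_iff)
      finally show ?thesis .
    qed
    have T_sub: "T t \<subseteq> cball 0 (\<theta> * \<rho> t)"
    proof
      fix y assume "y \<in> T t"
      then obtain x where x: "x \<in> S" "y = \<rho> t *\<^sub>R x" by (auto simp: T_def)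
      hence "norm x \<le> \<theta>" using S(5) by auto
      thus "y \<in> cball 0 (\<theta> * \<rho> t)" using x \<rho>0 by (simp add: mult.commute mult_right_mono)
    qed
    have T_sup: "cball 0 (\<rho> t) \<subseteq> T t"
    proof
      fix y :: 'a assume y: "y \<in> cball 0 (\<rho> t)"
      have "(1 / \<rho> t) *\<^sub>R y \<in> cball 0 1" using y \<rho>0 by (simp add: divide_le_eq)
      hence "(1 / \<rho> t) *\<^sub>R y \<in> S" using S(4) by blast
      moreover have "y = \<rho> t *\<^sub>R ((1 / \<rho> t) *\<^sub>R y)" using \<rho>0 by simp
      ultimately show "y \<in> T t" unfolding T_def by blast
    qed
    have int: "integrable M (\<lambda>\<omega>. enn2real (tuple_sum k (f t) (\<eta> t \<omega>)))"
      using t1 by (simp add: XY X_def[symmetric])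
    have fin: "AE \<omega> in M. tuple_sum k (f t) (\<eta> t \<omega>) < \<infinity>" using X_finite[of t] t1 by (simp add: X_def)
    have EX: "expectation (\<lambda>\<omega>. enn2real (tuple_sum k (f t) (\<eta> t \<omega>))) \<le> fact k * (2 * a) * V t"
      using t1 by (simp add: XY X_def[symmetric] mult.assoc)
    have small: "measure (\<Lambda> t) (cball y (\<rho> t / 2)) \<le> c1 * root k (V t)" for y
    proof -
      have "measure (\<Lambda> t) (cball y (\<rho> t / 2)) ^ k \<le> expectation (\<lambda>\<omega>. enn2real (tuple_sum k (f t) (\<eta> t \<omega>)))"
      proof (rule measure_power_le_expectation[OF int fin])
        fix x assume x: "\<And>i. i < k \<Longrightarrow> x i \<in> cball y (\<rho> t / 2)"
        show "1 \<le> f t x"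
          unfolding f_def
        proof (rule tuple_count_complete[OF H(1,3) k(2)])
          fix i j assume "i < k" "j < k"
          hence "dist y (x i) \<le> \<rho> t / 2" "dist y (x j) \<le> \<rho> t / 2" using x by auto
          hence "dist (x i) (x j) \<le> \<rho> t" using dist_triangle3[of "x i" "x j" y] by simp
          hence "x i - x j \<in> cball 0 (\<rho> t)" by (simp add: dist_norm norm_minus_commute)
          thus "x i - x j \<in> T t" using T_sup by blast
        qed
      qed auto
      also have "\<dots> \<le> fact k * (2 * a) * V t" by (rule EX)
      finally have "root k (measure (\<Lambda> t) (cball y (\<rho> t / 2)) ^ k) \<le> root k (fact k * (2 * a) * V t)"
        using k by (intro real_root_le_mono) auto
      thus ?thesis using k by (simp add: real_root_power_cancel real_root_mult c1_def)
    qed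
    have root1: "1 \<le> root k (V t)" using t1 k by simp
    show ?thesis
      unfolding X_def
    proof (rule tuple_sum_tail[OF k(1) _ _ _ \<rho>0 _ _ _ int fin _ r])
      show "f t \<in> PiM {..<k} (\<lambda>_. borel) \<rightarrow>\<^sub>M count_space UNIV"
        using measurable_tuple_count[OF T_borel, of H] by (simp add: f_def H(3))
      show "f t x \<le> K" for x by (simp add: f_def K_def tuple_count_le_max)
      show "dist (x i) (x j) \<le> real (k * k) * (\<theta> * \<rho> t)" if "0 < f t x" "i < k" "j < k" for x i j
        using tuple_count_local[OF H(1,2,3) k(2) T_sub _ that(1)[unfolded f_def] that(2,3)] S(1) \<rho>0 by simp
      show "measure (\<Lambda> t) (cball x (real (k * k) * (\<theta> * \<rho> t) + \<rho> t)) \<le> C0 * root k (V t)" for x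
      proof -
        have "measure (\<Lambda> t) (cball x (s * \<rho> t)) \<le> real (card P) * (c1 * root k (V t))"
          by (rule measure_cball_covering[OF P(1) P(2)[OF \<rho>0] small])
        also have "\<dots> \<le> C0 * root k (V t)"
          unfolding mult.assoc[symmetric] using root1 by (intro mult_right_mono) (auto simp: C0_def)
        finally show ?thesis by (simp add: s_def algebra_simps)
      qed
      show "1 \<le> C0 * root k (V t)"
        using mult_mono[of 1 C0 1 "root k (V t)"] root1 by (simp add: C0_def)
      show "real (k ^ k * (K * K)) \<le> D" by (simp add: D_def)
      have "expectation (\<lambda>\<omega>. enn2real (tuple_sum k (f t) (\<eta> t \<omega>))) + 1 \<le> (fact k * (2 * a) + 1) * V t"
        using EX t1 by (simp add: algebra_simps)
      also have "\<dots> \<le> D * V t" using t1 by (intro mult_right_mono) (auto simp: D_def)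
      also have "\<dots> \<le> D * (C0 ^ k * V t)"
        using D0 t1 mult_right_mono[of 1 "C0 ^ k" "V t"] by (intro mult_left_mono) (auto simp: C0_def)
      also have "C0 ^ k * V t = (C0 * root k (V t)) ^ k"
        using t1 k by (simp add: power_mult_distrib real_root_pow_pos2)
      finally show "expectation (\<lambda>\<omega>. enn2real (tuple_sum k (f t) (\<eta> t \<omega>))) + 1 \<le> D * (C0 * root k (V t)) ^ k" .
    qed
  qed
  have "AE \<omega> in M. (\<lambda>t. (Y t \<omega> - expectation (Y t)) / V t) \<longlonglongrightarrow> 0"
  proof (rule AE_tendsto_0_if_summable_tails[of t0])
    show "(\<lambda>\<omega>. (Y t \<omega> - expectation (Y t)) / V t) \<in> borel_measurable M" if "t0 \<le> t" for t
    proof -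
      have [measurable]: "Y t \<in> borel_measurable M" using t0[OF that] by auto
      show ?thesis by measurable
    qed
    fix e :: real assume e: "0 < e"
    \<comment> \<open>Tails are known for \<open>X t\<close>, which is \<open>fact k\<close> times
      \<open>Y t\<close>; a deviation \<open>e\<close> of \<open>Y t / V t\<close> is a deviation
      \<open>fact k * e * V t\<close> of \<open>X t\<close>.\<close>
    define r where "r = fact k * e"
    have r: "0 < r" using e by (simp add: r_def)
    show "\<exists>C. \<forall>t\<ge>t0. prob {\<omega> \<in> space M. e \<le> \<bar>(Y t \<omega> - expectation (Y t)) / V t\<bar>} \<le> C / real t ^ 2"
    proof (intro exI allI impI)
      fix t assume t: "t0 \<le> t"
      note t1 = t0[OF t]
      have V: "0 < V t" "1 \<le> V t" using t1 by auto
      have "e \<le> \<bar>(Y t \<omega> - expectation (Y t)) / V t\<bar> \<longleftrightarrow>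
          r * V t \<le> \<bar>enn2real (X t \<omega>) - expectation (\<lambda>\<omega>. enn2real (X t \<omega>))\<bar>" for \<omega>
      proof -
        have "\<bar>enn2real (X t \<omega>) - expectation (\<lambda>\<omega>. enn2real (X t \<omega>))\<bar> = fact k * \<bar>Y t \<omega> - expectation (Y t)\<bar>"
          by (simp add: XY abs_mult flip: right_diff_distrib)
        thus ?thesis using V by (simp add: r_def abs_divide le_divide_eq mult.assoc)
      qed
      hence "prob {\<omega> \<in> space M. e \<le> \<bar>(Y t \<omega> - expectation (Y t)) / V t\<bar>}
        = prob {\<omega> \<in> space M. r * V t \<le> \<bar>enn2real (X t \<omega>) - expectation (\<lambda>\<omega>. enn2real (X t \<omega>))\<bar>}" by simp
      also have "\<dots> \<le> (3 / (r * V t)) ^ (2 * h) * (moment_const h k D * (C0 * root k (V t)) ^ (h * (2 * k - 1)))"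
        using V r by (intro tail t) simp
      also have "\<dots> \<le> ((3 / r) ^ (2 * h) * moment_const h k D * C0 ^ (h * (2 * k - 1)) / c ^ q) / real t ^ 2"
        unfolding h_def
        by (rule tail_algebra[OF k(1) _ _ _ c(1) _ q r mc[unfolded h_def]])
           (use t1 k in \<open>auto simp: C0_def real_root_pow_pos2\<close>)
      finally show "prob {\<omega> \<in> space M. e \<le> \<bar>(Y t \<omega> - expectation (Y t)) / V t\<bar>}
        \<le> ((3 / r) ^ (2 * h) * moment_const h k D * C0 ^ (h * (2 * k - 1)) / c ^ q) / real t ^ 2" .
    qed
  qed
  thus ?thesis
  proof (rule AE_mp, intro AE_I2 impI)
    fix \<omega> assume "(\<lambda>t. (Y t \<omega> - expectation (Y t)) / V t) \<longlonglongrightarrow> 0"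
    from tendsto_add[OF this lim] have "(\<lambda>t. Y t \<omega> / V t) \<longlonglongrightarrow> a" by (simp add: diff_divide_distrib)
    thus "(\<lambda>t. enn2real (N t \<omega>) / (real t ^ k * \<rho> t ^ (DIM('a) * (k - 1)))) \<longlonglongrightarrow> a"
      unfolding Y_def V_def .
  qed
qed

end
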